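(* (Fundamental Theorem for Hopf Modules) Let $(\mathcal V,\otimes,k,c)$ be a strict braided monoidal category with equalizers. For a $\mathcal C(\mathcal V)$-category $A$ with underlying class $X$, the following assertions are equivalent: (1) $A$ is a Hopf $\mathcal V$-category; (2) the pair of adjoint functors $(F,G)$ between $\mathcal D(X)$ and $\mathcal V(X)_A^A$ described in the context is a pair of inverse equivalences between the categories $\mathcal D(X)$ and $\mathcal V(X)_A^A$; (3) the functor $G:\mathcal V(X)_A^A\to\mathcal D(X)$ is fully faithful; (4) $\mathrm{can}^z_{x,y}$ is an isomorphism, for all $x,y,z\in X$; (5) $\mathrm{can}^x_{x,y}$ has a left inverse $f_{x,y}$ and $\mathrm{can}^y_{x,y}$ is an isomorphism, with inverse $g_{x,y}$, for all $x,y\in X$.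
   Context: $\mathcal V(X)$ is the category of families $(M_{x,y})_{x,y\in X}$ of objects of $\mathcal V$ with families of morphisms as morphisms. A $\mathcal C(\mathcal V)$-category $A$ with underlying class $X$ consists of coalgebras $(A_{x,y},\Delta_{x,y},\varepsilon_{x,y})$ in $\mathcal V$ and coalgebra morphisms $m_{x,y,z}:A_{x,y}\otimes A_{y,z}\to A_{x,z}$, $\eta_x:k\to A_{x,x}$ with $m_{x,y,t}\circ(\mathrm{id}\otimes m_{y,z,t})=m_{x,z,t}\circ(m_{x,y,z}\otimes\mathrm{id})$ and $m_{x,x,y}\circ(\eta_x\otimes\mathrm{id})=\mathrm{id}=m_{x,y,y}\circ(\mathrm{id}\otimes\eta_y)$; here $A_{x,y}\otimes A_{y,z}$ has comultiplication $(\mathrm{id}\otimes c_{A_{x,y},A_{y,z}}\otimes\mathrm{id})\circ(\Delta_{x,y}\otimes\Delta_{y,z})$. $A$ is a Hopf $\mathcal V$-category if there are morphisms $S_{x,y}:A_{x,y}\to A_{y,x}$ in $\mathcal V$ such that $m_{x,y,x}\circ(\mathrm{id}\otimes S_{x,y})\circ\Delta_{x,y}=\eta_x\circ\varepsilon_{x,y}$ and $m_{y,x,y}\circ(S_{x,y}\otimes\mathrm{id})\circ\Delta_{x,y}=\eta_y\circ\varepsilon_{x,y}$ for all $x,y\in X$. A Hopf module is an object $M\in\mathcal V(X)$ with a right $A$-module structure, i.e. morphisms $\psi_{x,y,z}:M_{x,y}\otimes A_{y,z}\to M_{x,z}$ with $\psi_{x,z,u}\circ(\psi_{x,y,z}\otimes\mathrm{id})=\psi_{x,y,u}\circ(\mathrm{id}\otimes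 m_{y,z,u})$ and $\psi_{x,y,y}\circ(\mathrm{id}\otimes\eta_y)=\mathrm{id}$, and with right $A_{x,y}$-comodule structures $\rho_{x,y}:M_{x,y}\to M_{x,y}\otimes A_{x,y}$ for all $x,y$, such that for all $x,y,z\in X$ $$\rho_{x,z}\circ\psi_{x,y,z}=(\psi_{x,y,z}\otimes m_{x,y,z})\circ(M_{x,y}\otimes c_{A_{x,y},A_{y,z}}\otimes A_{y,z})\circ(\rho_{x,y}\otimes\Delta_{y,z}).$$ Morphisms of Hopf modules are morphisms in $\mathcal V(X)$ commuting with the actions and coactions; they form the category $\mathcal V(X)_A^A$. $\mathcal D(X)$ is the category of families $(N_x)_{x\in X}$ of objects of $\mathcal V$, with families of morphisms $N_x\to N'_x$ as morphisms. $F:\mathcal D(X)\to\mathcal V(X)_A^A$: $F(N)_{x,y}=N_x\otimes A_{x,y}$, $\psi_{x,y,z}=N_x\otimes m_{x,y,z}$, $\rho_{x,y}=N_x\otimes\Delta_{x,y}$, $F(f)_{x,y}=f_x\otimes A_{x,y}$. $G:\mathcal V(X)_A^A\to\mathcal D(X)$: $G(M)_x=M^{\mathrm{co}A}_x$ is the equalizer (with canonical morphism $i:M^{\mathrm{co}A}_x\to M_{x,x}$) of $\rho_{x,x},\ M_{x,x}\otimes\eta_x:M_{x,x}\to M_{x,x}\otimes A_{x,x}$, and $G(g)_x$ is the morphism induced by $g_{x,x}$. $F$ is left adjoint to $G$, with unit $N_x\to GF(N)_x=(N_x\otimes A_{x,x})^{\mathrm{co}A_{x,x}}$ induced by $N_x\otimes\eta_x$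 and counit $\psi_{x,x,y}\circ(i\otimes A_{x,y}):M_x^{\mathrm{co}A}\otimes A_{x,y}\to M_{x,y}$. Canonical maps: for $x,y,z\in X$, $$\mathrm{can}^z_{x,y}=(m_{z,x,y}\otimes A_{x,y})\circ(A_{z,x}\otimes\Delta_{x,y}):A_{z,x}\otimes A_{x,y}\to A_{z,y}\otimes A_{x,y}.$$ (An object's name also denotes its identity morphism.) *)

theory Defs
  imports Main "HOL-Library.FuncSet"
begin

section \<open>Categories, functors, adjunctions\<close>

text \<open>
  A category is given by a set of objects and, for any two objects \<open>a\<close>, \<open>b\<close>, a set
  \<open>Hom C a b\<close>. Different hom-sets are allowed to overlap: an arrow need not determine its
  source and target, which are therefore always given explicitly. In particular a functor
  acts on arrows by a family of maps \<open>farr F a b\<close> from \<open>Hom C a b\<close> to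
  \<open>Hom D (F a) (F b)\<close>.
\<close>

record ('o, 'a) category =
  Obj :: "'o set"
  Hom :: "'o \<Rightarrow> 'o \<Rightarrow> 'a set"
  Ident :: "'o \<Rightarrow> 'a"  ("\<one>\<index>")
  Comp :: "'a \<Rightarrow> 'a \<Rightarrow> 'a"  (infixr "\<cdot>\<index>" 65)

locale category =
  fixes C :: "('o, 'a, 'z) category_scheme" (structure)
  assumes ident_hom: "a \<in> Obj C \<Longrightarrow> \<one> a \<in> Hom C a a"
    and comp_hom: "\<lbrakk>a \<in> Obj C; b \<in> Obj C; c \<in> Obj C; f \<in> Hom C a b; g \<in> Hom C b c\<rbrakk>
      \<Longrightarrow> g \<cdot> f \<in> Hom C a c"
    and comp_ident_right: "\<lbrakk>a \<in> Obj C; b \<in> Obj C; f \<in> Hom C a b\<rbrakk> \<Longrightarrow> f \<cdot> \<one> a = f"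
    and comp_ident_left: "\<lbrakk>a \<in> Obj C; b \<in> Obj C; f \<in> Hom C a b\<rbrakk> \<Longrightarrow> \<one> b \<cdot> f = f"
    and comp_assoc: "\<lbrakk>a \<in> Obj C; b \<in> Obj C; c \<in> Obj C; d \<in> Obj C;
        f \<in> Hom C a b; g \<in> Hom C b c; h \<in> Hom C c d\<rbrakk>
      \<Longrightarrow> (h \<cdot> g) \<cdot> f = h \<cdot> (g \<cdot> f)"

definition is_inverse ::
    "('o, 'a, 'z) category_scheme \<Rightarrow> 'o \<Rightarrow> 'o \<Rightarrow> 'a \<Rightarrow> 'a \<Rightarrow> bool" where
  "is_inverse C a b f g \<longleftrightarrow>
    g \<in> Hom C b a \<and> g \<cdot>\<^bsub>C\<^esub> f = \<one>\<^bsub>C\<^esub> a \<and> f \<cdot>\<^bsub>C\<^esub> g = \<one>\<^bsub>C\<^esub> b"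

definition is_left_inverse ::
    "('o, 'a, 'z) category_scheme \<Rightarrow> 'o \<Rightarrow> 'o \<Rightarrow> 'a \<Rightarrow> 'a \<Rightarrow> bool" where
  "is_left_inverse C a b f g \<longleftrightarrow> g \<in> Hom C b a \<and> g \<cdot>\<^bsub>C\<^esub> f = \<one>\<^bsub>C\<^esub> a"

definition is_iso :: "('o, 'a, 'z) category_scheme \<Rightarrow> 'o \<Rightarrow> 'o \<Rightarrow> 'a \<Rightarrow> bool" where
  "is_iso C a b f \<longleftrightarrow> f \<in> Hom C a b \<and> (\<exists>g. is_inverse C a b f g)"

definition is_equalizer ::
    "('o, 'a, 'z) category_scheme \<Rightarrow> 'o \<Rightarrow> 'o \<Rightarrow> 'a \<Rightarrow> 'a \<Rightarrow> 'o \<Rightarrow> 'a \<Rightarrow> bool" where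
  "is_equalizer C a b f g e i \<longleftrightarrow>
    e \<in> Obj C \<and> i \<in> Hom C e a \<and> f \<cdot>\<^bsub>C\<^esub> i = g \<cdot>\<^bsub>C\<^esub> i \<and>
    (\<forall>d \<in> Obj C. \<forall>h \<in> Hom C d a.
      f \<cdot>\<^bsub>C\<^esub> h = g \<cdot>\<^bsub>C\<^esub> h \<longrightarrow> (\<exists>!u. u \<in> Hom C d e \<and> i \<cdot>\<^bsub>C\<^esub> u = h))"

definition has_equalizers :: "('o, 'a, 'z) category_scheme \<Rightarrow> bool" where
  "has_equalizers C \<longleftrightarrow>
    (\<forall>a \<in> Obj C. \<forall>b \<in> Obj C. \<forall>f \<in> Hom C a b. \<forall>g \<in> Hom C a b.
      \<exists>e i. is_equalizer C a b f g e i)"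

record ('o, 'a, 'p, 'b) cfunctor =
  fobj :: "'o \<Rightarrow> 'p"
  farr :: "'o \<Rightarrow> 'o \<Rightarrow> 'a \<Rightarrow> 'b"

locale is_functor = C: category C + D: category D
  for C :: "('o, 'a, 'y) category_scheme"
    and D :: "('p, 'b, 'z) category_scheme"
    and F :: "('o, 'a, 'p, 'b) cfunctor" +
  assumes fobj_Obj: "a \<in> Obj C \<Longrightarrow> fobj F a \<in> Obj D"
    and farr_Hom: "\<lbrakk>a \<in> Obj C; b \<in> Obj C; f \<in> Hom C a b\<rbrakk>
      \<Longrightarrow> farr F a b f \<in> Hom D (fobj F a) (fobj F b)"
    and farr_ident: "a \<in> Obj C \<Longrightarrow> farr F a a (\<one>\<^bsub>C\<^esub> a) = \<one>\<^bsub>D\<^esub> (fobj F a)"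
    and farr_comp: "\<lbrakk>a \<in> Obj C; b \<in> Obj C; c \<in> Obj C; f \<in> Hom C a b; g \<in> Hom C b c\<rbrakk>
      \<Longrightarrow> farr F a c (g \<cdot>\<^bsub>C\<^esub> f) = farr F b c g \<cdot>\<^bsub>D\<^esub> farr F a b f"

definition fully_faithful ::
    "('o, 'a, 'y) category_scheme \<Rightarrow> ('p, 'b, 'z) category_scheme
      \<Rightarrow> ('o, 'a, 'p, 'b) cfunctor \<Rightarrow> bool" where
  "fully_faithful C D F \<longleftrightarrow> is_functor C D F \<and>
    (\<forall>a \<in> Obj C. \<forall>b \<in> Obj C.
      bij_betw (farr F a b) (Hom C a b) (Hom D (fobj F a) (fobj F b)))"

definition id_functor :: "('o, 'a, 'o, 'a) cfunctor" where
  "id_functor = \<lparr>fobj = (\<lambda>a. a), farr = (\<lambda>a b f. f)\<rparr>"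

definition comp_functor ::
    "('p, 'b, 'q, 'c) cfunctor \<Rightarrow> ('o, 'a, 'p, 'b) cfunctor \<Rightarrow> ('o, 'a, 'q, 'c) cfunctor" where
  "comp_functor G F =
    \<lparr>fobj = (\<lambda>a. fobj G (fobj F a)),
     farr = (\<lambda>a b f. farr G (fobj F a) (fobj F b) (farr F a b f))\<rparr>"

locale natural_transformation = F: is_functor C D F + G: is_functor C D G
  for C :: "('o, 'a, 'y) category_scheme"
    and D :: "('p, 'b, 'z) category_scheme"
    and F G :: "('o, 'a, 'p, 'b) cfunctor"
    and \<tau> :: "'o \<Rightarrow> 'b" +
  assumes component_Hom: "a \<in> Obj C \<Longrightarrow> \<tau> a \<in> Hom D (fobj F a) (fobj G a)"
    and naturality: "\<lbrakk>a \<in> Obj C; b \<in> Obj C; f \<in> Hom C a b\<rbrakk>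
      \<Longrightarrow> \<tau> b \<cdot>\<^bsub>D\<^esub> farr F a b f = farr G a b f \<cdot>\<^bsub>D\<^esub> \<tau> a"

locale adjunction =
  F: is_functor C D F + G: is_functor D C G +
  unit: natural_transformation C C id_functor "comp_functor G F" \<eta> +
  counit: natural_transformation D D "comp_functor F G" id_functor \<epsilon>
  for C :: "('o, 'a, 'y) category_scheme"
    and D :: "('p, 'b, 'z) category_scheme"
    and F :: "('o, 'a, 'p, 'b) cfunctor"
    and G :: "('p, 'b, 'o, 'a) cfunctor"
    and \<eta> :: "'o \<Rightarrow> 'a"
    and \<epsilon> :: "'p \<Rightarrow> 'b" +
  assumes triangle_F: "a \<in> Obj C \<Longrightarrow>
      \<epsilon> (fobj F a) \<cdot>\<^bsub>D\<^esub> farr F a (fobj G (fobj F a)) (\<eta> a) = \<one>\<^bsub>D\<^esub> (fobj F a)"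
    and triangle_G: "d \<in> Obj D \<Longrightarrow>
      farr G (fobj F (fobj G d)) d (\<epsilon> d) \<cdot>\<^bsub>C\<^esub> \<eta> (fobj G d) = \<one>\<^bsub>C\<^esub> (fobj G d)"

text \<open>
  An adjoint pair \<open>(F, G)\<close> is a pair of inverse equivalences when the unit and the counit of
  the adjunction are natural isomorphisms.
\<close>

locale inverse_equivalences = adjunction +
  assumes unit_iso: "a \<in> Obj C \<Longrightarrow> is_iso C a (fobj G (fobj F a)) (\<eta> a)"
    and counit_iso: "d \<in> Obj D \<Longrightarrow> is_iso D (fobj F (fobj G d)) d (\<epsilon> d)"

section \<open>Strict braided monoidal categories\<close>

record ('o, 'a) monoidal_category = "('o, 'a) category" +
  tensor_obj :: "'o \<Rightarrow> 'o \<Rightarrow> 'o"  (infixr "\<otimes>\<^sub>o\<index>" 70)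
  tensor_arr :: "'a \<Rightarrow> 'a \<Rightarrow> 'a"  (infixr "\<otimes>\<index>" 70)
  unit_obj :: 'o  ("\<k>\<index>")

locale strict_monoidal_category = category V
  for V :: "('o, 'a, 'z) monoidal_category_scheme" (structure) +
  assumes unit_obj_Obj: "\<k> \<in> Obj V"
    and tensor_Obj: "\<lbrakk>a \<in> Obj V; b \<in> Obj V\<rbrakk> \<Longrightarrow> a \<otimes>\<^sub>o b \<in> Obj V"
    and tensor_Hom: "\<lbrakk>a \<in> Obj V; b \<in> Obj V; c \<in> Obj V; d \<in> Obj V;
        f \<in> Hom V a b; g \<in> Hom V c d\<rbrakk>
      \<Longrightarrow> f \<otimes> g \<in> Hom V (a \<otimes>\<^sub>o c) (b \<otimes>\<^sub>o d)"
    and tensor_ident: "\<lbrakk>a \<in> Obj V; b \<in> Obj V\<rbrakk> \<Longrightarrow> \<one> a \<otimes> \<one> b = \<one> (a \<otimes>\<^sub>o b)"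
    and tensor_comp: "\<lbrakk>a \<in> Obj V; b \<in> Obj V; c \<in> Obj V; a' \<in> Obj V; b' \<in> Obj V; c' \<in> Obj V;
        f \<in> Hom V a b; g \<in> Hom V b c; f' \<in> Hom V a' b'; g' \<in> Hom V b' c'\<rbrakk>
      \<Longrightarrow> (g \<cdot> f) \<otimes> (g' \<cdot> f') = (g \<otimes> g') \<cdot> (f \<otimes> f')"
    and tensor_obj_assoc: "\<lbrakk>a \<in> Obj V; b \<in> Obj V; c \<in> Obj V\<rbrakk>
      \<Longrightarrow> (a \<otimes>\<^sub>o b) \<otimes>\<^sub>o c = a \<otimes>\<^sub>o (b \<otimes>\<^sub>o c)"
    and tensor_arr_assoc: "\<lbrakk>a \<in> Obj V; b \<in> Obj V; c \<in> Obj V;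
        a' \<in> Obj V; b' \<in> Obj V; c' \<in> Obj V;
        f \<in> Hom V a a'; g \<in> Hom V b b'; h \<in> Hom V c c'\<rbrakk>
      \<Longrightarrow> (f \<otimes> g) \<otimes> h = f \<otimes> (g \<otimes> h)"
    and unit_tensor_obj: "a \<in> Obj V \<Longrightarrow> \<k> \<otimes>\<^sub>o a = a"
    and tensor_unit_obj: "a \<in> Obj V \<Longrightarrow> a \<otimes>\<^sub>o \<k> = a"
    and unit_tensor_arr: "\<lbrakk>a \<in> Obj V; b \<in> Obj V; f \<in> Hom V a b\<rbrakk> \<Longrightarrow> \<one> \<k> \<otimes> f = f"
    and tensor_unit_arr: "\<lbrakk>a \<in> Obj V; b \<in> Obj V; f \<in> Hom V a b\<rbrakk> \<Longrightarrow> f \<otimes> \<one> \<k> = f"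

record ('o, 'a) braided_category = "('o, 'a) monoidal_category" +
  braid :: "'o \<Rightarrow> 'o \<Rightarrow> 'a"  ("\<c>\<index>")

locale strict_braided_monoidal_category = strict_monoidal_category V
  for V :: "('o, 'a, 'z) braided_category_scheme" (structure) +
  assumes braid_iso: "\<lbrakk>a \<in> Obj V; b \<in> Obj V\<rbrakk>
      \<Longrightarrow> is_iso V (a \<otimes>\<^sub>o b) (b \<otimes>\<^sub>o a) (\<c> a b)"
    and braid_natural: "\<lbrakk>a \<in> Obj V; b \<in> Obj V; a' \<in> Obj V; b' \<in> Obj V;
        f \<in> Hom V a a'; g \<in> Hom V b b'\<rbrakk>
      \<Longrightarrow> \<c> a' b' \<cdot> (f \<otimes> g) = (g \<otimes> f) \<cdot> \<c> a b"
    and hexagon_right: "\<lbrakk>a \<in> Obj V; b \<in> Obj V; c \<in> Obj V\<rbrakk>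
      \<Longrightarrow> \<c> a (b \<otimes>\<^sub>o c) = (\<one> b \<otimes> \<c> a c) \<cdot> (\<c> a b \<otimes> \<one> c)"
    and hexagon_left: "\<lbrakk>a \<in> Obj V; b \<in> Obj V; c \<in> Obj V\<rbrakk>
      \<Longrightarrow> \<c> (a \<otimes>\<^sub>o b) c = (\<c> a c \<otimes> \<one> b) \<cdot> (\<one> a \<otimes> \<c> b c)"

section \<open>Coalgebras\<close>

record ('o, 'a) coalgebra =
  carr :: 'o
  comul :: 'a
  counit :: 'a

locale coalgebra =
  fixes V :: "('o, 'a, 'z) monoidal_category_scheme" (structure)
    and C :: "('o, 'a) coalgebra"
  assumes carr_Obj: "carr C \<in> Obj V"
    and comul_Hom: "comul C \<in> Hom V (carr C) (carr C \<otimes>\<^sub>o carr C)"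
    and counit_Hom: "counit C \<in> Hom V (carr C) \<k>"
    and coassoc: "(comul C \<otimes> \<one> (carr C)) \<cdot> comul C = (\<one> (carr C) \<otimes> comul C) \<cdot> comul C"
    and counit_left: "(counit C \<otimes> \<one> (carr C)) \<cdot> comul C = \<one> (carr C)"
    and counit_right: "(\<one> (carr C) \<otimes> counit C) \<cdot> comul C = \<one> (carr C)"

definition coalgebra_hom ::
    "('o, 'a, 'z) monoidal_category_scheme \<Rightarrow> ('o, 'a) coalgebra \<Rightarrow> ('o, 'a) coalgebra
      \<Rightarrow> 'a set" where
  "coalgebra_hom V C D = {f \<in> Hom V (carr C) (carr D).
    comul D \<cdot>\<^bsub>V\<^esub> f = (f \<otimes>\<^bsub>V\<^esub> f) \<cdot>\<^bsub>V\<^esub> comul C \<and> counit D \<cdot>\<^bsub>V\<^esub> f = counit C}"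

definition unit_coalgebra :: "('o, 'a, 'z) monoidal_category_scheme \<Rightarrow> ('o, 'a) coalgebra" where
  "unit_coalgebra V =
    \<lparr>carr = \<k>\<^bsub>V\<^esub>, comul = \<one>\<^bsub>V\<^esub> \<k>\<^bsub>V\<^esub>, counit = \<one>\<^bsub>V\<^esub> \<k>\<^bsub>V\<^esub>\<rparr>"

definition tensor_coalgebra ::
    "('o, 'a, 'z) braided_category_scheme \<Rightarrow> ('o, 'a) coalgebra \<Rightarrow> ('o, 'a) coalgebra
      \<Rightarrow> ('o, 'a) coalgebra" where
  "tensor_coalgebra V C D =
    \<lparr>carr = carr C \<otimes>\<^sub>o\<^bsub>V\<^esub> carr D,
     comul = (\<one>\<^bsub>V\<^esub> (carr C) \<otimes>\<^bsub>V\<^esub> \<c>\<^bsub>V\<^esub> (carr C) (carr D) \<otimes>\<^bsub>V\<^esub> \<one>\<^bsub>V\<^esub> (carr D))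
       \<cdot>\<^bsub>V\<^esub> (comul C \<otimes>\<^bsub>V\<^esub> comul D),
     counit = counit C \<otimes>\<^bsub>V\<^esub> counit D\<rparr>"

section \<open>Categories enriched over coalgebras and Hopf categories\<close>

record ('x, 'o, 'a) cv_category =
  base :: "'x set"
  coalg :: "'x \<Rightarrow> 'x \<Rightarrow> ('o, 'a) coalgebra"
  mult :: "'x \<Rightarrow> 'x \<Rightarrow> 'x \<Rightarrow> 'a"
  unity :: "'x \<Rightarrow> 'a"

abbreviation ob :: "('x, 'o, 'a) cv_category \<Rightarrow> 'x \<Rightarrow> 'x \<Rightarrow> 'o" where
  "ob A x y \<equiv> carr (coalg A x y)"

locale cv_category =
  fixes V :: "('o, 'a, 'z) braided_category_scheme" (structure)
    and A :: "('x, 'o, 'a) cv_category"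
  assumes coalg: "\<lbrakk>x \<in> base A; y \<in> base A\<rbrakk> \<Longrightarrow> coalgebra V (coalg A x y)"
    and mult_hom: "\<lbrakk>x \<in> base A; y \<in> base A; z \<in> base A\<rbrakk> \<Longrightarrow>
      mult A x y z \<in>
        coalgebra_hom V (tensor_coalgebra V (coalg A x y) (coalg A y z)) (coalg A x z)"
    and unity_hom: "x \<in> base A \<Longrightarrow>
      unity A x \<in> coalgebra_hom V (unit_coalgebra V) (coalg A x x)"
    and mult_assoc: "\<lbrakk>x \<in> base A; y \<in> base A; z \<in> base A; t \<in> base A\<rbrakk> \<Longrightarrow>
      mult A x y t \<cdot> (\<one> (ob A x y) \<otimes> mult A y z t) =
      mult A x z t \<cdot> (mult A x y z \<otimes> \<one> (ob A z t))"
    and unity_mult: "\<lbrakk>x \<in> base A; y \<in> base A\<rbrakk> \<Longrightarrow>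
      mult A x x y \<cdot> (unity A x \<otimes> \<one> (ob A x y)) = \<one> (ob A x y)"
    and mult_unity: "\<lbrakk>x \<in> base A; y \<in> base A\<rbrakk> \<Longrightarrow>
      mult A x y y \<cdot> (\<one> (ob A x y) \<otimes> unity A y) = \<one> (ob A x y)"

definition is_antipode ::
    "('o, 'a, 'z) braided_category_scheme \<Rightarrow> ('x, 'o, 'a) cv_category
      \<Rightarrow> ('x \<Rightarrow> 'x \<Rightarrow> 'a) \<Rightarrow> bool" where
  "is_antipode V A S \<longleftrightarrow> (\<forall>x \<in> base A. \<forall>y \<in> base A.
    S x y \<in> Hom V (ob A x y) (ob A y x) \<and>
    mult A x y x \<cdot>\<^bsub>V\<^esub> (\<one>\<^bsub>V\<^esub> (ob A x y) \<otimes>\<^bsub>V\<^esub> S x y) \<cdot>\<^bsub>V\<^esub> comul (coalg A x y)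
      = unity A x \<cdot>\<^bsub>V\<^esub> counit (coalg A x y) \<and>
    mult A y x y \<cdot>\<^bsub>V\<^esub> (S x y \<otimes>\<^bsub>V\<^esub> \<one>\<^bsub>V\<^esub> (ob A x y)) \<cdot>\<^bsub>V\<^esub> comul (coalg A x y)
      = unity A y \<cdot>\<^bsub>V\<^esub> counit (coalg A x y))"

definition hopf_category ::
    "('o, 'a, 'z) braided_category_scheme \<Rightarrow> ('x, 'o, 'a) cv_category \<Rightarrow> bool" where
  "hopf_category V A \<longleftrightarrow> cv_category V A \<and> (\<exists>S. is_antipode V A S)"

section \<open>The category of families and the category of Hopf modules\<close>

text \<open>
  Families indexed by \<open>X\<close> are extensional functions (equal to \<^const>\<open>undefined\<close> outside
  \<open>X\<close>), so that two families are equal if and only if all their members are.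
\<close>

definition family_category ::
    "('o, 'a, 'z) category_scheme \<Rightarrow> 'x set \<Rightarrow> ('x \<Rightarrow> 'o, 'x \<Rightarrow> 'a) category" where
  "family_category V X =
    \<lparr>Obj = (\<Pi>\<^sub>E x \<in> X. Obj V),
     Hom = (\<lambda>M N. \<Pi>\<^sub>E x \<in> X. Hom V (M x) (N x)),
     Ident = (\<lambda>M. \<lambda>x \<in> X. \<one>\<^bsub>V\<^esub> (M x)),
     Comp = (\<lambda>g f. \<lambda>x \<in> X. g x \<cdot>\<^bsub>V\<^esub> f x)\<rparr>"

record ('x, 'o, 'a) hopf_module =
  mob :: "'x \<Rightarrow> 'x \<Rightarrow> 'o"
  act :: "'x \<Rightarrow> 'x \<Rightarrow> 'x \<Rightarrow> 'a"
  coact :: "'x \<Rightarrow> 'x \<Rightarrow> 'a"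

locale hopf_module =
  fixes V :: "('o, 'a, 'z) braided_category_scheme" (structure)
    and A :: "('x, 'o, 'a) cv_category"
    and M :: "('x, 'o, 'a) hopf_module"
  assumes mob_Obj: "mob M \<in> (\<Pi>\<^sub>E x \<in> base A. \<Pi>\<^sub>E y \<in> base A. Obj V)"
    and act_Hom: "act M \<in> (\<Pi>\<^sub>E x \<in> base A. \<Pi>\<^sub>E y \<in> base A. \<Pi>\<^sub>E z \<in> base A.
        Hom V (mob M x y \<otimes>\<^sub>o ob A y z) (mob M x z))"
    and coact_Hom: "coact M \<in> (\<Pi>\<^sub>E x \<in> base A. \<Pi>\<^sub>E y \<in> base A.
        Hom V (mob M x y) (mob M x y \<otimes>\<^sub>o ob A x y))"
    and act_assoc: "\<lbrakk>x \<in> base A; y \<in> base A; z \<in> base A; u \<in> base A\<rbrakk> \<Longrightarrow>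
      act M x z u \<cdot> (act M x y z \<otimes> \<one> (ob A z u)) =
      act M x y u \<cdot> (\<one> (mob M x y) \<otimes> mult A y z u)"
    and act_unity: "\<lbrakk>x \<in> base A; y \<in> base A\<rbrakk> \<Longrightarrow>
      act M x y y \<cdot> (\<one> (mob M x y) \<otimes> unity A y) = \<one> (mob M x y)"
    and coact_coassoc: "\<lbrakk>x \<in> base A; y \<in> base A\<rbrakk> \<Longrightarrow>
      (coact M x y \<otimes> \<one> (ob A x y)) \<cdot> coact M x y =
      (\<one> (mob M x y) \<otimes> comul (coalg A x y)) \<cdot> coact M x y"
    and coact_counit: "\<lbrakk>x \<in> base A; y \<in> base A\<rbrakk> \<Longrightarrow>
      (\<one> (mob M x y) \<otimes> counit (coalg A x y)) \<cdot> coact M x y = \<one> (mob M x y)"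
    and compatibility: "\<lbrakk>x \<in> base A; y \<in> base A; z \<in> base A\<rbrakk> \<Longrightarrow>
      coact M x z \<cdot> act M x y z =
      (act M x y z \<otimes> mult A x y z)
        \<cdot> (\<one> (mob M x y) \<otimes> \<c> (ob A x y) (ob A y z) \<otimes> \<one> (ob A y z))
        \<cdot> (coact M x y \<otimes> comul (coalg A y z))"

definition hopf_module_hom ::
    "('o, 'a, 'z) braided_category_scheme \<Rightarrow> ('x, 'o, 'a) cv_category
      \<Rightarrow> ('x, 'o, 'a) hopf_module \<Rightarrow> ('x, 'o, 'a) hopf_module \<Rightarrow> ('x \<Rightarrow> 'x \<Rightarrow> 'a) set" where
  "hopf_module_hom V A M N =
    {f \<in> (\<Pi>\<^sub>E x \<in> base A. \<Pi>\<^sub>E y \<in> base A. Hom V (mob M x y) (mob N x y)).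
      (\<forall>x \<in> base A. \<forall>y \<in> base A. \<forall>z \<in> base A.
        f x z \<cdot>\<^bsub>V\<^esub> act M x y z = act N x y z \<cdot>\<^bsub>V\<^esub> (f x y \<otimes>\<^bsub>V\<^esub> \<one>\<^bsub>V\<^esub> (ob A y z))) \<and>
      (\<forall>x \<in> base A. \<forall>y \<in> base A.
        coact N x y \<cdot>\<^bsub>V\<^esub> f x y = (f x y \<otimes>\<^bsub>V\<^esub> \<one>\<^bsub>V\<^esub> (ob A x y)) \<cdot>\<^bsub>V\<^esub> coact M x y)}"

definition hopf_module_category ::
    "('o, 'a, 'z) braided_category_scheme \<Rightarrow> ('x, 'o, 'a) cv_category
      \<Rightarrow> (('x, 'o, 'a) hopf_module, 'x \<Rightarrow> 'x \<Rightarrow> 'a) category" where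
  "hopf_module_category V A =
    \<lparr>Obj = {M. hopf_module V A M},
     Hom = hopf_module_hom V A,
     Ident = (\<lambda>M. \<lambda>x \<in> base A. \<lambda>y \<in> base A. \<one>\<^bsub>V\<^esub> (mob M x y)),
     Comp = (\<lambda>g f. \<lambda>x \<in> base A. \<lambda>y \<in> base A. g x y \<cdot>\<^bsub>V\<^esub> f x y)\<rparr>"

section \<open>The adjoint pair and the canonical maps\<close>

definition free_module ::
    "('o, 'a, 'z) braided_category_scheme \<Rightarrow> ('x, 'o, 'a) cv_category
      \<Rightarrow> ('x \<Rightarrow> 'o) \<Rightarrow> ('x, 'o, 'a) hopf_module" where
  "free_module V A N =
    \<lparr>mob = (\<lambda>x \<in> base A. \<lambda>y \<in> base A. N x \<otimes>\<^sub>o\<^bsub>V\<^esub> ob A x y),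
     act = (\<lambda>x \<in> base A. \<lambda>y \<in> base A. \<lambda>z \<in> base A. \<one>\<^bsub>V\<^esub> (N x) \<otimes>\<^bsub>V\<^esub> mult A x y z),
     coact = (\<lambda>x \<in> base A. \<lambda>y \<in> base A. \<one>\<^bsub>V\<^esub> (N x) \<otimes>\<^bsub>V\<^esub> comul (coalg A x y))\<rparr>"

definition F_functor ::
    "('o, 'a, 'z) braided_category_scheme \<Rightarrow> ('x, 'o, 'a) cv_category
      \<Rightarrow> ('x \<Rightarrow> 'o, 'x \<Rightarrow> 'a, ('x, 'o, 'a) hopf_module, 'x \<Rightarrow> 'x \<Rightarrow> 'a) cfunctor" where
  "F_functor V A =
    \<lparr>fobj = free_module V A,
     farr = (\<lambda>N N' f. \<lambda>x \<in> base A. \<lambda>y \<in> base A. f x \<otimes>\<^bsub>V\<^esub> \<one>\<^bsub>V\<^esub> (ob A x y))\<rparr>"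

text \<open>
  Equalizers are unique only up to isomorphism; one equalizer per Hopf module and index is
  selected by Hilbert choice.
\<close>

definition coinv ::
    "('o, 'a, 'z) braided_category_scheme \<Rightarrow> ('x, 'o, 'a) cv_category
      \<Rightarrow> ('x, 'o, 'a) hopf_module \<Rightarrow> 'x \<Rightarrow> 'o \<times> 'a" where
  "coinv V A M x = (SOME (e, i).
    is_equalizer V (mob M x x) (mob M x x \<otimes>\<^sub>o\<^bsub>V\<^esub> ob A x x)
      (coact M x x) (\<one>\<^bsub>V\<^esub> (mob M x x) \<otimes>\<^bsub>V\<^esub> unity A x) e i)"

abbreviation coinv_obj ::
    "('o, 'a, 'z) braided_category_scheme \<Rightarrow> ('x, 'o, 'a) cv_category
      \<Rightarrow> ('x, 'o, 'a) hopf_module \<Rightarrow> 'x \<Rightarrow> 'o" where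
  "coinv_obj V A M x \<equiv> fst (coinv V A M x)"

abbreviation coinv_incl ::
    "('o, 'a, 'z) braided_category_scheme \<Rightarrow> ('x, 'o, 'a) cv_category
      \<Rightarrow> ('x, 'o, 'a) hopf_module \<Rightarrow> 'x \<Rightarrow> 'a" where
  "coinv_incl V A M x \<equiv> snd (coinv V A M x)"

text \<open>
  The arrow from \<open>d\<close> to the coinvariants of \<open>M\<close> at \<open>x\<close> induced by an arrow \<open>h\<close> from \<open>d\<close> to
  \<open>M\<^sub>x\<^sub>,\<^sub>x\<close> that equalizes the two arrows defining the coinvariants.
\<close>

definition coinv_lift ::
    "('o, 'a, 'z) braided_category_scheme \<Rightarrow> ('x, 'o, 'a) cv_category
      \<Rightarrow> ('x, 'o, 'a) hopf_module \<Rightarrow> 'x \<Rightarrow> 'o \<Rightarrow> 'a \<Rightarrow> 'a" where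
  "coinv_lift V A M x d h =
    (THE u. u \<in> Hom V d (coinv_obj V A M x) \<and> coinv_incl V A M x \<cdot>\<^bsub>V\<^esub> u = h)"

definition G_functor ::
    "('o, 'a, 'z) braided_category_scheme \<Rightarrow> ('x, 'o, 'a) cv_category
      \<Rightarrow> (('x, 'o, 'a) hopf_module, 'x \<Rightarrow> 'x \<Rightarrow> 'a, 'x \<Rightarrow> 'o, 'x \<Rightarrow> 'a) cfunctor" where
  "G_functor V A =
    \<lparr>fobj = (\<lambda>M. \<lambda>x \<in> base A. coinv_obj V A M x),
     farr = (\<lambda>M M' g. \<lambda>x \<in> base A.
       coinv_lift V A M' x (coinv_obj V A M x) (g x x \<cdot>\<^bsub>V\<^esub> coinv_incl V A M x))\<rparr>"

definition FG_unit ::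
    "('o, 'a, 'z) braided_category_scheme \<Rightarrow> ('x, 'o, 'a) cv_category
      \<Rightarrow> ('x \<Rightarrow> 'o) \<Rightarrow> 'x \<Rightarrow> 'a" where
  "FG_unit V A N = (\<lambda>x \<in> base A.
    coinv_lift V A (free_module V A N) x (N x) (\<one>\<^bsub>V\<^esub> (N x) \<otimes>\<^bsub>V\<^esub> unity A x))"

definition FG_counit ::
    "('o, 'a, 'z) braided_category_scheme \<Rightarrow> ('x, 'o, 'a) cv_category
      \<Rightarrow> ('x, 'o, 'a) hopf_module \<Rightarrow> 'x \<Rightarrow> 'x \<Rightarrow> 'a" where
  "FG_counit V A M = (\<lambda>x \<in> base A. \<lambda>y \<in> base A.
    act M x x y \<cdot>\<^bsub>V\<^esub> (coinv_incl V A M x \<otimes>\<^bsub>V\<^esub> \<one>\<^bsub>V\<^esub> (ob A x y)))"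

definition can ::
    "('o, 'a, 'z) braided_category_scheme \<Rightarrow> ('x, 'o, 'a) cv_category
      \<Rightarrow> 'x \<Rightarrow> 'x \<Rightarrow> 'x \<Rightarrow> 'a" where
  "can V A z x y =
    (mult A z x y \<otimes>\<^bsub>V\<^esub> \<one>\<^bsub>V\<^esub> (ob A x y)) \<cdot>\<^bsub>V\<^esub> (\<one>\<^bsub>V\<^esub> (ob A z x) \<otimes>\<^bsub>V\<^esub> comul (coalg A x y))"

abbreviation can_dom ::
    "('o, 'a, 'z) braided_category_scheme \<Rightarrow> ('x, 'o, 'a) cv_category
      \<Rightarrow> 'x \<Rightarrow> 'x \<Rightarrow> 'x \<Rightarrow> 'o" where
  "can_dom V A z x y \<equiv> ob A z x \<otimes>\<^sub>o\<^bsub>V\<^esub> ob A x y"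

abbreviation can_cod ::
    "('o, 'a, 'z) braided_category_scheme \<Rightarrow> ('x, 'o, 'a) cv_category
      \<Rightarrow> 'x \<Rightarrow> 'x \<Rightarrow> 'x \<Rightarrow> 'o" where
  "can_cod V A z x y \<equiv> ob A z y \<otimes>\<^sub>o\<^bsub>V\<^esub> ob A x y"

end

theory Submission
  imports Defs
begin

text \<open>
  The unit of the adjunction is always invertible, because \<open>N\<^sub>x \<otimes> \<eta>\<^sub>x\<close> is a split equalizer. Hence the
  adjunction is an equivalence iff its counit is invertible, which for any adjunction amounts to
  \<open>G\<close> being fully faithful. With an antipode, \<open>m \<mapsto> m\<^sub>0 S(m\<^sub>1)\<close> takes values in the coinvariants and
  \<open>m \<mapsto> m\<^sub>0 S(m\<^sub>1) \<otimes> m\<^sub>2\<close> inverts the counit. Conversely, the counit at the Hopf module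
  \<open>A\<^sub>z\<^sub>y \<otimes> A\<^sub>x\<^sub>y\<close> with diagonal action is, up to the unit isomorphism, the canonical map; and an antipode
  can be read off from a left inverse of the canonical maps with \<open>z = x\<close> and inverses of those
  with \<open>z = y\<close>.
\<close>

section \<open>String diagrams\<close>

text \<open>Coinvariants at \<open>x\<close> are built from the object and the coaction at the
  indices \<open>x\<close>, \<open>x\<close>; the action does not enter. At these indices the
  diagonal module on \<open>A_z\<close> and the free module on the family of all \<open>A_zx\<close>
  coincide, so they have the same coinvariants, although they need not agree elsewhere. Hence the
  invertible unit at the free module also describes the coinvariants of the diagonal one, and this
  is what turns its counit into the canonical map.

  That \<open>m_0 S(m_1)\<close> is coinvariant usually rests on \<open>S\<close> reversing the
  comultiplication up to the braiding. Here both sides of the claim are multiplied by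
  \<open>m_2\<close>, after which they agree without such a law, and the antipode allows that factor
  to be cancelled.

  Identities with several crossings are checked by normalising diagrams: independent layers are
  sorted, and the axioms act as oriented rewrite rules on adjacent layers. Sorting can separate two
  layers that an axiom needs side by side; then an intermediate diagram is stated in which they are
  still adjacent.\<close>

text \<open>
  A diagram consists of a word of objects (its domain), an arrow and a word of objects (its
  codomain); \<open>None\<close> stands for an ill-typed diagram. Words make the tensor product of objects
  strictly associative by computation, and \<open>L n f k\<close> is the diagram \<open>k\<close> followed by \<open>f\<close> on the
  strands starting at position \<open>n\<close>, so that the strands to either side need not be mentioned.
\<close>

type_synonym ('o, 'a) diagram = "('o list \<times> 'a \<times> 'o list) option"

definition mk :: "'o list \<Rightarrow> 'a \<Rightarrow> 'o list \<Rightarrow> ('o, 'a) diagram" where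
  "mk as f bs = Some (as, f, bs)"

definition dm :: "('o, 'a) diagram \<Rightarrow> 'o list" where "dm k = fst (the k)"
definition raw :: "('o, 'a) diagram \<Rightarrow> 'a" where "raw k = fst (snd (the k))"
definition cd :: "('o, 'a) diagram \<Rightarrow> 'o list" where "cd k = snd (snd (the k))"

lemma mk_sel [simp]: "dm (mk as f bs) = as" "cd (mk as f bs) = bs" "raw (mk as f bs) = f"
  by (simp_all add: mk_def dm_def cd_def raw_def)

text \<open>Given by recursion so that typing conditions on explicit words are decided by
  computation; \<open>occurs_at_iff\<close> recovers the decomposition that structural proofs
  need.\<close>

fun occurs_at :: "nat \<Rightarrow> 'o list \<Rightarrow> 'o list \<Rightarrow> bool" where
  "occurs_at 0 [] bs = True"
| "occurs_at 0 (a # as) (b # bs) = (a = b \<and> occurs_at 0 as bs)"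
| "occurs_at 0 (a # as) [] = False"
| "occurs_at (Suc n) as (b # bs) = occurs_at n as bs"
| "occurs_at (Suc n) as [] = False"

text \<open>The equations for a word that is too short are default values: \<open>L\<close> reaches
  \<open>replace_at\<close> only where \<open>occurs_at\<close> holds.\<close>

fun replace_at :: "nat \<Rightarrow> nat \<Rightarrow> 'o list \<Rightarrow> 'o list \<Rightarrow> 'o list" where
  "replace_at 0 0 ds bs = ds @ bs"
| "replace_at 0 (Suc m) ds (b # bs) = replace_at 0 m ds bs"
| "replace_at 0 (Suc m) ds [] = ds"
| "replace_at (Suc n) m ds (b # bs) = b # replace_at n m ds bs"
| "replace_at (Suc n) m ds [] = ds"

lemma occurs_at_iff: "occurs_at n as bs \<longleftrightarrow> (\<exists>l r. bs = l @ as @ r \<and> length l = n)"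
proof (induction n as bs rule: occurs_at.induct)
  case (4 n as b bs)
  show ?case
  proof
    assume "occurs_at (Suc n) as (b # bs)"
    then obtain l r where "bs = l @ as @ r" "length l = n" using 4 by auto
    then have "b # bs = (b # l) @ as @ r \<and> length (b # l) = Suc n" by simp
    then show "\<exists>l r. b # bs = l @ as @ r \<and> length l = Suc n" by blast
  next
    assume "\<exists>l r. b # bs = l @ as @ r \<and> length l = Suc n"
    then obtain l r where "b # bs = l @ as @ r" "length l = Suc n" by blast
    then have "bs = tl l @ as @ r \<and> length (tl l) = n" by (cases l) auto
    then show "occurs_at (Suc n) as (b # bs)" using 4 by auto
  qed
qed auto

lemma occurs_at_append [simp]: "occurs_at (length l) as (l @ as @ r)"
  by (auto simp: occurs_at_iff)

lemma replace_at_append: "length l = n \<Longrightarrow> length as = m \<Longrightarrow> replace_at n m ds (l @ as @ r) = l @ ds @ r"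
proof (induction l arbitrary: n)
  case Nil
  have "replace_at 0 m ds (as @ r) = ds @ r" using Nil(2)
    by (induction as arbitrary: m) auto
  then show ?case using Nil by simp
qed auto

lemma append_eq_prefix: "a @ r = b @ s \<Longrightarrow> length a \<le> length b \<Longrightarrow> \<exists>m. b = a @ m"
  by (auto simp: append_eq_append_conv2)

section \<open>Calculus of layered diagrams in a strict monoidal category\<close>

context strict_monoidal_category
begin

primrec tens :: "'o list \<Rightarrow> 'o" where
  "tens [] = \<k>"
| "tens (a # as) = a \<otimes>\<^sub>o tens as"

definition valid :: "('o, 'a) diagram \<Rightarrow> bool" where
  "valid k \<longleftrightarrow> k \<noteq> None \<and> set (dm k) \<subseteq> Obj V \<and> set (cd k) \<subseteq> Obj V \<and>
    raw k \<in> Hom V (tens (dm k)) (tens (cd k))"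

text \<open>
  \<open>cdo\<close> computes well-typedness and codomain in a single pass; separate conditional rules for
  \<open>valid\<close> and \<open>cd\<close> would make the simplifier exponential in the number of layers.
\<close>

definition cdo :: "('o, 'a) diagram \<Rightarrow> 'o list option" where
  "cdo k = (if valid k then Some (cd k) else None)"

definition fits :: "nat \<Rightarrow> 'o list \<Rightarrow> ('o, 'a) diagram \<Rightarrow> bool" where
  "fits n as k \<longleftrightarrow> valid k \<and> occurs_at n as (cd k)"

definition I :: "'o list \<Rightarrow> ('o, 'a) diagram" where
  "I as = mk as (\<one> (tens as)) as"

text \<open>The whiskering of \<open>f\<close> by identity strands on both sides.\<close>

definition W :: "'o list \<Rightarrow> ('o, 'a) diagram \<Rightarrow> 'o list \<Rightarrow> 'a" where
  "W l f r = \<one> (tens l) \<otimes> raw f \<otimes> \<one> (tens r)"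

definition L :: "nat \<Rightarrow> ('o, 'a) diagram \<Rightarrow> ('o, 'a) diagram \<Rightarrow> ('o, 'a) diagram" where
  "L n f k = (if valid f \<and> fits n (dm f) k
    then mk (dm k) (W (take n (cd k)) f (drop (n + length (dm f)) (cd k)) \<cdot> raw k)
      (replace_at n (length (dm f)) (cd f) (cd k))
    else None)"

lemma ident_comp: "a \<in> Obj V \<Longrightarrow> \<one> a \<cdot> \<one> a = \<one> a"
  by (simp add: comp_ident_left[of a a] ident_hom)

lemma tens_Obj: "set as \<subseteq> Obj V \<Longrightarrow> tens as \<in> Obj V"
  by (induction as) (auto simp: unit_obj_Obj tensor_Obj)

lemma tens_append: "set as \<subseteq> Obj V \<Longrightarrow> set bs \<subseteq> Obj V \<Longrightarrow>
    tens (as @ bs) = tens as \<otimes>\<^sub>o tens bs"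
  by (induction as) (auto simp: unit_tensor_obj tensor_obj_assoc tens_Obj)

lemma tens_single [simp]: "a \<in> Obj V \<Longrightarrow> tens [a] = a"
  by (simp add: tensor_unit_obj)

lemma None_simps [simp]: "\<not> valid None" "cdo None = None" "L n f None = None" "L n None k = None"
  by (auto simp: valid_def cdo_def L_def fits_def)

lemma fits_cdo: "fits n as k \<longleftrightarrow> (case cdo k of None \<Rightarrow> False | Some b \<Rightarrow> occurs_at n as b)"
  by (simp add: fits_def cdo_def)

lemma I_sel [simp]: "dm (I as) = as" "cd (I as) = as" "raw (I as) = \<one> (tens as)"
  by (simp_all add: I_def)

lemma valid_I [simp]: "valid (I as) \<longleftrightarrow> set as \<subseteq> Obj V"
  by (auto simp: valid_def ident_hom tens_Obj) (simp add: I_def mk_def)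

lemma validD: "valid k \<Longrightarrow> set (dm k) \<subseteq> Obj V" "valid k \<Longrightarrow> set (cd k) \<subseteq> Obj V"
  "valid k \<Longrightarrow> raw k \<in> Hom V (tens (dm k)) (tens (cd k))"
  by (auto simp: valid_def)

lemma valid_mk [simp]: "valid (mk as f bs) \<longleftrightarrow>
    set as \<subseteq> Obj V \<and> set bs \<subseteq> Obj V \<and> f \<in> Hom V (tens as) (tens bs)"
  by (simp add: valid_def) (simp add: mk_def)

lemma cdo_I [simp]: "set as \<subseteq> Obj V \<Longrightarrow> cdo (I as) = Some as"
  by (simp add: cdo_def)

text \<open>Validity excludes \<open>None\<close>, on which the three selectors are unspecified;
  apart from that they determine a diagram.\<close>

lemma diagram_eqI:
  assumes "valid s" "valid t" "dm s = dm t" "cd s = cd t" "raw s = raw t"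
  shows "s = t"
  using assms by (auto simp: valid_def dm_def cd_def raw_def prod_eq_iff)

lemma W_Hom:
  assumes "valid f" "set l \<subseteq> Obj V" "set r \<subseteq> Obj V"
  shows "W l f r \<in> Hom V (tens (l @ dm f @ r)) (tens (l @ cd f @ r))"
  using assms validD[OF assms(1)]
  by (simp add: W_def tens_append tens_Obj tensor_Obj tensor_Hom ident_hom)

lemma fitsE:
  assumes "fits n as k"
  obtains l r where "cd k = l @ as @ r" "length l = n" "valid k"
    "set l \<subseteq> Obj V" "set as \<subseteq> Obj V" "set r \<subseteq> Obj V"
proof -
  obtain l r where *: "cd k = l @ as @ r" "length l = n" "valid k"
    using assms by (auto simp: fits_def occurs_at_iff)
  then show ?thesis using validD(2)[OF *(3)] that by auto
qed

lemma L_eq: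
  assumes "valid f" "valid k" "cd k = l @ dm f @ r" "length l = n"
  shows "L n f k = mk (dm k) (W l f r \<cdot> raw k) (l @ cd f @ r)"
  using assms by (auto simp: L_def fits_def replace_at_append occurs_at_iff)

lemma valid_L_eq:
  assumes "valid f" "valid k" "cd k = l @ dm f @ r" "length l = n"
  shows "valid (L n f k)"
proof -
  have o: "set l \<subseteq> Obj V" "set r \<subseteq> Obj V" using validD(2)[OF assms(2)] assms(3) by auto
  have "W l f r \<cdot> raw k \<in> Hom V (tens (dm k)) (tens (l @ cd f @ r))"
    using W_Hom[OF assms(1) o] validD[OF assms(1)] validD[OF assms(2)] assms(3) o
    by (intro comp_hom[where b = "tens (l @ dm f @ r)"] tens_Obj) auto
  then show ?thesis
    using assms o validD[OF assms(1)] validD[OF assms(2)] by (simp add: L_eq)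
qed

lemma valid_L [simp]: "valid (L n f k) \<longleftrightarrow> valid f \<and> fits n (dm f) k"
proof
  assume "valid (L n f k)"
  then show "valid f \<and> fits n (dm f) k" by (auto simp: L_def split: if_splits)
next
  assume "valid f \<and> fits n (dm f) k"
  then show "valid (L n f k)" by (metis fitsE valid_L_eq)
qed

lemma L_None: "\<not> (valid f \<and> fits n (dm f) k) \<Longrightarrow> L n f k = None"
  by (auto simp: L_def)

lemma dm_L: "valid (L n f k) \<Longrightarrow> dm (L n f k) = dm k"
  and cd_L: "valid (L n f k) \<Longrightarrow> cd (L n f k) = replace_at n (length (dm f)) (cd f) (cd k)"
  by (simp_all only: valid_L) (simp_all add: L_def)

lemma cdo_L [simp]: "valid f \<Longrightarrow> cdo (L n f k) = (case cdo k of None \<Rightarrow> None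
    | Some b \<Rightarrow> if occurs_at n (dm f) b then Some (replace_at n (length (dm f)) (cd f) b) else None)"
  using valid_L[of n f k] by (auto simp: cdo_def fits_def cd_L)

lemma W_comp:
  assumes "valid f" "valid g" "cd f = dm g" "set l \<subseteq> Obj V" "set r \<subseteq> Obj V"
  shows "W l g r \<cdot> W l f r = \<one> (tens l) \<otimes> (raw g \<cdot> raw f) \<otimes> \<one> (tens r)"
proof -
  note o = validD[OF assms(1)] validD[OF assms(2)]
  have f: "raw f \<in> Hom V (tens (dm f)) (tens (dm g))" using o assms(3) by simp
  have "(raw g \<cdot> raw f) \<otimes> \<one> (tens r) = (raw g \<otimes> \<one> (tens r)) \<cdot> (raw f \<otimes> \<one> (tens r))"
    using tensor_comp[OF _ _ _ _ _ _ f o(6), of "tens r" "tens r" "tens r" "\<one> (tens r)" "\<one> (tens r)"]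
      o assms by (simp add: tens_Obj ident_hom ident_comp)
  moreover have "\<one> (tens l) \<otimes> ((raw g \<otimes> \<one> (tens r)) \<cdot> (raw f \<otimes> \<one> (tens r))) =
     (\<one> (tens l) \<otimes> (raw g \<otimes> \<one> (tens r))) \<cdot> (\<one> (tens l) \<otimes> (raw f \<otimes> \<one> (tens r)))"
    using tensor_comp[of "tens l" "tens l" "tens l" "tens (dm f) \<otimes>\<^sub>o tens r" "tens (cd f) \<otimes>\<^sub>o tens r" "tens (cd g) \<otimes>\<^sub>o tens r"
        "\<one> (tens l)" "\<one> (tens l)" "raw f \<otimes> \<one> (tens r)" "raw g \<otimes> \<one> (tens r)"] o assms
    by (simp add: tens_Obj ident_hom ident_comp tensor_Obj tensor_Hom)
  ultimately show ?thesis by (simp add: W_def)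
qed

lemma tens_arr_assoc:
  assumes "f \<in> Hom V (tens a) (tens a')" "g \<in> Hom V (tens b) (tens b')" "h \<in> Hom V (tens c) (tens c')"
   "set a \<subseteq> Obj V" "set b \<subseteq> Obj V" "set c \<subseteq> Obj V" "set a' \<subseteq> Obj V" "set b' \<subseteq> Obj V" "set c' \<subseteq> Obj V"
  shows "(f \<otimes> g) \<otimes> h = f \<otimes> (g \<otimes> h)"
  using assms by (intro tensor_arr_assoc[of "tens a" "tens b" "tens c" "tens a'" "tens b'" "tens c'"] tens_Obj)

lemma W_append:
  assumes "valid f" "set l \<subseteq> Obj V" "set l' \<subseteq> Obj V" "set r \<subseteq> Obj V" "set r' \<subseteq> Obj V"
  shows "W (l @ l') f (r @ r') = \<one> (tens l) \<otimes> W l' f r \<otimes> \<one> (tens r')"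
proof -
  note o = validD[OF assms(1)]
  have i: "\<one> (tens (l @ l')) = \<one> (tens l) \<otimes> \<one> (tens l')" "\<one> (tens (r @ r')) = \<one> (tens r) \<otimes> \<one> (tens r')"
    using assms by (simp_all add: tens_append tensor_ident tens_Obj)
  have id: "set x \<subseteq> Obj V \<Longrightarrow> \<one> (tens x) \<in> Hom V (tens x) (tens x)" for x
    by (simp add: ident_hom tens_Obj)
  have 1: "raw f \<otimes> \<one> (tens r) \<in> Hom V (tens (dm f @ r)) (tens (cd f @ r))"
    using o assms id by (simp add: tens_append tensor_Hom tens_Obj)
  have 2: "(raw f \<otimes> \<one> (tens r)) \<otimes> \<one> (tens r') = raw f \<otimes> \<one> (tens r) \<otimes> \<one> (tens r')"
    using o assms id by (intro tens_arr_assoc[of _ "dm f" "cd f" _ r r _ r' r']) auto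
  have 3: "(\<one> (tens l') \<otimes> (raw f \<otimes> \<one> (tens r))) \<otimes> \<one> (tens r') =
     \<one> (tens l') \<otimes> ((raw f \<otimes> \<one> (tens r)) \<otimes> \<one> (tens r'))"
    using 1 o assms id by (intro tens_arr_assoc[of _ l' l' _ "dm f @ r" "cd f @ r" _ r' r']) auto
  have 4: "raw f \<otimes> \<one> (tens r) \<otimes> \<one> (tens r') \<in> Hom V (tens (dm f @ r @ r')) (tens (cd f @ r @ r'))"
    using o assms id by (simp add: tens_append tensor_Hom tens_Obj tensor_Obj)
  have 5: "(\<one> (tens l) \<otimes> \<one> (tens l')) \<otimes> (raw f \<otimes> \<one> (tens r) \<otimes> \<one> (tens r')) =
     \<one> (tens l) \<otimes> \<one> (tens l') \<otimes> (raw f \<otimes> \<one> (tens r) \<otimes> \<one> (tens r'))"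
    using 4 o assms id
    by (intro tens_arr_assoc[of _ l l _ l' l' _ "dm f @ r @ r'" "cd f @ r @ r'"]) auto
  show ?thesis unfolding W_def i using 2 3 5 by simp
qed

text \<open>The interchange law: by bifunctoriality of the tensor product both composites equal
  \<open>\<one> (tens l) \<otimes> (raw g \<otimes> W m f r)\<close>.\<close>

lemma W_exchange:
  assumes "valid f" "valid g" "set l \<subseteq> Obj V" "set m \<subseteq> Obj V" "set r \<subseteq> Obj V"
  shows "W (l @ cd g @ m) f r \<cdot> W l g (m @ dm f @ r) = W l g (m @ cd f @ r) \<cdot> W (l @ dm g @ m) f r"
proof -
  note o = validD[OF assms(1)] validD[OF assms(2)]
  have id: "set x \<subseteq> Obj V \<Longrightarrow> \<one> (tens x) \<in> Hom V (tens x) (tens x)" for x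
    by (simp add: ident_hom tens_Obj)
  have Wf: "W (as @ m) f r = \<one> (tens as) \<otimes> W m f r" if "set as \<subseteq> Obj V" for as
    using W_append[OF assms(1) that assms(4,5), of "[]"] that W_Hom[OF assms(1,4,5)] o assms
      tens_arr_assoc[of "\<one> (tens as)" as as "W m f r" "m @ dm f @ r" "m @ cd f @ r" "\<one> \<k>" "[]" "[]"]
    by (simp add: tensor_Hom tens_Obj unit_obj_Obj ident_hom)
       (subst tensor_unit_arr[of "tens (m @ dm f @ r)" "tens (m @ cd f @ r)"], auto simp: tens_Obj)
  have f1: "W (l @ as @ m) f r = \<one> (tens l) \<otimes> (\<one> (tens as) \<otimes> W m f r)" if "set as \<subseteq> Obj V" for as
  proof -
    have "W (l @ as @ m) f r = (\<one> (tens l) \<otimes> \<one> (tens as)) \<otimes> W m f r"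
      using Wf[of "l @ as"] that assms by (simp add: tens_append tensor_ident tens_Obj)
    also have "\<dots> = \<one> (tens l) \<otimes> (\<one> (tens as) \<otimes> W m f r)"
      using id that assms W_Hom[OF assms(1,4,5)] o
      by (intro tens_arr_assoc[of _ l l _ as as _ "m @ dm f @ r" "m @ cd f @ r"]) auto
    finally show ?thesis .
  qed
  have W0: "\<one> (tens a) \<otimes> W m f r \<in> Hom V (tens a \<otimes>\<^sub>o tens (m @ dm f @ r)) (tens a \<otimes>\<^sub>o tens (m @ cd f @ r))"
    if "set a \<subseteq> Obj V" for a
    using that W_Hom[OF assms(1,4,5)] o assms id by (intro tensor_Hom tens_Obj) auto
  have G0: "raw g \<otimes> \<one> (tens a) \<in> Hom V (tens (dm g) \<otimes>\<^sub>o tens a) (tens (cd g) \<otimes>\<^sub>o tens a)"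
    if "set a \<subseteq> Obj V" for a
    using that o assms id by (intro tensor_Hom tens_Obj) auto
  have ll: "\<one> (tens l) \<otimes> (u \<cdot> v) = (\<one> (tens l) \<otimes> u) \<cdot> (\<one> (tens l) \<otimes> v)"
    if "v \<in> Hom V a b" "u \<in> Hom V b c" "a \<in> Obj V" "b \<in> Obj V" "c \<in> Obj V" for u v a b c
    using tensor_comp[OF _ _ _ that(3-5) _ _ that(1,2), of "tens l" "tens l" "tens l" "\<one> (tens l)" "\<one> (tens l)"]
      assms id by (simp add: tens_Obj ident_comp)
  have cf: "(\<one> (tens (cd g)) \<otimes> W m f r) \<cdot> (raw g \<otimes> \<one> (tens (m @ dm f @ r))) = raw g \<otimes> W m f r"
    using tensor_comp[of "tens (dm g)" "tens (cd g)" "tens (cd g)" "tens (m @ dm f @ r)" "tens (m @ dm f @ r)" "tens (m @ cd f @ r)"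
       "raw g" "\<one> (tens (cd g))" "\<one> (tens (m @ dm f @ r))" "W m f r"] o assms id W_Hom[OF assms(1,4,5)]
       comp_ident_left[of "tens (dm g)" "tens (cd g)" "raw g"]
       comp_ident_right[of "tens (m @ dm f @ r)" "tens (m @ cd f @ r)" "W m f r"]
    by (simp add: tens_Obj)
  have cg: "(raw g \<otimes> \<one> (tens (m @ cd f @ r))) \<cdot> (\<one> (tens (dm g)) \<otimes> W m f r) = raw g \<otimes> W m f r"
    using tensor_comp[of "tens (dm g)" "tens (dm g)" "tens (cd g)" "tens (m @ dm f @ r)" "tens (m @ cd f @ r)" "tens (m @ cd f @ r)"
       "\<one> (tens (dm g))" "raw g" "W m f r" "\<one> (tens (m @ cd f @ r))"] o assms id W_Hom[OF assms(1,4,5)]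
       comp_ident_right[of "tens (dm g)" "tens (cd g)" "raw g"]
       comp_ident_left[of "tens (m @ dm f @ r)" "tens (m @ cd f @ r)" "W m f r"]
    by (simp add: tens_Obj)
  have s: "set (m @ dm f @ r) \<subseteq> Obj V" "set (m @ cd f @ r) \<subseteq> Obj V" using assms o by auto
  note wg = W_def[of l g]
  have "W (l @ cd g @ m) f r \<cdot> W l g (m @ dm f @ r) = \<one> (tens l) \<otimes> (raw g \<otimes> W m f r)"
    unfolding f1[OF o(5)] wg
    using ll[OF G0[OF s(1)] W0[OF o(5)]] s o by (simp add: tens_Obj tensor_Obj cf)
  also have "\<dots> = W l g (m @ cd f @ r) \<cdot> W (l @ dm g @ m) f r"
    unfolding f1[OF o(4)] wg
    using ll[OF W0[OF o(4)] G0[OF s(2)]] s o by (simp add: tens_Obj tensor_Obj cg)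
  finally show ?thesis .
qed

text \<open>The part of the interchange law that concerns words. A replacement at \<open>p\<close>
  shifts all strands to its right, so position \<open>q\<close> after it is
  \<open>q - length cs + length as\<close> before it.\<close>

lemma occurs_at_rep_exchange:
  assumes "p + length cs \<le> q"
  shows "occurs_at p as b \<and> occurs_at q ds (replace_at p (length as) cs b) \<longleftrightarrow>
    occurs_at (q - length cs + length as) ds b \<and> occurs_at p as (replace_at (q - length cs + length as) (length ds) ds' b)"
proof
  assume "occurs_at p as b \<and> occurs_at q ds (replace_at p (length as) cs b)"
  then have "occurs_at p as b" "occurs_at q ds (replace_at p (length as) cs b)" by auto
  moreover from this(1) obtain l r where b: "b = l @ as @ r" and l: "length l = p"
    unfolding occurs_at_iff by blast
  ultimately have "occurs_at q ds ((l @ cs) @ r)" by (simp add: replace_at_append)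
  then obtain l' r' where e: "(l @ cs) @ r = l' @ ds @ r'" and l': "length l' = q"
    unfolding occurs_at_iff by blast
  have le: "length (l @ cs) \<le> length l'" using assms l l' by simp
  then obtain m where m: "l' = (l @ cs) @ m"
    using append_eq_prefix[OF e] le by blast
  then have r: "r = m @ ds @ r'" using e by simp
  have q: "length (l @ as @ m) = q - length cs + length as" using m l' by simp
  have "b = (l @ as @ m) @ ds @ r'" using b r by simp
  moreover have "replace_at (q - length cs + length as) (length ds) ds' b = l @ as @ m @ ds' @ r'"
    using replace_at_append[OF q refl, of ds ds' r'] b r by simp
  ultimately show "occurs_at (q - length cs + length as) ds b \<and> occurs_at p as (replace_at (q - length cs + length as) (length ds) ds' b)"
    using q l unfolding occurs_at_iff by blast
next
  assume a: "occurs_at (q - length cs + length as) ds b \<and> occurs_at p as (replace_at (q - length cs + length as) (length ds) ds' b)"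
  then have "occurs_at (q - length cs + length as) ds b" by blast
  then obtain l r where b: "b = l @ ds @ r" and l: "length l = q - length cs + length as"
    unfolding occurs_at_iff by blast
  have "occurs_at p as (l @ ds' @ r)" using a replace_at_append[OF l refl, of ds ds' r] b by simp
  then obtain l' r' where e: "(l' @ as) @ r' = l @ ds' @ r" and l': "length l' = p"
    unfolding occurs_at_iff by (metis append_assoc)
  have le: "length (l' @ as) \<le> length l" using assms l l' by simp
  then obtain m where m: "l = (l' @ as) @ m"
    using append_eq_prefix[OF e] le by blast
  have q: "length (l' @ cs @ m) = q" using m l l' assms by simp
  have "b = l' @ as @ m @ ds @ r" using b m by simp
  moreover have "replace_at p (length as) cs b = (l' @ cs @ m) @ ds @ r"
    using replace_at_append[OF l' refl, of as cs "m @ ds @ r"] b m by simp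
  ultimately show "occurs_at p as b \<and> occurs_at q ds (replace_at p (length as) cs b)"
    using q l' unfolding occurs_at_iff by blast
qed

lemma fits_L: "fits m as (L n f k) \<longleftrightarrow> valid f \<and> valid k \<and> occurs_at n (dm f) (cd k) \<and>
    occurs_at m as (replace_at n (length (dm f)) (cd f) (cd k))"
  using valid_L[of n f k] by (auto simp: fits_def cd_L)

text \<open>
  As a rewrite rule this sorts layers acting on disjoint strands: the layer further to the left
  is applied last. Positions are written with \<open>Suc\<close> so that the rules below match by unification.
\<close>

lemma L_exchange:
  assumes "p + length (cd g) \<le> q"
  shows "L q f (L p g k) = L p g (L (q - length (cd g) + length (dm g)) f k)"
proof (cases "valid (L q f (L p g k))")
  case True
  let ?q = "q - length (cd g) + length (dm g)"
  have v: "valid f" "valid g" "valid k" and "occurs_at p (dm g) (cd k)"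
    "occurs_at q (dm f) (replace_at p (length (dm g)) (cd g) (cd k))"
    using True by (auto simp: fits_L)
  then have "occurs_at ?q (dm f) (cd k) \<and> occurs_at p (dm g) (replace_at ?q (length (dm f)) (cd f) (cd k))"
    using occurs_at_rep_exchange[OF assms] by blast
  then have a: "occurs_at ?q (dm f) (cd k)" "occurs_at p (dm g) (replace_at ?q (length (dm f)) (cd f) (cd k))"
    by blast+
  from a(1) obtain l r where b: "cd k = l @ dm f @ r" and l: "length l = ?q"
    unfolding occurs_at_iff by blast
  have "occurs_at p (dm g) (l @ cd f @ r)" using a(2) replace_at_append[OF l refl, of "dm f" "cd f" r] b by simp
  then obtain l' r' where e: "(l' @ dm g) @ r' = l @ cd f @ r" and l': "length l' = p"
    unfolding occurs_at_iff by (metis append_assoc)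
  have le: "length (l' @ dm g) \<le> length l" using assms l l' by simp
  then obtain m where m: "l = (l' @ dm g) @ m"
    using append_eq_prefix[OF e] le by blast
  have q: "length (l' @ cd g @ m) = q" using m l l' assms by simp
  have o: "set l' \<subseteq> Obj V" "set m \<subseteq> Obj V" "set r \<subseteq> Obj V"
    using validD(2)[OF v(3)] b m by auto
  note oo = o validD[OF v(1)] validD[OF v(2)] validD[OF v(3)]
  have k1: "cd k = l' @ dm g @ (m @ dm f @ r)" using b m by simp
  have k2: "cd k = (l' @ dm g @ m) @ dm f @ r" using b m by simp
  have lq: "length (l' @ dm g @ m) = ?q" using l m by simp
  have L1: "L p g k = mk (dm k) (W l' g (m @ dm f @ r) \<cdot> raw k) (l' @ cd g @ (m @ dm f @ r))"
    by (rule L_eq[OF v(2,3) k1 l'])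
  have L2: "L ?q f k = mk (dm k) (W (l' @ dm g @ m) f r \<cdot> raw k) ((l' @ dm g @ m) @ cd f @ r)"
    by (rule L_eq[OF v(1,3) k2 lq])
  have V1: "valid (L p g k)" by (rule valid_L_eq[OF v(2,3) k1 l'])
  have V2: "valid (L ?q f k)" by (rule valid_L_eq[OF v(1,3) k2 lq])
  have "L q f (L p g k) = mk (dm k) (W (l' @ cd g @ m) f r \<cdot> W l' g (m @ dm f @ r) \<cdot> raw k)
      (l' @ cd g @ m @ cd f @ r)"
    using L_eq[OF v(1) V1 _ q, of r] L1 by simp
  moreover have "L p g (L ?q f k) = mk (dm k) (W l' g (m @ cd f @ r) \<cdot> W (l' @ dm g @ m) f r \<cdot> raw k)
      (l' @ cd g @ m @ cd f @ r)"
    using L_eq[OF v(2) V2 _ l', of "m @ cd f @ r"] L2 by simp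
  moreover have "W (l' @ cd g @ m) f r \<cdot> W l' g (m @ dm f @ r) \<cdot> raw k =
     (W (l' @ cd g @ m) f r \<cdot> W l' g (m @ dm f @ r)) \<cdot> raw k"
    using oo W_Hom[OF v(1), of "l' @ cd g @ m" r] W_Hom[OF v(2), of l' "m @ dm f @ r"] k1
    by (intro comp_assoc[symmetric, of "tens (dm k)" "tens (cd k)" "tens (l' @ cd g @ m @ dm f @ r)" "tens (l' @ cd g @ m @ cd f @ r)"] tens_Obj) auto
  moreover have "W l' g (m @ cd f @ r) \<cdot> W (l' @ dm g @ m) f r \<cdot> raw k =
     (W l' g (m @ cd f @ r) \<cdot> W (l' @ dm g @ m) f r) \<cdot> raw k"
    using oo W_Hom[OF v(1), of "l' @ dm g @ m" r] W_Hom[OF v(2), of l' "m @ cd f @ r"] k1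
    by (intro comp_assoc[symmetric, of "tens (dm k)" "tens (cd k)" "tens (l' @ dm g @ m @ cd f @ r)" "tens (l' @ cd g @ m @ cd f @ r)"] tens_Obj) auto
  ultimately show ?thesis using W_exchange[OF v(1,2) o] by simp
next
  \<comment> \<open>If one side is ill-typed then so is the other, and both are \<open>None\<close>.
    Hence sorting needs no typing premises.\<close>
  case False
  then have "\<not> valid (L p g (L (q - length (cd g) + length (dm g)) f k))"
    using occurs_at_rep_exchange[OF assms, of "dm g" "cd k" "dm f" "cd f"] by (auto simp: fits_L)
  then show ?thesis using False by (simp add: L_None)
qed

lemma W_id: "set l \<subseteq> Obj V \<Longrightarrow> set r \<subseteq> Obj V \<Longrightarrow> set as \<subseteq> Obj V \<Longrightarrow>
    W l (I as) r = \<one> (tens (l @ as @ r))"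
  by (simp add: W_def tens_append tensor_ident tens_Obj tensor_Obj)

lemma L_I: "fits n as k \<Longrightarrow> L n (I as) k = k"
proof -
  assume "fits n as k"
  then obtain l r where *: "cd k = l @ as @ r" "length l = n" "valid k"
    "set l \<subseteq> Obj V" "set as \<subseteq> Obj V" "set r \<subseteq> Obj V" by (rule fitsE)
  then have "L n (I as) k = mk (dm k) (\<one> (tens (cd k)) \<cdot> raw k) (cd k)"
    using L_eq[of "I as" k l r n] by (simp add: W_id)
  also have "\<dots> = mk (dm k) (raw k) (cd k)"
    using comp_ident_left[of "tens (dm k)" "tens (cd k)" "raw k"] validD[OF *(3)] by (simp add: tens_Obj)
  also have "\<dots> = k" using *(3) by (intro diagram_eqI) (auto simp: validD)
  finally show ?thesis .
qed

text \<open>Whiskering is functorial, so a composite diagram used as a single layer dissolves into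
  its own layers.\<close>

lemma L_L:
  assumes "fits m (dm f) h"
  shows "L n (L m f h) k = L (n + m) f (L n h k)"
proof (cases "valid f \<and> fits n (dm h) k")
  case True
  obtain l r where h: "cd h = l @ dm f @ r" "length l = m" "valid h"
    and o: "set l \<subseteq> Obj V" "set (dm f) \<subseteq> Obj V" "set r \<subseteq> Obj V" by (rule fitsE[OF assms])
  obtain l' r' where k: "cd k = l' @ dm h @ r'" "length l' = n" "valid k"
    and o': "set l' \<subseteq> Obj V" "set (dm h) \<subseteq> Obj V" "set r' \<subseteq> Obj V"
    using True fitsE by blast
  have f: "valid f" using True by simp
  note oo = o o' validD[OF f] validD[OF h(3)] validD[OF k(3)]
  have Lm: "L m f h = mk (dm h) (W l f r \<cdot> raw h) (l @ cd f @ r)" by (rule L_eq[OF f h(3,1,2)])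
  have V: "valid (L m f h)" by (rule valid_L_eq[OF f h(3,1,2)])
  have Ln: "L n h k = mk (dm k) (W l' h r' \<cdot> raw k) (l' @ cd h @ r')" by (rule L_eq[OF h(3) k(3,1,2)])
  have V': "valid (L n h k)" by (rule valid_L_eq[OF h(3) k(3,1,2)])
  let ?w = "mk (cd h) (W l f r) (l @ cd f @ r)"
  have w: "valid ?w" using W_Hom[OF f o(1,3)] oo h(1) by simp
  have 1: "L n (L m f h) k = mk (dm k) (W l' (L m f h) r' \<cdot> raw k) (l' @ (l @ cd f @ r) @ r')"
    using L_eq[OF V k(3) _ k(2), of r'] k(1) Lm by simp
  have 2: "L (n + m) f (L n h k) = mk (dm k) (W (l' @ l) f (r @ r') \<cdot> W l' h r' \<cdot> raw k) (l' @ (l @ cd f @ r) @ r')"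
    using L_eq[OF f V', of "l' @ l" "r @ r'" "n + m"] k h Ln by simp
  have 3: "W l' (L m f h) r' = W (l' @ l) f (r @ r') \<cdot> W l' h r'"
    using W_comp[OF h(3) w _ o'(1,3)] W_append[OF f o'(1) o(1,3) o'(3)]
    by (simp add: Lm W_def[of l' "mk _ _ _"])
  have 4: "(W (l' @ l) f (r @ r') \<cdot> W l' h r') \<cdot> raw k = W (l' @ l) f (r @ r') \<cdot> W l' h r' \<cdot> raw k"
    using oo W_Hom[OF f, of "l' @ l" "r @ r'"] W_Hom[OF h(3), of l' r'] h k
    by (intro comp_assoc[of "tens (dm k)" "tens (cd k)" "tens (l' @ cd h @ r')" "tens (l' @ l @ cd f @ r @ r')"] tens_Obj) auto
  show ?thesis using 1 2 3 4 by simp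
next
  case False
  have d: "valid (L m f h) \<Longrightarrow> dm (L m f h) = dm h" by (rule dm_L)
  have "\<not> valid (L n (L m f h) k)" using False d by auto
  moreover have "\<not> valid (L (n + m) f (L n h k))" using False by (auto simp: fits_def)
  ultimately show ?thesis by (simp add: L_None)
qed

text \<open>The right factor is applied first, in agreement with the order that
  \<open>L_exchange\<close> produces.\<close>

definition par :: "('o, 'a) diagram \<Rightarrow> ('o, 'a) diagram \<Rightarrow> ('o, 'a) diagram" (infixr "\<parallel>" 70) where
  "par f g = L 0 f (L (length (dm f)) g (I (dm f @ dm g)))"

text \<open>If \<open>dm g\<close> is a proper prefix of \<open>cd f\<close>, the remaining strands
  pass through unchanged; the typing lemmas below ask for equality.\<close>

definition seq :: "('o, 'a) diagram \<Rightarrow> ('o, 'a) diagram \<Rightarrow> ('o, 'a) diagram" (infixr "\<odot>" 65) where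
  "seq g f = L 0 g f"

definition arr :: "('o, 'a) diagram \<Rightarrow> 'o list \<Rightarrow> 'o list \<Rightarrow> bool" where
  "arr f as bs \<longleftrightarrow> valid f \<and> dm f = as \<and> cd f = bs"

lemma arrD: "arr f as bs \<Longrightarrow> valid f" "arr f as bs \<Longrightarrow> dm f = as" "arr f as bs \<Longrightarrow> cd f = bs"
  by (auto simp: arr_def)

lemma W_Nil: "valid f \<Longrightarrow> W [] f [] = raw f"
  using validD[of f] tensor_unit_arr[of "tens (dm f)" "tens (cd f)" "raw f"]
    unit_tensor_arr[of "tens (dm f)" "tens (cd f)" "raw f"]
  by (simp add: W_def tens_Obj)

lemma seq_eq:
  assumes "arr f as bs" "arr g bs cs"
  shows "g \<odot> f = mk as (raw g \<cdot> raw f) cs"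
  using assms L_eq[of g f "[]" "[]" 0] by (auto simp: arr_def seq_def W_Nil)

lemma arr_seq: "arr f as bs \<Longrightarrow> arr g bs cs \<Longrightarrow> arr (g \<odot> f) as cs"
proof -
  assume a: "arr f as bs" "arr g bs cs"
  then have "valid (g \<odot> f)" unfolding seq_def arr_def by (intro valid_L_eq[where l = "[]" and r = "[]"]) auto
  then show ?thesis using seq_eq[OF a] by (simp only: arr_def mk_sel)
qed

lemma par_eq:
  assumes "arr f as bs" "arr g cs ds"
  shows "f \<parallel> g = mk (as @ cs) (raw f \<otimes> raw g) (bs @ ds)"
proof -
  have f: "valid f" "dm f = as" "cd f = bs" and g: "valid g" "dm g = cs" "cd g = ds"
    using assms by (auto simp: arr_def)
  note o = validD[OF f(1), unfolded f] validD[OF g(1), unfolded g]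
  have i: "valid (I (as @ cs))" using o by simp
  have 1: "L (length as) g (I (as @ cs)) = mk (as @ cs) (W as g [] \<cdot> \<one> (tens (as @ cs))) (as @ ds)"
    using L_eq[OF g(1) i, of as "[]" "length as"] g o by simp
  have v: "valid (L (length as) g (I (as @ cs)))"
    using valid_L_eq[OF g(1) i, of as "[]" "length as"] g by simp
  have W1: "W as g [] = \<one> (tens as) \<otimes> raw g"
    using o tensor_unit_arr[of "tens cs" "tens ds" "raw g"] by (simp add: W_def tens_Obj)
  have W2: "W [] f ds = raw f \<otimes> \<one> (tens ds)"
    using o unit_tensor_arr[of "tens as \<otimes>\<^sub>o tens ds" "tens bs \<otimes>\<^sub>o tens ds" "raw f \<otimes> \<one> (tens ds)"]
    by (simp add: W_def tens_Obj tensor_Hom tensor_Obj ident_hom)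
  have 2: "W as g [] \<cdot> \<one> (tens (as @ cs)) = W as g []"
    using W_Hom[OF g(1), of as "[]"] o g
    by (intro comp_ident_right[of "tens (as @ cs)" "tens (as @ ds)"] tens_Obj) auto
  have 3: "f \<parallel> g = mk (as @ cs) (W [] f ds \<cdot> W as g []) (bs @ ds)"
    unfolding par_def using L_eq[OF f(1) v[folded f(2)], of "[]" ds 0] f g 1 2 by simp
  have "(raw f \<otimes> \<one> (tens ds)) \<cdot> (\<one> (tens as) \<otimes> raw g) = (raw f \<cdot> \<one> (tens as)) \<otimes> (\<one> (tens ds) \<cdot> raw g)"
    using o by (intro tensor_comp[symmetric, of "tens as" "tens as" "tens bs" "tens cs" "tens ds" "tens ds"]) (auto simp: tens_Obj ident_hom)
  also have "\<dots> = raw f \<otimes> raw g"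
    using o comp_ident_right[of "tens as" "tens bs" "raw f"] comp_ident_left[of "tens cs" "tens ds" "raw g"]
    by (simp add: tens_Obj)
  finally show ?thesis using 3 W1 W2 by simp
qed

lemma arr_par: "arr f as bs \<Longrightarrow> arr g cs ds \<Longrightarrow> arr (f \<parallel> g) (as @ cs) (bs @ ds)"
  using validD[of f] validD[of g]
  by (auto simp: par_eq) (auto simp: arr_def tens_append tens_Obj tensor_Hom)

lemma raw_seq: "valid f \<Longrightarrow> valid g \<Longrightarrow> cd f = dm g \<Longrightarrow> raw (g \<odot> f) = raw g \<cdot> raw f"
  and valid_seq: "valid f \<Longrightarrow> valid g \<Longrightarrow> cd f = dm g \<Longrightarrow> valid (g \<odot> f)"
  and dm_seq: "valid f \<Longrightarrow> valid g \<Longrightarrow> cd f = dm g \<Longrightarrow> dm (g \<odot> f) = dm f"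
  and cd_seq: "valid f \<Longrightarrow> valid g \<Longrightarrow> cd f = dm g \<Longrightarrow> cd (g \<odot> f) = cd g"
  using seq_eq[of f "dm f" "cd f" g "cd g"] arr_seq[of f "dm f" "cd f" g "cd g"]
  by (auto simp: arr_def)

lemma raw_par: "valid f \<Longrightarrow> valid g \<Longrightarrow> raw (f \<parallel> g) = raw f \<otimes> raw g"
  and valid_par: "valid f \<Longrightarrow> valid g \<Longrightarrow> valid (f \<parallel> g)"
  and dm_par: "valid f \<Longrightarrow> valid g \<Longrightarrow> dm (f \<parallel> g) = dm f @ dm g"
  and cd_par: "valid f \<Longrightarrow> valid g \<Longrightarrow> cd (f \<parallel> g) = cd f @ cd g"
  using par_eq[of f "dm f" "cd f" g "dm g" "cd g"] arr_par[of f "dm f" "cd f" g "dm g" "cd g"]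
  by (auto simp: arr_def)

lemmas par_seq_simps = raw_seq valid_seq dm_seq cd_seq raw_par valid_par dm_par cd_par

text \<open>Normal forms are stacks of layers over some \<open>I\<close>; this rule translates
  between a bare generator and that form.\<close>

lemma L_atom: "valid f \<Longrightarrow> L 0 f (I (dm f)) = f"
proof -
  assume f: "valid f"
  have "f \<odot> I (dm f) = mk (dm f) (raw f \<cdot> \<one> (tens (dm f))) (cd f)"
    using f validD[OF f] seq_eq[of "I (dm f)" "dm f" "dm f" f "cd f"] by (simp add: arr_def)
  also have "\<dots> = f" using f validD[OF f] comp_ident_right[of "tens (dm f)" "tens (cd f)" "raw f"]
    by (intro diagram_eqI) (auto simp: tens_Obj)
  finally show ?thesis by (simp add: seq_def)
qed

end

context strict_monoidal_category
begin

text \<open>The source of the rewrite rules below: an equation between whole diagrams becomes, after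
  flattening, a rule that applies at any position \<open>n\<close> on top of any diagram
  \<open>k\<close>.\<close>

lemma L_cong_lift: "s = t \<Longrightarrow> L n s k = L n t k" by simp

lemma dm_L_cdo: "cdo (L n f k) \<noteq> None \<Longrightarrow> dm (L n f k) = dm k"
  by (rule dm_L) (simp add: cdo_def split: if_splits)

lemma cdo_valid: "valid f \<Longrightarrow> cdo f = Some (cd f)"
  by (simp add: cdo_def)

text \<open>\<open>L_I\<close> would first require the diagram underneath to be valid. This rule and
  the next remove an identity without evaluating the layer \<open>f\<close>.\<close>

lemma L_I_Nil: "L n (I []) (L n f k) = L n f k"
proof (cases "valid (L n f k)")
  case True
  then obtain l r where "cd k = l @ dm f @ r" "length l = n" by (auto elim: fitsE)
  then have "cd (L n f k) = l @ [] @ (cd f @ r)" using cd_L[OF True] by (simp add: replace_at_append)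
  then have "fits n [] (L n f k)" using True \<open>length l = n\<close> by (auto simp: fits_def[of n "[]"] occurs_at_iff)
  then show ?thesis by (rule L_I)
qed (simp add: L_None)

lemma L_I_single: "fits n [a] k \<Longrightarrow> L n (I [a]) (L (Suc n) f k) = L (Suc n) f k"
  using L_exchange[of n "I [a]" "Suc n" f k] by (simp add: L_I)

text \<open>The normalisation procedure: \<open>par_def\<close>, \<open>seq_def\<close> and
  \<open>L_L\<close> flatten, the rules for \<open>I\<close> delete identities,
  \<open>L_exchange\<close> sorts, and \<open>fits_cdo\<close> turns side conditions into
  computations on words.\<close>

lemmas diag = L_I_Nil L_I_single par_def dm_L_cdo seq_def L_L L_I fits_cdo L_exchange

end

section \<open>Diagrammatic rules for a category enriched over coalgebras\<close>

context strict_braided_monoidal_category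
begin

definition gc :: "'o \<Rightarrow> 'o \<Rightarrow> ('o, 'a) diagram" where
  "gc a b = mk [a, b] (\<c> a b) [b, a]"

lemma gc_simps [simp]: "dm (gc a b) = [a, b]" "cd (gc a b) = [b, a]" "raw (gc a b) = \<c> a b"
  "a \<in> Obj V \<Longrightarrow> b \<in> Obj V \<Longrightarrow> valid (gc a b)"
  using braid_iso[of a b] by (auto simp: gc_def is_iso_def tensor_unit_obj)

lemma braid_Hom: "a \<in> Obj V \<Longrightarrow> b \<in> Obj V \<Longrightarrow> \<c> a b \<in> Hom V (a \<otimes>\<^sub>o b) (b \<otimes>\<^sub>o a)"
  using braid_iso[of a b] by (auto simp: is_iso_def)

lemma idem_iso:
  assumes "is_iso V a a f" "f \<cdot> f = f" "a \<in> Obj V"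
  shows "f = \<one> a"
proof -
  obtain g where f: "f \<in> Hom V a a" and g: "g \<in> Hom V a a" "g \<cdot> f = \<one> a"
    using assms(1) by (auto simp: is_iso_def is_inverse_def)
  have "f = \<one> a \<cdot> f" using f assms(3) by (simp add: comp_ident_left)
  also have "\<dots> = g \<cdot> (f \<cdot> f)" using comp_assoc[of a a a a f f g] f g assms(3) by simp
  also have "\<dots> = \<one> a" using g assms(2) by simp
  finally show ?thesis .
qed

text \<open>The hexagon at two unit objects makes this braiding idempotent, and an invertible
  idempotent is an identity.\<close>

lemma braid_unit_left: "a \<in> Obj V \<Longrightarrow> \<c> \<k> a = \<one> a"
proof -
  assume a: "a \<in> Obj V"
  note h = braid_Hom[OF unit_obj_Obj a]
  have "\<c> \<k> a \<cdot> \<c> \<k> a = \<c> \<k> a"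
    using hexagon_left[OF unit_obj_Obj unit_obj_Obj a] a h unit_obj_Obj
      unit_tensor_arr[of a a "\<c> \<k> a"] tensor_unit_arr[of a a "\<c> \<k> a"]
    by (simp add: unit_tensor_obj tensor_unit_obj)
  then show ?thesis using idem_iso[of a "\<c> \<k> a"] braid_iso[OF unit_obj_Obj a] a
    by (simp add: unit_tensor_obj tensor_unit_obj)
qed

lemma braid_unit_right: "a \<in> Obj V \<Longrightarrow> \<c> a \<k> = \<one> a"
proof -
  assume a: "a \<in> Obj V"
  note h = braid_Hom[OF a unit_obj_Obj]
  have "\<c> a \<k> \<cdot> \<c> a \<k> = \<c> a \<k>"
    using hexagon_right[OF a unit_obj_Obj unit_obj_Obj] a h unit_obj_Obj
      unit_tensor_arr[of a a "\<c> a \<k>"] tensor_unit_arr[of a a "\<c> a \<k>"]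
    by (simp add: unit_tensor_obj tensor_unit_obj)
  then show ?thesis using idem_iso[of a "\<c> a \<k>"] braid_iso[OF a unit_obj_Obj] a
    by (simp add: unit_tensor_obj tensor_unit_obj)
qed

text \<open>Naturality of the braiding in an arrow that starts from the unit object, where the
  braiding is trivial.\<close>

lemma braid_right_unit:
  assumes "a \<in> Obj V" "arr f [] [b]" "fits n [a] k"
  shows "L n (gc a b) (L (Suc n) f k) = L n f k"
proof -
  note f = arrD[OF assms(2)]
  have b: "b \<in> Obj V" using validD[OF f(1)] f by auto
  note f' = validD(3)[OF f(1), unfolded f]
  have "gc a b \<odot> (I [a] \<parallel> f) = f \<parallel> I [a]"
    using f b assms f' braid_natural[of a \<k> a b "\<one> a" "raw f"] comp_ident_right[of a "b \<otimes>\<^sub>o a" "raw f \<otimes> \<one> a"]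
      tensor_Hom[of \<k> b a a "raw f" "\<one> a"]
    by (intro diagram_eqI) (simp_all add: par_seq_simps unit_obj_Obj tensor_unit_obj ident_hom braid_unit_right unit_tensor_obj tensor_Obj)
  from L_cong_lift[OF this, of n k] show ?thesis using f b assms by (simp add: diag)
qed

lemma braid_left_unit:
  assumes "a \<in> Obj V" "arr f [] [b]" "fits n [a] k"
  shows "L n (gc b a) (L n f k) = L (Suc n) f k"
proof -
  note f = arrD[OF assms(2)]
  have b: "b \<in> Obj V" using validD[OF f(1)] f by auto
  note f' = validD(3)[OF f(1), unfolded f]
  have "gc b a \<odot> (f \<parallel> I [a]) = I [a] \<parallel> f"
    using f b assms f' braid_natural[of \<k> a b a "raw f" "\<one> a"] comp_ident_right[of a "a \<otimes>\<^sub>o b" "\<one> a \<otimes> raw f"]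
      tensor_Hom[of a a \<k> b "\<one> a" "raw f"]
    by (intro diagram_eqI) (simp_all add: par_seq_simps unit_obj_Obj tensor_unit_obj ident_hom braid_unit_left unit_tensor_obj tensor_Obj)
  from L_cong_lift[OF this, of n k] show ?thesis using f b assms by (simp add: diag)
qed

lemma cdo_gc [simp]: "a \<in> Obj V \<Longrightarrow> b \<in> Obj V \<Longrightarrow> cdo (gc a b) = Some [b, a]"
  by (simp add: cdo_valid)

text \<open>Naturality of the braiding yields a single box that crosses a tensor product; this
  splits it into crossings of single strands.\<close>

lemma hexagon_right_diag:
  assumes "a \<in> Obj V" "b \<in> Obj V" "c \<in> Obj V"
  shows "mk [a, b, c] (\<c> a (b \<otimes>\<^sub>o c)) [b, c, a] = L (Suc 0) (gc a c) (L 0 (gc a b) (I [a, b, c]))"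
proof -
  have "mk [a, b, c] (\<c> a (b \<otimes>\<^sub>o c)) [b, c, a] = (I [b] \<parallel> gc a c) \<odot> (gc a b \<parallel> I [c])"
    using assms hexagon_right[OF assms] braid_Hom[of a "b \<otimes>\<^sub>o c"]
    by (intro diagram_eqI) (simp_all add: par_seq_simps tensor_unit_obj tensor_Obj tensor_obj_assoc)
  then show ?thesis using assms by (simp add: diag)
qed

lemma hexagon_left_diag:
  assumes "a \<in> Obj V" "b \<in> Obj V" "c \<in> Obj V"
  shows "mk [a, b, c] (\<c> (a \<otimes>\<^sub>o b) c) [c, a, b] = L 0 (gc a c) (L (Suc 0) (gc b c) (I [a, b, c]))"
proof -
  have "mk [a, b, c] (\<c> (a \<otimes>\<^sub>o b) c) [c, a, b] = (gc a c \<parallel> I [b]) \<odot> (I [a] \<parallel> gc b c)"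
    using assms hexagon_left[OF assms] braid_Hom[of "a \<otimes>\<^sub>o b" c]
    by (intro diagram_eqI) (simp_all add: par_seq_simps tensor_unit_obj tensor_Obj tensor_obj_assoc)
  then show ?thesis using assms by (simp add: diag)
qed

text \<open>This rule and the next three combine naturality with a hexagon. Their orientation moves
  boxes with two inputs after the crossings and boxes with two outputs before them.\<close>

lemma braid_right_mult:
  assumes "a \<in> Obj V" "arr f [b, c] [d]" "fits n [a, b, c] k"
  shows "L n (gc a d) (L (Suc n) f k) = L n f (L (Suc n) (gc a c) (L n (gc a b) k))"
proof -
  note f = arrD[OF assms(2)]
  have o: "b \<in> Obj V" "c \<in> Obj V" "d \<in> Obj V" using validD[OF f(1)] f by auto
  note f' = validD(3)[OF f(1), unfolded f]
  have "gc a d \<odot> (I [a] \<parallel> f) = (f \<parallel> I [a]) \<odot> mk [a, b, c] (\<c> a (b \<otimes>\<^sub>o c)) [b, c, a]"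
    using f o assms f' braid_natural[of a "b \<otimes>\<^sub>o c" a d "\<one> a" "raw f"] braid_Hom[of a "b \<otimes>\<^sub>o c"]
    by (intro diagram_eqI) (simp_all add: par_seq_simps tensor_unit_obj ident_hom tensor_Obj tensor_obj_assoc)
  from L_cong_lift[OF this, of n k] show ?thesis using f o assms by (simp add: diag hexagon_right_diag)
qed

lemma braid_left_mult:
  assumes "a \<in> Obj V" "arr f [b, c] [d]" "fits n [b, c, a] k"
  shows "L n (gc d a) (L n f k) = L (Suc n) f (L n (gc b a) (L (Suc n) (gc c a) k))"
proof -
  note f = arrD[OF assms(2)]
  have o: "b \<in> Obj V" "c \<in> Obj V" "d \<in> Obj V" using validD[OF f(1)] f by auto
  note f' = validD(3)[OF f(1), unfolded f]
  have "gc d a \<odot> (f \<parallel> I [a]) = (I [a] \<parallel> f) \<odot> mk [b, c, a] (\<c> (b \<otimes>\<^sub>o c) a) [a, b, c]"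
    using f o assms f' braid_natural[of "b \<otimes>\<^sub>o c" a d a "raw f" "\<one> a"] braid_Hom[of "b \<otimes>\<^sub>o c" a]
    by (intro diagram_eqI) (simp_all add: par_seq_simps tensor_unit_obj ident_hom tensor_Obj tensor_obj_assoc)
  from L_cong_lift[OF this, of n k] show ?thesis using f o assms by (simp add: diag hexagon_left_diag)
qed

lemma braid_right_comult:
  assumes "a \<in> Obj V" "arr f [d] [b, c]" "fits n [a, d] k"
  shows "L n f (L n (gc a d) k) = L (Suc n) (gc a c) (L n (gc a b) (L (Suc n) f k))"
proof -
  note f = arrD[OF assms(2)]
  have o: "b \<in> Obj V" "c \<in> Obj V" "d \<in> Obj V" using validD[OF f(1)] f by auto
  note f' = validD(3)[OF f(1), unfolded f]
  have "mk [a, b, c] (\<c> a (b \<otimes>\<^sub>o c)) [b, c, a] \<odot> (I [a] \<parallel> f) = (f \<parallel> I [a]) \<odot> gc a d"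
    using f o assms f' braid_natural[of a d a "b \<otimes>\<^sub>o c" "\<one> a" "raw f"] braid_Hom[of a "b \<otimes>\<^sub>o c"]
    by (intro diagram_eqI) (simp_all add: par_seq_simps tensor_unit_obj ident_hom tensor_Obj tensor_obj_assoc)
  from L_cong_lift[OF this, of n k] show ?thesis using f o assms by (simp add: diag hexagon_right_diag)
qed

lemma braid_left_comult:
  assumes "a \<in> Obj V" "arr f [d] [b, c]" "fits n [d, a] k"
  shows "L (Suc n) f (L n (gc d a) k) = L n (gc b a) (L (Suc n) (gc c a) (L n f k))"
proof -
  note f = arrD[OF assms(2)]
  have o: "b \<in> Obj V" "c \<in> Obj V" "d \<in> Obj V" using validD[OF f(1)] f by auto
  note f' = validD(3)[OF f(1), unfolded f]
  have "mk [b, c, a] (\<c> (b \<otimes>\<^sub>o c) a) [a, b, c] \<odot> (f \<parallel> I [a]) = (I [a] \<parallel> f) \<odot> gc d a"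
    using f o assms f' braid_natural[of d a "b \<otimes>\<^sub>o c" a "raw f" "\<one> a"] braid_Hom[of "b \<otimes>\<^sub>o c" a]
    by (intro diagram_eqI) (simp_all add: par_seq_simps tensor_unit_obj ident_hom tensor_Obj tensor_obj_assoc)
  from L_cong_lift[OF this, of n k] show ?thesis using f o assms by (simp add: diag hexagon_left_diag)
qed

end

section \<open>The axioms of the enriched category as rewrite rules\<close>

locale cv_context = strict_braided_monoidal_category V + cv_category V A
  for V :: "('o, 'a) braided_category" (structure)
    and A :: "('x, 'o, 'a) cv_category"
begin

definition gm where "gm x y z = mk [ob A x y, ob A y z] (mult A x y z) [ob A x z]"
definition gu where "gu x = mk [] (unity A x) [ob A x x]"
definition gD where "gD x y = mk [ob A x y] (comul (coalg A x y)) [ob A x y, ob A x y]"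
definition ge where "ge x y = mk [ob A x y] (counit (coalg A x y)) []"

lemma ob_Obj [simp]: "x \<in> base A \<Longrightarrow> y \<in> base A \<Longrightarrow> ob A x y \<in> Obj V"
  using coalg coalgebra.carr_Obj by blast

lemma mult_Hom [simp]: "x \<in> base A \<Longrightarrow> y \<in> base A \<Longrightarrow> z \<in> base A \<Longrightarrow>
    mult A x y z \<in> Hom V (ob A x y \<otimes>\<^sub>o ob A y z) (ob A x z)"
  using mult_hom[of x y z] by (simp add: coalgebra_hom_def tensor_coalgebra_def)

lemma unity_Hom [simp]: "x \<in> base A \<Longrightarrow> unity A x \<in> Hom V \<k> (ob A x x)"
  using unity_hom[of x] by (simp add: coalgebra_hom_def unit_coalgebra_def)

lemma comul_Hom [simp]: "x \<in> base A \<Longrightarrow> y \<in> base A \<Longrightarrow>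
    comul (coalg A x y) \<in> Hom V (ob A x y) (ob A x y \<otimes>\<^sub>o ob A x y)"
  using coalg[of x y] by (rule coalgebra.comul_Hom)

lemma counit_Hom [simp]: "x \<in> base A \<Longrightarrow> y \<in> base A \<Longrightarrow>
    counit (coalg A x y) \<in> Hom V (ob A x y) \<k>"
  using coalg[of x y] by (rule coalgebra.counit_Hom)

lemma gen_simps [simp]:
  "dm (gm x y z) = [ob A x y, ob A y z]" "cd (gm x y z) = [ob A x z]" "raw (gm x y z) = mult A x y z"
  "dm (gu x) = []" "cd (gu x) = [ob A x x]" "raw (gu x) = unity A x"
  "dm (gD x y) = [ob A x y]" "cd (gD x y) = [ob A x y, ob A x y]" "raw (gD x y) = comul (coalg A x y)"
  "dm (ge x y) = [ob A x y]" "cd (ge x y) = []" "raw (ge x y) = counit (coalg A x y)"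
  by (simp_all add: gm_def gu_def gD_def ge_def)

lemma gen_valid [simp]:
  "x \<in> base A \<Longrightarrow> y \<in> base A \<Longrightarrow> z \<in> base A \<Longrightarrow> valid (gm x y z)"
  "x \<in> base A \<Longrightarrow> valid (gu x)"
  "x \<in> base A \<Longrightarrow> y \<in> base A \<Longrightarrow> valid (gD x y)"
  "x \<in> base A \<Longrightarrow> y \<in> base A \<Longrightarrow> valid (ge x y)"
  by (simp_all add: gm_def gu_def gD_def ge_def tensor_unit_obj)

lemma gen_cdo [simp]:
  "x \<in> base A \<Longrightarrow> y \<in> base A \<Longrightarrow> z \<in> base A \<Longrightarrow> cdo (gm x y z) = Some [ob A x z]"
  "x \<in> base A \<Longrightarrow> cdo (gu x) = Some [ob A x x]"
  "x \<in> base A \<Longrightarrow> y \<in> base A \<Longrightarrow> cdo (gD x y) = Some [ob A x y, ob A x y]"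
  "x \<in> base A \<Longrightarrow> y \<in> base A \<Longrightarrow> cdo (ge x y) = Some []"
  by (simp_all add: cdo_valid)

lemma gen_arr:
  "x \<in> base A \<Longrightarrow> y \<in> base A \<Longrightarrow> z \<in> base A \<Longrightarrow> arr (gm x y z) [ob A x y, ob A y z] [ob A x z]"
  "x \<in> base A \<Longrightarrow> arr (gu x) [] [ob A x x]"
  "x \<in> base A \<Longrightarrow> y \<in> base A \<Longrightarrow> arr (gD x y) [ob A x y] [ob A x y, ob A x y]"
  "x \<in> base A \<Longrightarrow> y \<in> base A \<Longrightarrow> arr (ge x y) [ob A x y] []"
  by (simp_all add: arr_def)

text \<open>Iterated products are normalised to right-nested form, as are iterated comultiplications
  in \<open>R_coassoc\<close>.\<close>

lemma R_assoc:
  assumes [simp]: "x \<in> base A" "y \<in> base A" "z \<in> base A" "t \<in> base A"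
    and k: "fits n [ob A x y, ob A y z, ob A z t] k"
  shows "L n (gm x z t) (L n (gm x y z) k) = L n (gm x y t) (L (Suc n) (gm y z t) k)"
proof -
  have "gm x z t \<odot> (gm x y z \<parallel> I [ob A z t]) = gm x y t \<odot> (I [ob A x y] \<parallel> gm y z t)"
    by (rule diagram_eqI) (simp_all add: par_seq_simps mult_assoc tensor_unit_obj)
  from L_cong_lift[OF this, of n k] show ?thesis using k by (simp add: diag)
qed

lemma R_unit_left:
  assumes [simp]: "x \<in> base A" "y \<in> base A" and k: "fits n [ob A x y] k"
  shows "L n (gm x x y) (L n (gu x) k) = k"
proof -
  have "gm x x y \<odot> (gu x \<parallel> I [ob A x y]) = I [ob A x y]"
    by (rule diagram_eqI) (simp_all add: par_seq_simps unity_mult tensor_unit_obj)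
  from L_cong_lift[OF this, of n k] show ?thesis using k by (simp add: diag)
qed

lemma R_unit_right:
  assumes [simp]: "x \<in> base A" "y \<in> base A" and k: "fits n [ob A x y] k"
  shows "L n (gm x y y) (L (Suc n) (gu y) k) = k"
proof -
  have "gm x y y \<odot> (I [ob A x y] \<parallel> gu y) = I [ob A x y]"
    by (rule diagram_eqI) (simp_all add: par_seq_simps mult_unity tensor_unit_obj)
  from L_cong_lift[OF this, of n k] show ?thesis using k by (simp add: diag)
qed

lemma R_coassoc:
  assumes [simp]: "x \<in> base A" "y \<in> base A" and k: "fits n [ob A x y] k"
  shows "L n (gD x y) (L n (gD x y) k) = L (Suc n) (gD x y) (L n (gD x y) k)"
proof -
  have "(gD x y \<parallel> I [ob A x y]) \<odot> gD x y = (I [ob A x y] \<parallel> gD x y) \<odot> gD x y"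
    using coalgebra.coassoc[OF coalg[of x y]]
    by (intro diagram_eqI) (simp_all add: par_seq_simps tensor_unit_obj)
  from L_cong_lift[OF this, of n k] show ?thesis using k by (simp add: diag)
qed

lemma R_counit_left:
  assumes [simp]: "x \<in> base A" "y \<in> base A" and k: "fits n [ob A x y] k"
  shows "L n (ge x y) (L n (gD x y) k) = k"
proof -
  have "(ge x y \<parallel> I [ob A x y]) \<odot> gD x y = I [ob A x y]"
    using coalgebra.counit_left[OF coalg[of x y]]
    by (intro diagram_eqI) (simp_all add: par_seq_simps tensor_unit_obj)
  from L_cong_lift[OF this, of n k] show ?thesis using k by (simp add: diag)
qed

lemma R_counit_right:
  assumes [simp]: "x \<in> base A" "y \<in> base A" and k: "fits n [ob A x y] k"
  shows "L (Suc n) (ge x y) (L n (gD x y) k) = k"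
proof -
  have "(I [ob A x y] \<parallel> ge x y) \<odot> gD x y = I [ob A x y]"
    using coalgebra.counit_right[OF coalg[of x y]]
    by (intro diagram_eqI) (simp_all add: par_seq_simps tensor_unit_obj)
  from L_cong_lift[OF this, of n k] show ?thesis using k by (simp add: diag)
qed

text \<open>Multiplication is a coalgebra morphism; the crossing stems from the comultiplication of
  the tensor coalgebra. The rule moves comultiplications before multiplications.\<close>

lemma R_comul_mult:
  assumes [simp]: "x \<in> base A" "y \<in> base A" "z \<in> base A"
    and k: "fits n [ob A x y, ob A y z] k"
  shows "L n (gD x z) (L n (gm x y z) k) =
    L n (gm x y z) (L (Suc (Suc n)) (gm x y z) (L (Suc n) (gc (ob A x y) (ob A y z))
      (L n (gD x y) (L (Suc n) (gD y z) k))))"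
proof -
  have "gD x z \<odot> gm x y z = (gm x y z \<parallel> gm x y z) \<odot>
      (I [ob A x y] \<parallel> gc (ob A x y) (ob A y z) \<parallel> I [ob A y z]) \<odot> (gD x y \<parallel> gD y z)"
    using mult_hom[of x y z]
    by (intro diagram_eqI) (simp_all add: par_seq_simps coalgebra_hom_def tensor_coalgebra_def tensor_unit_obj)
  from L_cong_lift[OF this, of n k] show ?thesis using k by (simp add: diag)
qed

lemma R_comul_unit:
  assumes [simp]: "x \<in> base A" and k: "fits n [] k"
  shows "L n (gD x x) (L n (gu x) k) = L n (gu x) (L n (gu x) k)"
proof -
  have "raw (gD x x \<odot> gu x) = raw (gu x \<parallel> gu x)"
    using unity_hom[of x] comp_ident_right[of \<k> "ob A x x \<otimes>\<^sub>o ob A x x" "unity A x \<otimes> unity A x"]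
      tensor_Hom[of \<k> "ob A x x" \<k> "ob A x x" "unity A x" "unity A x"]
    by (simp add: par_seq_simps coalgebra_hom_def unit_coalgebra_def unit_obj_Obj unit_tensor_obj tensor_Obj)
  then have "gD x x \<odot> gu x = gu x \<parallel> gu x"
    by (intro diagram_eqI) (simp_all add: par_seq_simps)
  from L_cong_lift[OF this, of n k] show ?thesis using k by (simp add: diag)
qed

lemma R_counit_unit:
  assumes [simp]: "x \<in> base A" and k: "fits n [] k"
  shows "L n (ge x x) (L n (gu x) k) = k"
proof -
  have "ge x x \<odot> gu x = I []"
    using unity_hom[of x]
    by (intro diagram_eqI) (simp_all add: par_seq_simps coalgebra_hom_def unit_coalgebra_def)
  from L_cong_lift[OF this, of n k] show ?thesis using k by (simp add: diag)
qed

lemma R_braid_mult: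
  "\<lbrakk>x \<in> base A; y \<in> base A; z \<in> base A; a \<in> Obj V; fits n [a, ob A x y, ob A y z] k\<rbrakk> \<Longrightarrow>
    L n (gc a (ob A x z)) (L (Suc n) (gm x y z) k) =
    L n (gm x y z) (L (Suc n) (gc a (ob A y z)) (L n (gc a (ob A x y)) k))"
  by (rule braid_right_mult[OF _ gen_arr(1)])

lemma R_braid_comul:
  "\<lbrakk>x \<in> base A; y \<in> base A; a \<in> Obj V; fits n [a, ob A x y] k\<rbrakk> \<Longrightarrow>
    L n (gD x y) (L n (gc a (ob A x y)) k) =
    L (Suc n) (gc a (ob A x y)) (L n (gc a (ob A x y)) (L (Suc n) (gD x y) k))"
  by (rule braid_right_comult[OF _ gen_arr(3)])

lemma R_braid_comul_left:
  "\<lbrakk>x \<in> base A; y \<in> base A; a \<in> Obj V; fits n [ob A x y, a] k\<rbrakk> \<Longrightarrow>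
    L (Suc n) (gD x y) (L n (gc (ob A x y) a) k) =
    L n (gc (ob A x y) a) (L (Suc n) (gc (ob A x y) a) (L n (gD x y) k))"
  by (rule braid_left_comult[OF _ gen_arr(3)])

lemma R_braid_unit_right:
  "\<lbrakk>x \<in> base A; a \<in> Obj V; fits n [a] k\<rbrakk> \<Longrightarrow>
    L n (gc a (ob A x x)) (L (Suc n) (gu x) k) = L n (gu x) k"
  by (rule braid_right_unit[OF _ gen_arr(2)])

lemma R_braid_unit_left:
  "\<lbrakk>x \<in> base A; a \<in> Obj V; fits n [a] k\<rbrakk> \<Longrightarrow>
    L n (gc (ob A x x) a) (L n (gu x) k) = L (Suc n) (gu x) k"
  by (rule braid_left_unit[OF _ gen_arr(2)])

end

section \<open>Right modules and the diagonal action\<close>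

text \<open>One row of a module, with the first index held fixed and no coaction. Rows of Hopf
  modules, rows of \<open>A\<close> and their diagonal tensor products are all of this kind.\<close>

locale right_module = cv_context V A
  for V :: "('o, 'a) braided_category" (structure)
    and A :: "('x, 'o, 'a) cv_category" +
  fixes P :: "'x \<Rightarrow> 'o" and \<phi> :: "'x \<Rightarrow> 'x \<Rightarrow> 'a"
  assumes P_Obj [simp]: "y \<in> base A \<Longrightarrow> P y \<in> Obj V"
    and phi_Hom [simp]: "y \<in> base A \<Longrightarrow> z \<in> base A \<Longrightarrow> \<phi> y z \<in> Hom V (P y \<otimes>\<^sub>o ob A y z) (P z)"
    and phi_assoc: "\<lbrakk>y \<in> base A; z \<in> base A; u \<in> base A\<rbrakk> \<Longrightarrow>
      \<phi> z u \<cdot> (\<phi> y z \<otimes> \<one> (ob A z u)) = \<phi> y u \<cdot> (\<one> (P y) \<otimes> mult A y z u)"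
    and phi_unity: "y \<in> base A \<Longrightarrow> \<phi> y y \<cdot> (\<one> (P y) \<otimes> unity A y) = \<one> (P y)"
begin

definition ga where "ga y z = mk [P y, ob A y z] (\<phi> y z) [P z]"

lemma ga_simps [simp]: "dm (ga y z) = [P y, ob A y z]" "cd (ga y z) = [P z]" "raw (ga y z) = \<phi> y z"
  "y \<in> base A \<Longrightarrow> z \<in> base A \<Longrightarrow> valid (ga y z)"
  "y \<in> base A \<Longrightarrow> z \<in> base A \<Longrightarrow> cdo (ga y z) = Some [P z]"
  by (simp_all add: ga_def cdo_def tensor_unit_obj)

lemma ga_arr: "y \<in> base A \<Longrightarrow> z \<in> base A \<Longrightarrow> arr (ga y z) [P y, ob A y z] [P z]"
  by (simp add: arr_def)

lemma R_braid_act: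
  "\<lbrakk>y \<in> base A; z \<in> base A; a \<in> Obj V; fits n [P y, ob A y z, a] k\<rbrakk> \<Longrightarrow>
    L n (gc (P z) a) (L n (ga y z) k) =
    L (Suc n) (ga y z) (L n (gc (P y) a) (L (Suc n) (gc (ob A y z) a) k))"
  by (rule braid_left_mult[OF _ ga_arr])

text \<open>Oriented towards iterated actions, against \<open>R_assoc\<close>:
  \<open>diag_gen_assoc\<close> compares its two sides in that form.\<close>

lemma R_act_assoc:
  assumes [simp]: "y \<in> base A" "z \<in> base A" "u \<in> base A"
    and k: "fits n [P y, ob A y z, ob A z u] k"
  shows "L n (ga y u) (L (Suc n) (gm y z u) k) = L n (ga z u) (L n (ga y z) k)"
proof -
  have "ga y u \<odot> (I [P y] \<parallel> gm y z u) = ga z u \<odot> (ga y z \<parallel> I [ob A z u])"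
    by (rule diagram_eqI) (simp_all add: par_seq_simps phi_assoc tensor_unit_obj)
  from L_cong_lift[OF this, of n k] show ?thesis using k by (simp add: diag)
qed

lemma R_act_unit:
  assumes [simp]: "y \<in> base A" and k: "fits n [P y] k"
  shows "L n (ga y y) (L (Suc n) (gu y) k) = k"
proof -
  have "ga y y \<odot> (I [P y] \<parallel> gu y) = I [P y]"
    by (rule diagram_eqI) (simp_all add: par_seq_simps phi_unity tensor_unit_obj)
  from L_cong_lift[OF this, of n k] show ?thesis using k by (simp add: diag)
qed

end

context cv_context
begin

text \<open>In Sweedler notation \<open>(p \<otimes> q) a = p a_1 \<otimes> q a_2\<close>, where
  \<open>q\<close> and \<open>a_1\<close> cross by the braiding.\<close>

definition diag_act where
  "diag_act P \<phi> Q \<chi> y z = (\<phi> y z \<otimes> \<chi> y z)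
    \<cdot> (\<one> (P y) \<otimes> \<c> (Q y) (ob A y z) \<otimes> \<one> (ob A y z))
    \<cdot> (\<one> (P y \<otimes>\<^sub>o Q y) \<otimes> comul (coalg A y z))"

end

locale two_modules = cv_context V A + P: right_module V A P \<phi> + Q: right_module V A Q \<chi>
  for V :: "('o, 'a) braided_category" (structure)
    and A :: "('x, 'o, 'a) cv_category"
    and P \<phi> Q \<chi>
begin

definition diag_gen where
  "diag_gen y z = (P.ga y z \<parallel> Q.ga y z) \<odot> (I [P y] \<parallel> gc (Q y) (ob A y z) \<parallel> I [ob A y z]) \<odot> (I [P y, Q y] \<parallel> gD y z)"

lemma diag_gen_simps [simp]:
  assumes "y \<in> base A" "z \<in> base A"
  shows "dm (diag_gen y z) = [P y, Q y, ob A y z]" "cd (diag_gen y z) = [P z, Q z]" "valid (diag_gen y z)"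
    "raw (diag_gen y z) = diag_act P \<phi> Q \<chi> y z"
  using assms by (simp_all add: diag_gen_def par_seq_simps diag_act_def tensor_unit_obj)

lemma diag_gen_L:
  assumes [simp]: "y \<in> base A" "z \<in> base A"
  shows "diag_gen y z = L 0 (P.ga y z) (L (Suc (Suc 0)) (Q.ga y z) (L (Suc 0) (gc (Q y) (ob A y z))
    (L (Suc (Suc 0)) (gD y z) (I [P y, Q y, ob A y z]))))"
  by (simp add: diag_gen_def diag)

lemma diag_gen_unit:
  assumes [simp]: "y \<in> base A"
  shows "diag_gen y y \<odot> (I [P y, Q y] \<parallel> gu y) = I [P y, Q y]"
  by (simp add: diag_gen_L diag R_comul_unit R_braid_unit_right P.R_act_unit Q.R_act_unit)

lemma diag_gen_assoc:
  assumes [simp]: "y \<in> base A" "z \<in> base A" "u \<in> base A"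
  shows "diag_gen z u \<odot> (diag_gen y z \<parallel> I [ob A z u]) = diag_gen y u \<odot> (I [P y, Q y] \<parallel> gm y z u)"
proof -
  let ?k = "L 2 (gc (Q y) (ob A z u)) (L 1 (gc (Q y) (ob A y z)) (L 3 (gc (ob A y z) (ob A z u))
    (L 2 (gD y z) (L 3 (gD z u) (I [P y, Q y, ob A y z, ob A z u])))))"
  \<comment> \<open>In sorted form the crossings of the \<open>Q\<close> strand separate
    \<open>gm\<close> from the action that it feeds. Associativity on the second factor is therefore
    stated at the stage \<open>?k\<close>, where that strand has reached position 3.\<close>
  have "L 3 (Q.ga y u) (L (Suc 3) (gm y z u) ?k) = L 3 (Q.ga z u) (L 3 (Q.ga y z) ?k)"
    by (rule Q.R_act_assoc) (simp_all add: diag eval_nat_numeral)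
  then show ?thesis
    by (simp add: diag_gen_L diag eval_nat_numeral R_comul_mult R_braid_mult Q.R_braid_act P.R_act_assoc)
qed

lemma diag_right_module: "right_module V A (\<lambda>y. P y \<otimes>\<^sub>o Q y) (diag_act P \<phi> Q \<chi>)"
proof
  fix y z u assume [simp]: "y \<in> base A" "z \<in> base A" "u \<in> base A"
  show "P y \<otimes>\<^sub>o Q y \<in> Obj V" by (simp add: tensor_Obj)
  show "diag_act P \<phi> Q \<chi> y z \<in> Hom V ((P y \<otimes>\<^sub>o Q y) \<otimes>\<^sub>o ob A y z) (P z \<otimes>\<^sub>o Q z)"
    using validD(3)[OF diag_gen_simps(3)[of y z]] by (simp add: tensor_obj_assoc tensor_unit_obj)
  show "diag_act P \<phi> Q \<chi> z u \<cdot> (diag_act P \<phi> Q \<chi> y z \<otimes> \<one> (ob A z u)) =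
      diag_act P \<phi> Q \<chi> y u \<cdot> (\<one> (P y \<otimes>\<^sub>o Q y) \<otimes> mult A y z u)"
    using arg_cong[OF diag_gen_assoc[of y z u], of raw] by (simp add: par_seq_simps tensor_unit_obj)
  show "diag_act P \<phi> Q \<chi> y y \<cdot> (\<one> (P y \<otimes>\<^sub>o Q y) \<otimes> unity A y) = \<one> (P y \<otimes>\<^sub>o Q y)"
    using arg_cong[OF diag_gen_unit[of y], of raw] by (simp add: par_seq_simps tensor_unit_obj)
qed

end

context cv_context
begin

lemma mult_right_module: "x \<in> base A \<Longrightarrow> right_module V A (ob A x) (mult A x)"
  by unfold_locales (simp_all add: mult_assoc mult_unity)

end

text \<open>
  The family \<open>P\<^sub>y \<otimes> A\<^sub>x\<^sub>y\<close> with the diagonal action and the coaction on the second factor is a Hopf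
  module. For \<open>P = A\<^sub>z\<close> its counit turns out to be the canonical map.
\<close>

locale diag_hopf = right_module V A P \<phi>
  for V :: "('o, 'a) braided_category" (structure)
    and A :: "('x, 'o, 'a) cv_category" and P \<phi>
begin

definition diag_hopf_gen where
  "diag_hopf_gen x y z = (ga y z \<parallel> gm x y z) \<odot> (I [P y] \<parallel> gc (ob A x y) (ob A y z) \<parallel> I [ob A y z]) \<odot> (I [P y, ob A x y] \<parallel> gD y z)"

lemma diag_hopf_gen_simps [simp]:
  assumes "x \<in> base A" "y \<in> base A" "z \<in> base A"
  shows "dm (diag_hopf_gen x y z) = [P y, ob A x y, ob A y z]" "cd (diag_hopf_gen x y z) = [P z, ob A x z]" "valid (diag_hopf_gen x y z)"
    "raw (diag_hopf_gen x y z) = diag_act P \<phi> (ob A x) (mult A x) y z"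
  using assms by (simp_all add: diag_hopf_gen_def par_seq_simps diag_act_def tensor_unit_obj)

lemma diag_hopf_gen_L:
  assumes [simp]: "x \<in> base A" "y \<in> base A" "z \<in> base A"
  shows "diag_hopf_gen x y z = L 0 (ga y z) (L (Suc (Suc 0)) (gm x y z) (L (Suc 0) (gc (ob A x y) (ob A y z))
    (L (Suc (Suc 0)) (gD y z) (I [P y, ob A x y, ob A y z]))))"
  by (simp add: diag_hopf_gen_def diag)

text \<open>Both sides are \<open>p b_1 \<otimes> a_1 b_2 \<otimes> a_2 b_3\<close>, by
  multiplicativity of the comultiplication and coassociativity.\<close>

lemma diag_hopf_gen_compat:
  assumes [simp]: "x \<in> base A" "y \<in> base A" "z \<in> base A"
  shows "(I [P z] \<parallel> gD x z) \<odot> diag_hopf_gen x y z = (diag_hopf_gen x y z \<parallel> gm x y z) \<odot>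
    (I [P y, ob A x y] \<parallel> gc (ob A x y) (ob A y z) \<parallel> I [ob A y z]) \<odot> ((I [P y] \<parallel> gD x y) \<parallel> gD y z)"
proof -
  let ?k = "L 1 (gD x y) (L 2 (gD y z) (I [P y, ob A x y, ob A y z]))"
  let ?k' = "L 2 (gc (ob A x y) (ob A y z)) ?k"
  \<comment> \<open>Sorting puts \<open>gm\<close> between \<open>gD\<close> and the crossing, where
    \<open>R_braid_comul\<close> does not match; the exchange is undone to bring the two
    together.\<close>
  have "L 2 (gD y z) (L 3 (gm x y z) ?k') = L 4 (gm x y z) (L 2 (gD y z) ?k')"
    by (simp add: diag eval_nat_numeral)
  also have "L 2 (gD y z) ?k' = L 3 (gc (ob A x y) (ob A y z)) (L 2 (gc (ob A x y) (ob A y z)) (L 3 (gD y z) ?k))"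
    by (simp add: diag eval_nat_numeral R_braid_comul)
  finally show ?thesis
    by (simp add: diag_hopf_gen_L diag eval_nat_numeral R_comul_mult R_braid_comul R_braid_comul_left R_coassoc)
qed

end

section \<open>Fully faithful right adjoints\<close>

context adjunction
begin

lemma eta_natural: "\<lbrakk>a \<in> Obj C; b \<in> Obj C; f \<in> Hom C a b\<rbrakk> \<Longrightarrow>
    \<eta> b \<cdot>\<^bsub>C\<^esub> f = farr G (fobj F a) (fobj F b) (farr F a b f) \<cdot>\<^bsub>C\<^esub> \<eta> a"
  using unit.naturality[of a b f] by (simp add: id_functor_def comp_functor_def)

lemma eps_natural: "\<lbrakk>a \<in> Obj D; b \<in> Obj D; f \<in> Hom D a b\<rbrakk> \<Longrightarrow>
    \<epsilon> b \<cdot>\<^bsub>D\<^esub> farr F (fobj G a) (fobj G b) (farr G a b f) = f \<cdot>\<^bsub>D\<^esub> \<epsilon> a"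
  using counit.naturality[of a b f] by (simp add: id_functor_def comp_functor_def)

lemma eta_Hom: "a \<in> Obj C \<Longrightarrow> \<eta> a \<in> Hom C a (fobj G (fobj F a))"
  using unit.component_Hom[of a] by (simp add: id_functor_def comp_functor_def)

lemma eps_Hom: "a \<in> Obj D \<Longrightarrow> \<epsilon> a \<in> Hom D (fobj F (fobj G a)) a"
  using counit.component_Hom[of a] by (simp add: id_functor_def comp_functor_def)

text \<open>It makes \<open>f \<mapsto> G f \<cdot> \<eta> a\<close> injective on arrows out of
  \<open>F a\<close>, which is how equality of such arrows is tested below.\<close>

lemma transpose_transpose:
  assumes "a \<in> Obj C" "d \<in> Obj D" "f \<in> Hom D (fobj F a) d"
  shows "\<epsilon> d \<cdot>\<^bsub>D\<^esub> farr F a (fobj G d) (farr G (fobj F a) d f \<cdot>\<^bsub>C\<^esub> \<eta> a) = f"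
proof -
  let ?a = "fobj F a" and ?Gd = "fobj G d" and ?GFa = "fobj G (fobj F a)"
  note o = assms F.fobj_Obj[OF assms(1)] G.fobj_Obj[OF assms(2)] G.fobj_Obj[OF F.fobj_Obj[OF assms(1)]]
  note o' = F.fobj_Obj[OF o(5)] F.fobj_Obj[OF o(6)]
  have Gf: "farr G ?a d f \<in> Hom C ?GFa ?Gd" using o by (intro G.farr_Hom)
  have "\<epsilon> d \<cdot>\<^bsub>D\<^esub> farr F a ?Gd (farr G ?a d f \<cdot>\<^bsub>C\<^esub> \<eta> a)
      = \<epsilon> d \<cdot>\<^bsub>D\<^esub> (farr F ?GFa ?Gd (farr G ?a d f) \<cdot>\<^bsub>D\<^esub> farr F a ?GFa (\<eta> a))"
    using F.farr_comp[OF o(1,6,5) eta_Hom[OF o(1)] Gf] by simp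
  also have "\<dots> = (\<epsilon> d \<cdot>\<^bsub>D\<^esub> farr F ?GFa ?Gd (farr G ?a d f)) \<cdot>\<^bsub>D\<^esub> farr F a ?GFa (\<eta> a)"
    using F.D.comp_assoc[OF o(4) o'(2,1) o(2) F.farr_Hom[OF o(1,6) eta_Hom[OF o(1)]] F.farr_Hom[OF o(6,5) Gf] eps_Hom[OF o(2)]]
    by simp
  also have "\<dots> = (f \<cdot>\<^bsub>D\<^esub> \<epsilon> ?a) \<cdot>\<^bsub>D\<^esub> farr F a ?GFa (\<eta> a)"
    using eps_natural[OF o(4,2,3)] by simp
  also have "\<dots> = f \<cdot>\<^bsub>D\<^esub> (\<epsilon> ?a \<cdot>\<^bsub>D\<^esub> farr F a ?GFa (\<eta> a))"
    using F.D.comp_assoc[OF o(4) o'(2) o(4) o(2) F.farr_Hom[OF o(1,6) eta_Hom[OF o(1)]] eps_Hom[OF o(4)] o(3)] .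
  also have "\<dots> = f" using triangle_F[OF o(1)] F.D.comp_ident_right[OF o(4,2,3)] by simp
  finally show ?thesis .
qed

text \<open>The inverse \<open>\<theta>\<close> is the preimage under \<open>G\<close> of the unit
  at \<open>G d\<close>. That it is a right inverse follows from a triangle identity and
  faithfulness, that it is a left inverse from transposition.\<close>

lemma fully_faithful_imp_counit_iso:
  assumes "fully_faithful D C G" and d: "d \<in> Obj D"
  shows "is_iso D (fobj F (fobj G d)) d (\<epsilon> d)"
proof -
  let ?Gd = "fobj G d"
  let ?FGd = "fobj F ?Gd"
  let ?GFGd = "fobj G ?FGd"
  note o = d G.fobj_Obj[OF d] F.fobj_Obj[OF G.fobj_Obj[OF d]] G.fobj_Obj[OF F.fobj_Obj[OF G.fobj_Obj[OF d]]]
  note e = eps_Hom[OF d] and n = eta_Hom[OF o(2)]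
  have b: "bij_betw (farr G a b) (Hom D a b) (Hom C (fobj G a) (fobj G b))" if "a \<in> Obj D" "b \<in> Obj D" for a b
    using assms that by (auto simp: fully_faithful_def)
  have "\<eta> ?Gd \<in> farr G d ?FGd ` Hom D d ?FGd"
    using bij_betw_imp_surj_on[OF b[OF o(1,3)]] n by simp
  then obtain \<theta> where t: "\<theta> \<in> Hom D d ?FGd" and tn: "farr G d ?FGd \<theta> = \<eta> ?Gd" by force
  have et: "\<epsilon> d \<cdot>\<^bsub>D\<^esub> \<theta> \<in> Hom D d d" by (rule F.D.comp_hom[OF o(1,3,1) t e])
  have "farr G d d (\<epsilon> d \<cdot>\<^bsub>D\<^esub> \<theta>) = farr G d d (\<one>\<^bsub>D\<^esub> d)"
    using G.farr_comp[OF o(1,3,1) t e] triangle_G[OF d] G.farr_ident[OF d] tn by simp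
  then have 1: "\<epsilon> d \<cdot>\<^bsub>D\<^esub> \<theta> = \<one>\<^bsub>D\<^esub> d"
    using bij_betw_imp_inj_on[OF b[OF o(1,1)]] et F.D.ident_hom[OF d] by (auto dest: inj_onD)
  have te: "\<theta> \<cdot>\<^bsub>D\<^esub> \<epsilon> d \<in> Hom D ?FGd ?FGd" by (rule F.D.comp_hom[OF o(3,1,3) e t])
  have i: "\<one>\<^bsub>D\<^esub> ?FGd \<in> Hom D ?FGd ?FGd" by (rule F.D.ident_hom[OF o(3)])
  have "farr G ?FGd ?FGd (\<theta> \<cdot>\<^bsub>D\<^esub> \<epsilon> d) \<cdot>\<^bsub>C\<^esub> \<eta> ?Gd = (\<eta> ?Gd \<cdot>\<^bsub>C\<^esub> farr G ?FGd d (\<epsilon> d)) \<cdot>\<^bsub>C\<^esub> \<eta> ?Gd"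
    using G.farr_comp[OF o(3,1,3) e t] tn by simp
  also have "\<dots> = \<eta> ?Gd \<cdot>\<^bsub>C\<^esub> (farr G ?FGd d (\<epsilon> d) \<cdot>\<^bsub>C\<^esub> \<eta> ?Gd)"
    by (rule F.C.comp_assoc[OF o(2,4,2,4) n G.farr_Hom[OF o(3,1) e] n])
  also have "\<dots> = \<eta> ?Gd" using triangle_G[OF d] F.C.comp_ident_right[OF o(2,4) n] by simp
  also have "\<dots> = farr G ?FGd ?FGd (\<one>\<^bsub>D\<^esub> ?FGd) \<cdot>\<^bsub>C\<^esub> \<eta> ?Gd"
    using G.farr_ident[OF o(3)] F.C.comp_ident_left[OF o(2,4) n] by simp
  finally have "\<theta> \<cdot>\<^bsub>D\<^esub> \<epsilon> d = \<one>\<^bsub>D\<^esub> ?FGd"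
    by (metis (no_types) transpose_transpose[OF o(2,3) te] transpose_transpose[OF o(2,3) i])
  with 1 t e show ?thesis by (auto simp: is_iso_def is_inverse_def)
qed

text \<open>Let \<open>\<theta>\<close> invert the counit at \<open>a\<close>. Naturality of the
  counit recovers \<open>f\<close> from \<open>F (G f)\<close> by composing with
  \<open>\<theta>\<close>, and \<open>\<epsilon> b \<cdot> F h \<cdot> \<theta>\<close> is a
  preimage of \<open>h\<close>.\<close>

lemma counit_iso_imp_fully_faithful:
  assumes iso: "\<And>d. d \<in> Obj D \<Longrightarrow> is_iso D (fobj F (fobj G d)) d (\<epsilon> d)"
  shows "fully_faithful D C G"
  unfolding fully_faithful_def
proof (intro conjI ballI)
  show "is_functor D C G" by (rule G.is_functor_axioms)
  fix a b assume a: "a \<in> Obj D" and b: "b \<in> Obj D"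
  let ?Ga = "fobj G a" and ?Gb = "fobj G b"
  let ?FGa = "fobj F ?Ga" and ?FGb = "fobj F ?Gb"
  note o = a b G.fobj_Obj[OF a] G.fobj_Obj[OF b] F.fobj_Obj[OF G.fobj_Obj[OF a]] F.fobj_Obj[OF G.fobj_Obj[OF b]]
  obtain \<theta> where t: "\<theta> \<in> Hom D a ?FGa" "\<theta> \<cdot>\<^bsub>D\<^esub> \<epsilon> a = \<one>\<^bsub>D\<^esub> ?FGa" "\<epsilon> a \<cdot>\<^bsub>D\<^esub> \<theta> = \<one>\<^bsub>D\<^esub> a"
    using iso[OF a] by (auto simp: is_iso_def is_inverse_def)
  note ea = eps_Hom[OF a] and eb = eps_Hom[OF b]
  have can: "(f \<cdot>\<^bsub>D\<^esub> \<epsilon> a) \<cdot>\<^bsub>D\<^esub> \<theta> = f" if "f \<in> Hom D a b" for f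
    using F.D.comp_assoc[OF o(1,5,1,2) t(1) ea that] t(3) F.D.comp_ident_right[OF a b that] by simp
  have inj: "inj_on (farr G a b) (Hom D a b)"
  proof (rule inj_onI)
    fix f g assume f: "f \<in> Hom D a b" and g: "g \<in> Hom D a b" and e: "farr G a b f = farr G a b g"
    have "f \<cdot>\<^bsub>D\<^esub> \<epsilon> a = g \<cdot>\<^bsub>D\<^esub> \<epsilon> a"
      unfolding eps_natural[OF a b f, symmetric] eps_natural[OF a b g, symmetric] e ..
    then show "f = g" by (metis (no_types) can[OF f] can[OF g])
  qed
  have "h \<in> farr G a b ` Hom D a b" if h: "h \<in> Hom C ?Ga ?Gb" for h
  proof -
    let ?Fh = "farr F ?Ga ?Gb h"
    have Fh: "?Fh \<in> Hom D ?FGa ?FGb" by (rule F.farr_Hom[OF o(3,4) h])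
    have eFh: "\<epsilon> b \<cdot>\<^bsub>D\<^esub> ?Fh \<in> Hom D ?FGa b" by (rule F.D.comp_hom[OF o(5,6,2) Fh eb])
    let ?g = "(\<epsilon> b \<cdot>\<^bsub>D\<^esub> ?Fh) \<cdot>\<^bsub>D\<^esub> \<theta>"
    have g: "?g \<in> Hom D a b" by (rule F.D.comp_hom[OF o(1,5,2) t(1) eFh])
    have "\<epsilon> b \<cdot>\<^bsub>D\<^esub> farr F ?Ga ?Gb (farr G a b ?g) = ?g \<cdot>\<^bsub>D\<^esub> \<epsilon> a"
      by (rule eps_natural[OF a b g])
    also have "\<dots> = \<epsilon> b \<cdot>\<^bsub>D\<^esub> ?Fh"
      using F.D.comp_assoc[OF o(5,1,5,2) ea t(1) eFh] t(2) F.D.comp_ident_right[OF o(5,2) eFh] by simp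
    finally have e: "\<epsilon> b \<cdot>\<^bsub>D\<^esub> farr F ?Ga ?Gb (farr G a b ?g) = \<epsilon> b \<cdot>\<^bsub>D\<^esub> ?Fh" .
    have rec: "farr G ?FGb b (\<epsilon> b) \<cdot>\<^bsub>C\<^esub> (\<eta> ?Gb \<cdot>\<^bsub>C\<^esub> k) = k" if k: "k \<in> Hom C ?Ga ?Gb" for k
      using F.C.comp_assoc[OF o(3,4) G.fobj_Obj[OF o(6)] o(4) k eta_Hom[OF o(4)] G.farr_Hom[OF o(6,2) eb]]
        triangle_G[OF b] F.C.comp_ident_left[OF o(3,4) k] by simp
    \<comment> \<open>The other composite of the two transpositions: an arrow \<open>k\<close> can
      be read off from \<open>\<epsilon> b \<cdot> F k\<close>.\<close>
    have tr: "farr G ?FGa b (\<epsilon> b \<cdot>\<^bsub>D\<^esub> farr F ?Ga ?Gb k) \<cdot>\<^bsub>C\<^esub> \<eta> ?Ga = k" if k: "k \<in> Hom C ?Ga ?Gb" for k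
    proof -
      have Fk: "farr F ?Ga ?Gb k \<in> Hom D ?FGa ?FGb" by (rule F.farr_Hom[OF o(3,4) k])
      have "farr G ?FGa b (\<epsilon> b \<cdot>\<^bsub>D\<^esub> farr F ?Ga ?Gb k) \<cdot>\<^bsub>C\<^esub> \<eta> ?Ga
        = farr G ?FGb b (\<epsilon> b) \<cdot>\<^bsub>C\<^esub> (farr G ?FGa ?FGb (farr F ?Ga ?Gb k) \<cdot>\<^bsub>C\<^esub> \<eta> ?Ga)"
        using G.farr_comp[OF o(5,6,2) Fk eb]
          F.C.comp_assoc[OF o(3) G.fobj_Obj[OF o(5)] G.fobj_Obj[OF o(6)] o(4) eta_Hom[OF o(3)] G.farr_Hom[OF o(5,6) Fk] G.farr_Hom[OF o(6,2) eb]]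
        by simp
      then show ?thesis using eta_natural[OF o(3,4) k] rec[OF k] by simp
    qed
    have "farr G a b ?g = h" using tr[OF G.farr_Hom[OF a b g]] tr[OF h] e by simp
    then show ?thesis by (rule image_eqI[of h "farr G a b" ?g "Hom D a b", OF sym g])
  qed
  then show "bij_betw (farr G a b) (Hom D a b) (Hom C ?Ga ?Gb)"
    using inj G.farr_Hom[OF a b] by (auto simp: bij_betw_def)
qed

end

section \<open>Hopf modules and their coinvariants\<close>

context strict_monoidal_category
begin

lemma fits_L_same:
  assumes "valid f" "fits n (dm f) k"
  shows "fits n (cd f) (L n f k)"
proof -
  obtain l r where "cd k = l @ dm f @ r" "length l = n" "valid k" using assms(2) by (rule fitsE)
  then have "cd (L n f k) = l @ cd f @ r" "occurs_at n (cd f) (l @ cd f @ r)"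
    using cd_L[of n f k] assms by (auto simp: replace_at_append)
  then show ?thesis using assms by (simp add: fits_def[of n "cd f"])
qed

end

locale hopf_setting = cv_context V A
  for V :: "('o, 'a) braided_category" (structure)
    and A :: "('x, 'o, 'a) cv_category" +
  assumes equalizers: "has_equalizers V"

locale hopf_mod = hopf_setting V A + hopf_module V A M
  for V :: "('o, 'a) braided_category" (structure)
    and A :: "('x, 'o, 'a) cv_category"
    and M :: "('x, 'o, 'a) hopf_module"
begin

lemma mob [simp]: "x \<in> base A \<Longrightarrow> y \<in> base A \<Longrightarrow> mob M x y \<in> Obj V"
  by (rule PiE_mem[OF PiE_mem[OF mob_Obj]])

lemma act [simp]: "x \<in> base A \<Longrightarrow> y \<in> base A \<Longrightarrow> z \<in> base A \<Longrightarrow>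
    act M x y z \<in> Hom V (mob M x y \<otimes>\<^sub>o ob A y z) (mob M x z)"
  by (rule PiE_mem[OF PiE_mem[OF PiE_mem[OF act_Hom]]])

lemma coact [simp]: "x \<in> base A \<Longrightarrow> y \<in> base A \<Longrightarrow>
    coact M x y \<in> Hom V (mob M x y) (mob M x y \<otimes>\<^sub>o ob A x y)"
  by (rule PiE_mem[OF PiE_mem[OF coact_Hom]])

definition gp where "gp x y z = mk [mob M x y, ob A y z] (act M x y z) [mob M x z]"
definition gr where "gr x y = mk [mob M x y] (coact M x y) [mob M x y, ob A x y]"

lemma gp_simps [simp]: "dm (gp x y z) = [mob M x y, ob A y z]" "cd (gp x y z) = [mob M x z]"
  "raw (gp x y z) = act M x y z" "dm (gr x y) = [mob M x y]" "cd (gr x y) = [mob M x y, ob A x y]"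
  "raw (gr x y) = coact M x y"
  "x \<in> base A \<Longrightarrow> y \<in> base A \<Longrightarrow> z \<in> base A \<Longrightarrow> valid (gp x y z)"
  "x \<in> base A \<Longrightarrow> y \<in> base A \<Longrightarrow> valid (gr x y)"
  "x \<in> base A \<Longrightarrow> y \<in> base A \<Longrightarrow> z \<in> base A \<Longrightarrow> cdo (gp x y z) = Some [mob M x z]"
  "x \<in> base A \<Longrightarrow> y \<in> base A \<Longrightarrow> cdo (gr x y) = Some [mob M x y, ob A x y]"
  by (simp_all add: gp_def gr_def tensor_unit_obj cdo_def)

lemma right_module: "x \<in> base A \<Longrightarrow> right_module V A (mob M x) (act M x)"
  by unfold_locales (simp_all add: act_assoc act_unity)

lemma R_mact_assoc:
  assumes [simp]: "x \<in> base A" "y \<in> base A" "z \<in> base A" "u \<in> base A"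
    and k: "fits n [mob M x y, ob A y z, ob A z u] k"
  shows "L n (gp x z u) (L n (gp x y z) k) = L n (gp x y u) (L (Suc n) (gm y z u) k)"
proof -
  interpret P: right_module V A "mob M x" "act M x" by (rule right_module) simp
  have "P.ga y z = gp x y z" for y z by (simp add: P.ga_def gp_def)
  then show ?thesis using P.R_act_assoc[OF assms(2-)] by simp
qed

lemma R_mact_unit:
  assumes [simp]: "x \<in> base A" "y \<in> base A" and k: "fits n [mob M x y] k"
  shows "L n (gp x y y) (L (Suc n) (gu y) k) = k"
proof -
  interpret P: right_module V A "mob M x" "act M x" by (rule right_module) simp
  have "P.ga y z = gp x y z" for y z by (simp add: P.ga_def gp_def)
  then show ?thesis using P.R_act_unit[OF assms(2-)] by simp
qed

lemma R_coact_coassoc: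
  assumes [simp]: "x \<in> base A" "y \<in> base A" and k: "fits n [mob M x y] k"
  shows "L n (gr x y) (L n (gr x y) k) = L (Suc n) (gD x y) (L n (gr x y) k)"
proof -
  have "(gr x y \<parallel> I [ob A x y]) \<odot> gr x y = (I [mob M x y] \<parallel> gD x y) \<odot> gr x y"
    using coact_coassoc[of x y] by (intro diagram_eqI) (simp_all add: par_seq_simps tensor_unit_obj)
  from L_cong_lift[OF this, of n k] show ?thesis using k by (simp add: diag)
qed

lemma R_coact_counit:
  assumes [simp]: "x \<in> base A" "y \<in> base A" and k: "fits n [mob M x y] k"
  shows "L (Suc n) (ge x y) (L n (gr x y) k) = k"
proof -
  have "(I [mob M x y] \<parallel> ge x y) \<odot> gr x y = I [mob M x y]"
    using coact_counit[of x y] by (intro diagram_eqI) (simp_all add: par_seq_simps tensor_unit_obj)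
  from L_cong_lift[OF this, of n k] show ?thesis using k by (simp add: diag)
qed

lemma R_compat:
  assumes [simp]: "x \<in> base A" "y \<in> base A" "z \<in> base A"
    and k: "fits n [mob M x y, ob A y z] k"
  shows "L n (gr x z) (L n (gp x y z) k) =
    L n (gp x y z) (L (Suc (Suc n)) (gm x y z) (L (Suc n) (gc (ob A x y) (ob A y z))
      (L n (gr x y) (L (Suc n) (gD y z) k))))"
proof -
  have "gr x z \<odot> gp x y z = (gp x y z \<parallel> gm x y z) \<odot>
      (I [mob M x y] \<parallel> gc (ob A x y) (ob A y z) \<parallel> I [ob A y z]) \<odot> (gr x y \<parallel> gD y z)"
    using compatibility[of x y z] by (intro diagram_eqI) (simp_all add: par_seq_simps tensor_unit_obj)
  from L_cong_lift[OF this, of n k] show ?thesis using k by (simp add: diag)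
qed

abbreviation E where "E \<equiv> coinv_obj V A M"
abbreviation inc where "inc \<equiv> coinv_incl V A M"

lemma coinv_equalizer:
  assumes [simp]: "x \<in> base A"
  shows "is_equalizer V (mob M x x) (mob M x x \<otimes>\<^sub>o ob A x x)
      (coact M x x) (\<one> (mob M x x) \<otimes> unity A x) (E x) (inc x)"
proof -
  have u: "\<one> (mob M x x) \<otimes> unity A x \<in> Hom V (mob M x x) (mob M x x \<otimes>\<^sub>o ob A x x)"
    using tensor_Hom[of "mob M x x" "mob M x x" \<k> "ob A x x" "\<one> (mob M x x)" "unity A x"]
    by (simp add: ident_hom unit_obj_Obj tensor_unit_obj)
  let ?Q = "\<lambda>p. is_equalizer V (mob M x x) (mob M x x \<otimes>\<^sub>o ob A x x)
      (coact M x x) (\<one> (mob M x x) \<otimes> unity A x) (fst p) (snd p)"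
  have "\<exists>e i. is_equalizer V (mob M x x) (mob M x x \<otimes>\<^sub>o ob A x x)
      (coact M x x) (\<one> (mob M x x) \<otimes> unity A x) e i"
    using equalizers u by (simp add: has_equalizers_def tensor_Obj)
  then have "\<exists>p. ?Q p" by auto
  then have "?Q (coinv V A M x)" unfolding coinv_def case_prod_beta by (rule someI_ex)
  then show ?thesis .
qed

lemma E_Obj [simp]: "x \<in> base A \<Longrightarrow> E x \<in> Obj V"
  and inc_Hom [simp]: "x \<in> base A \<Longrightarrow> inc x \<in> Hom V (E x) (mob M x x)"
  and inc_eq: "x \<in> base A \<Longrightarrow> coact M x x \<cdot> inc x = (\<one> (mob M x x) \<otimes> unity A x) \<cdot> inc x"
  using coinv_equalizer[of x] by (auto simp: is_equalizer_def)

lemma inc_ex1: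
  "\<lbrakk>x \<in> base A; d \<in> Obj V; h \<in> Hom V d (mob M x x); coact M x x \<cdot> h = (\<one> (mob M x x) \<otimes> unity A x) \<cdot> h\<rbrakk>
    \<Longrightarrow> \<exists>!u. u \<in> Hom V d (E x) \<and> inc x \<cdot> u = h"
  using coinv_equalizer[of x] by (auto simp: is_equalizer_def)

lemma coinv_lift:
  assumes "x \<in> base A" "d \<in> Obj V" "h \<in> Hom V d (mob M x x)"
    "coact M x x \<cdot> h = (\<one> (mob M x x) \<otimes> unity A x) \<cdot> h"
  shows "coinv_lift V A M x d h \<in> Hom V d (E x)" "inc x \<cdot> coinv_lift V A M x d h = h"
  using theI'[OF inc_ex1[OF assms]] by (auto simp: coinv_lift_def)

lemma one_unity_Hom: "x \<in> base A \<Longrightarrow> \<one> (mob M x x) \<otimes> unity A x \<in> Hom V (mob M x x) (mob M x x \<otimes>\<^sub>o ob A x x)"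
  using tensor_Hom[of "mob M x x" "mob M x x" \<k> "ob A x x" "\<one> (mob M x x)" "unity A x"]
  by (simp add: ident_hom unit_obj_Obj tensor_unit_obj)

lemma inc_mono:
  assumes x [simp]: "x \<in> base A" "d \<in> Obj V" and "u \<in> Hom V d (E x)" "v \<in> Hom V d (E x)" "inc x \<cdot> u = inc x \<cdot> v"
  shows "u = v"
proof -
  have h: "inc x \<cdot> u \<in> Hom V d (mob M x x)" using assms by (intro comp_hom[of d "E x"]) auto
  have "coact M x x \<cdot> inc x \<cdot> u = (\<one> (mob M x x) \<otimes> unity A x) \<cdot> inc x \<cdot> u"
    using comp_assoc[of d "E x" "mob M x x" "mob M x x \<otimes>\<^sub>o ob A x x" u "inc x" "coact M x x"]
      comp_assoc[of d "E x" "mob M x x" "mob M x x \<otimes>\<^sub>o ob A x x" u "inc x" "\<one> (mob M x x) \<otimes> unity A x"]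
      inc_eq[of x] one_unity_Hom[of x] assms by (simp add: tensor_Obj)
  from inc_ex1[OF x h this] show ?thesis using assms by auto
qed

definition gi where "gi x = mk [E x] (inc x) [mob M x x]"

lemma gi_simps [simp]: "dm (gi x) = [E x]" "cd (gi x) = [mob M x x]" "raw (gi x) = inc x"
  "x \<in> base A \<Longrightarrow> valid (gi x)" "x \<in> base A \<Longrightarrow> cdo (gi x) = Some [mob M x x]"
  by (simp_all add: gi_def tensor_unit_obj cdo_def)

lemma R_inc:
  assumes [simp]: "x \<in> base A" and k: "fits n [E x] k"
  shows "L n (gr x x) (L n (gi x) k) = L n (gi x) (L (Suc n) (gu x) k)"
proof -
  have "gr x x \<odot> gi x = (I [mob M x x] \<parallel> gu x) \<odot> gi x"
    using inc_eq[of x] by (intro diagram_eqI) (simp_all add: par_seq_simps tensor_unit_obj)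
  from L_cong_lift[OF this, of n k] show ?thesis using k by (simp add: diag)
qed

text \<open>Sorting applies the unit before the inclusion to its left, so \<open>R_mact_unit\<close>
  no longer matches; this is the same unit law in sorted order.\<close>

lemma R_mact_unit_inc:
  assumes [simp]: "x \<in> base A" and k: "fits n [E x] k"
  shows "L n (gp x x x) (L n (gi x) (L (Suc n) (gu x) k)) = L n (gi x) k"
proof -
  have "L n (gp x x x) (L (Suc n) (gu x) (L n (gi x) k)) = L n (gi x) k"
    using fits_L_same[of "gi x" n k] k by (intro R_mact_unit) simp_all
  then show ?thesis by (simp add: diag)
qed

definition g_counit where "g_counit x y = gp x x y \<odot> (gi x \<parallel> I [ob A x y])"

lemma g_counit_simps:
  assumes [simp]: "x \<in> base A" "y \<in> base A"
  shows "dm (g_counit x y) = [E x, ob A x y]" "cd (g_counit x y) = [mob M x y]" "valid (g_counit x y)"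
    "raw (g_counit x y) = FG_counit V A M x y"
  by (simp_all add: g_counit_def par_seq_simps FG_counit_def tensor_unit_obj)

lemma g_counit_L: "x \<in> base A \<Longrightarrow> y \<in> base A \<Longrightarrow> g_counit x y = L 0 (gp x x y) (L 0 (gi x) (I [E x, ob A x y]))"
  by (simp add: g_counit_def diag)

lemma counit_act:
  assumes [simp]: "x \<in> base A" "y \<in> base A" "z \<in> base A"
  shows "FG_counit V A M x z \<cdot> (\<one> (E x) \<otimes> mult A x y z) = act M x y z \<cdot> (FG_counit V A M x y \<otimes> \<one> (ob A y z))"
proof -
  have "g_counit x z \<odot> (I [E x] \<parallel> gm x y z) = gp x y z \<odot> (g_counit x y \<parallel> I [ob A y z])"
    by (simp add: g_counit_L diag R_mact_assoc)
  from arg_cong[OF this, of raw] show ?thesis by (simp add: par_seq_simps g_counit_simps tensor_unit_obj)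
qed

text \<open>By compatibility the coaction of \<open>i(n) a\<close> is
  \<open>i(n) a_1 \<otimes> 1 a_2\<close>, because \<open>i(n)\<close> is coinvariant.\<close>

lemma counit_coact:
  assumes [simp]: "x \<in> base A" "y \<in> base A"
  shows "coact M x y \<cdot> FG_counit V A M x y = (FG_counit V A M x y \<otimes> \<one> (ob A x y)) \<cdot> (\<one> (E x) \<otimes> comul (coalg A x y))"
proof -
  have "gr x y \<odot> g_counit x y = (g_counit x y \<parallel> I [ob A x y]) \<odot> (I [E x] \<parallel> gD x y)"
    by (simp add: g_counit_L diag R_compat R_inc R_braid_unit_left R_unit_left)
  from arg_cong[OF this, of raw] show ?thesis by (simp add: par_seq_simps g_counit_simps tensor_unit_obj)
qed

text \<open>This becomes the triangle identity for \<open>G\<close>, once both sides of that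
  identity are composed with the monic \<open>inc x\<close>.\<close>

lemma counit_unity:
  assumes [simp]: "x \<in> base A"
  shows "FG_counit V A M x x \<cdot> (\<one> (E x) \<otimes> unity A x) = inc x"
proof -
  have "g_counit x x \<odot> (I [E x] \<parallel> gu x) = gi x"
    using L_atom[of "gi x"] by (simp add: g_counit_L diag R_mact_unit_inc)
  from arg_cong[OF this, of raw] show ?thesis by (simp add: par_seq_simps g_counit_simps tensor_unit_obj)
qed

lemma counit_Hom':
  "x \<in> base A \<Longrightarrow> y \<in> base A \<Longrightarrow> FG_counit V A M x y \<in> Hom V (E x \<otimes>\<^sub>o ob A x y) (mob M x y)"
  using validD(3)[of "g_counit x y"] by (simp add: g_counit_simps tensor_unit_obj)

end

section \<open>The adjunction\<close>

lemma family_category_simps: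
  "Obj (family_category V X) = (\<Pi>\<^sub>E x \<in> X. Obj V)"
  "Hom (family_category V X) M N = (\<Pi>\<^sub>E x \<in> X. Hom V (M x) (N x))"
  "Ident (family_category V X) M = (\<lambda>x \<in> X. \<one>\<^bsub>V\<^esub> (M x))"
  "Comp (family_category V X) g f = (\<lambda>x \<in> X. g x \<cdot>\<^bsub>V\<^esub> f x)"
  by (simp_all add: family_category_def)

lemma hopf_module_category_simps:
  "Obj (hopf_module_category V A) = {M. hopf_module V A M}"
  "Hom (hopf_module_category V A) = hopf_module_hom V A"
  "Ident (hopf_module_category V A) M = (\<lambda>x \<in> base A. \<lambda>y \<in> base A. \<one>\<^bsub>V\<^esub> (mob M x y))"
  "Comp (hopf_module_category V A) g f = (\<lambda>x \<in> base A. \<lambda>y \<in> base A. g x y \<cdot>\<^bsub>V\<^esub> f x y)"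
  by (simp_all add: hopf_module_category_def)

text \<open>Outside the index sets only extensionality of the two families counts, so
  \<open>B\<close> and \<open>C\<close> may differ.\<close>

lemma PiE2_ext:
  assumes "f \<in> (\<Pi>\<^sub>E x \<in> X. \<Pi>\<^sub>E y \<in> Y. B x y)" "g \<in> (\<Pi>\<^sub>E x \<in> X. \<Pi>\<^sub>E y \<in> Y. C x y)"
    "\<And>x y. x \<in> X \<Longrightarrow> y \<in> Y \<Longrightarrow> f x y = g x y"
  shows "f = g"
proof (rule ext, rule ext)
  fix x y
  show "f x y = g x y"
  proof (cases "x \<in> X")
    case x: True
    note m = PiE_mem[OF assms(1) x] PiE_mem[OF assms(2) x]
    show ?thesis
      using PiE_arb[OF m(1), of y] PiE_arb[OF m(2), of y] assms(3)[OF x, of y] by metis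
  next
    case False
    then show ?thesis using PiE_arb[OF assms(1)] PiE_arb[OF assms(2)] by simp
  qed
qed

lemma restrict2_cong:
  "(\<And>x y. x \<in> X \<Longrightarrow> y \<in> Y \<Longrightarrow> h x y = k x y) \<Longrightarrow> (\<lambda>x\<in>X. \<lambda>y\<in>Y. h x y) = (\<lambda>x\<in>X. \<lambda>y\<in>Y. k x y)"
  by (intro restrict_ext) simp

lemma PiE2_mem: "f \<in> (\<Pi>\<^sub>E x \<in> X. \<Pi>\<^sub>E y \<in> Y. B x y) \<Longrightarrow> x \<in> X \<Longrightarrow> y \<in> Y \<Longrightarrow> f x y \<in> B x y"
  by (drule (1) PiE_mem, erule (1) PiE_mem)

lemma (in category) family_category: "category (family_category C X)"
proof (unfold_locales, unfold family_category_simps)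
  fix a assume "a \<in> (\<Pi>\<^sub>E x \<in> X. Obj C)"
  note m = PiE_mem[OF this]
  show "(\<lambda>x\<in>X. \<one> (a x)) \<in> (\<Pi>\<^sub>E x \<in> X. Hom C (a x) (a x))"
    using ident_hom[OF m] by simp
next
  fix a b c f g assume "a \<in> (\<Pi>\<^sub>E x \<in> X. Obj C)" "b \<in> (\<Pi>\<^sub>E x \<in> X. Obj C)" "c \<in> (\<Pi>\<^sub>E x \<in> X. Obj C)"
    "f \<in> (\<Pi>\<^sub>E x \<in> X. Hom C (a x) (b x))" "g \<in> (\<Pi>\<^sub>E x \<in> X. Hom C (b x) (c x))"
  note m = this[THEN PiE_mem]
  show "(\<lambda>x\<in>X. g x \<cdot> f x) \<in> (\<Pi>\<^sub>E x \<in> X. Hom C (a x) (c x))"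
    unfolding restrict_PiE_iff using comp_hom[OF m] by blast
next
  fix a b f assume "a \<in> (\<Pi>\<^sub>E x \<in> X. Obj C)" "b \<in> (\<Pi>\<^sub>E x \<in> X. Obj C)"
    and f: "f \<in> (\<Pi>\<^sub>E x \<in> X. Hom C (a x) (b x))"
  note m = this[THEN PiE_mem]
  show "(\<lambda>x\<in>X. f x \<cdot> (\<lambda>x\<in>X. \<one> (a x)) x) = f"
    using comp_ident_right[OF m] PiE_arb[OF f] by (auto simp: fun_eq_iff restrict_def)
  show "(\<lambda>x\<in>X. (\<lambda>x\<in>X. \<one> (b x)) x \<cdot> f x) = f"
    using comp_ident_left[OF m] PiE_arb[OF f] by (auto simp: fun_eq_iff restrict_def)
next
  fix a b c d f g h assume "a \<in> (\<Pi>\<^sub>E x \<in> X. Obj C)" "b \<in> (\<Pi>\<^sub>E x \<in> X. Obj C)" "c \<in> (\<Pi>\<^sub>E x \<in> X. Obj C)"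
    "d \<in> (\<Pi>\<^sub>E x \<in> X. Obj C)"
    "f \<in> (\<Pi>\<^sub>E x \<in> X. Hom C (a x) (b x))" "g \<in> (\<Pi>\<^sub>E x \<in> X. Hom C (b x) (c x))"
    "h \<in> (\<Pi>\<^sub>E x \<in> X. Hom C (c x) (d x))"
  note m = this[THEN PiE_mem]
  show "(\<lambda>x\<in>X. (\<lambda>x\<in>X. h x \<cdot> g x) x \<cdot> f x) = (\<lambda>x\<in>X. h x \<cdot> (\<lambda>x\<in>X. g x \<cdot> f x) x)"
    using comp_assoc[OF m] by (auto simp: fun_eq_iff restrict_def)
qed

context hopf_setting
begin

lemma hopf_modI: "hopf_module V A M \<Longrightarrow> hopf_mod V A M"
  by (intro hopf_mod.intro hopf_setting_axioms)

lemma free_simps [simp]: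
  "x \<in> base A \<Longrightarrow> y \<in> base A \<Longrightarrow> mob (free_module V A N) x y = N x \<otimes>\<^sub>o ob A x y"
  "x \<in> base A \<Longrightarrow> y \<in> base A \<Longrightarrow> z \<in> base A \<Longrightarrow> act (free_module V A N) x y z = \<one> (N x) \<otimes> mult A x y z"
  "x \<in> base A \<Longrightarrow> y \<in> base A \<Longrightarrow> coact (free_module V A N) x y = \<one> (N x) \<otimes> comul (coalg A x y)"
  by (simp_all add: free_module_def)

lemma family_mem [simp]: "N \<in> (\<Pi>\<^sub>E x \<in> base A. Obj V) \<Longrightarrow> x \<in> base A \<Longrightarrow> N x \<in> Obj V"
  by (rule PiE_mem)

lemma raw_congI: "s = t \<Longrightarrow> raw s = raw t" by simp

lemma free_hopf:
  assumes N [simp]: "N \<in> (\<Pi>\<^sub>E x \<in> base A. Obj V)"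
  shows "hopf_module V A (free_module V A N)"
proof
  show "mob (free_module V A N) \<in> (\<Pi>\<^sub>E x \<in> base A. \<Pi>\<^sub>E y \<in> base A. Obj V)"
    by (simp add: free_module_def tensor_Obj)
  show "act (free_module V A N) \<in> (\<Pi>\<^sub>E x\<in>base A. \<Pi>\<^sub>E y\<in>base A. \<Pi>\<^sub>E z\<in>base A.
      Hom V (mob (free_module V A N) x y \<otimes>\<^sub>o ob A y z) (mob (free_module V A N) x z))"
    using tensor_Hom[of "N x" "N x" _ _ "\<one> (N x)" for x]
    by (simp add: free_module_def tensor_Obj ident_hom tensor_obj_assoc)
  show "coact (free_module V A N) \<in> (\<Pi>\<^sub>E x\<in>base A. \<Pi>\<^sub>E y\<in>base A.
      Hom V (mob (free_module V A N) x y) (mob (free_module V A N) x y \<otimes>\<^sub>o ob A x y))"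
    using tensor_Hom[of "N x" "N x" _ _ "\<one> (N x)" for x]
    by (simp add: free_module_def tensor_Obj ident_hom tensor_obj_assoc)
next
  fix x y z u assume [simp]: "x \<in> base A" "y \<in> base A" "z \<in> base A" "u \<in> base A"
  have "(I [N x] \<parallel> gm x z u) \<odot> ((I [N x] \<parallel> gm x y z) \<parallel> I [ob A z u]) =
      (I [N x] \<parallel> gm x y u) \<odot> (I [N x, ob A x y] \<parallel> gm y z u)"
    by (simp add: diag R_assoc)
  from raw_congI[OF this] show "act (free_module V A N) x z u \<cdot> (act (free_module V A N) x y z \<otimes> \<one> (ob A z u)) =
      act (free_module V A N) x y u \<cdot> (\<one> (mob (free_module V A N) x y) \<otimes> mult A y z u)"
    by (simp add: par_seq_simps tensor_unit_obj)
  have "(I [N x] \<parallel> gm x y y) \<odot> (I [N x, ob A x y] \<parallel> gu y) = I [N x, ob A x y]"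
    by (simp add: diag R_unit_right)
  from raw_congI[OF this] show "act (free_module V A N) x y y \<cdot> (\<one> (mob (free_module V A N) x y) \<otimes> unity A y) =
      \<one> (mob (free_module V A N) x y)"
    by (simp add: par_seq_simps tensor_unit_obj)
  have "((I [N x] \<parallel> gD x y) \<parallel> I [ob A x y]) \<odot> (I [N x] \<parallel> gD x y) =
     (I [N x, ob A x y] \<parallel> gD x y) \<odot> (I [N x] \<parallel> gD x y)"
    by (simp add: diag R_coassoc)
  from raw_congI[OF this]
  show "(coact (free_module V A N) x y \<otimes> \<one> (ob A x y)) \<cdot> coact (free_module V A N) x y =
      (\<one> (mob (free_module V A N) x y) \<otimes> comul (coalg A x y)) \<cdot> coact (free_module V A N) x y"
    by (simp add: par_seq_simps tensor_unit_obj)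
  have "(I [N x, ob A x y] \<parallel> ge x y) \<odot> (I [N x] \<parallel> gD x y) = I [N x, ob A x y]"
    by (simp add: diag R_counit_right)
  from raw_congI[OF this]
  show "(\<one> (mob (free_module V A N) x y) \<otimes> counit (coalg A x y)) \<cdot> coact (free_module V A N) x y =
      \<one> (mob (free_module V A N) x y)"
    by (simp add: par_seq_simps tensor_unit_obj)
  have "(I [N x] \<parallel> gD x z) \<odot> (I [N x] \<parallel> gm x y z) = ((I [N x] \<parallel> gm x y z) \<parallel> gm x y z)
    \<odot> (I [N x, ob A x y] \<parallel> gc (ob A x y) (ob A y z) \<parallel> I [ob A y z]) \<odot> ((I [N x] \<parallel> gD x y) \<parallel> gD y z)"
    by (simp add: diag R_comul_mult)
  from raw_congI[OF this]
  show "coact (free_module V A N) x z \<cdot> act (free_module V A N) x y z =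
      (act (free_module V A N) x y z \<otimes> mult A x y z)
      \<cdot> (\<one> (mob (free_module V A N) x y) \<otimes> \<c> (ob A x y) (ob A y z) \<otimes> \<one> (ob A y z))
      \<cdot> (coact (free_module V A N) x y \<otimes> comul (coalg A y z))"
    by (simp add: par_seq_simps tensor_unit_obj)
qed

lemma hopf_module_hom_comp:
  assumes M: "hopf_module V A M" and M': "hopf_module V A M'" and M'': "hopf_module V A M''"
    and f: "f \<in> hopf_module_hom V A M M'" and g: "g \<in> hopf_module_hom V A M' M''"
  shows "(\<lambda>x\<in>base A. \<lambda>y\<in>base A. g x y \<cdot> f x y) \<in> hopf_module_hom V A M M''"
proof -
  interpret M: hopf_mod V A M by (rule hopf_modI[OF M])
  interpret M': hopf_mod V A M' by (rule hopf_modI[OF M'])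
  interpret M'': hopf_mod V A M'' by (rule hopf_modI[OF M''])
  have fH: "f x y \<in> Hom V (mob M x y) (mob M' x y)"
    and gH: "g x y \<in> Hom V (mob M' x y) (mob M'' x y)" if "x \<in> base A" "y \<in> base A" for x y
    using f g that by (auto simp: hopf_module_hom_def dest: PiE2_mem)
  define gf where "gf x y = mk [mob M x y] (f x y) [mob M' x y]" for x y
  define gg where "gg x y = mk [mob M' x y] (g x y) [mob M'' x y]" for x y
  have gf [simp]: "dm (gf x y) = [mob M x y]" "cd (gf x y) = [mob M' x y]" "raw (gf x y) = f x y"
    and gg [simp]: "dm (gg x y) = [mob M' x y]" "cd (gg x y) = [mob M'' x y]" "raw (gg x y) = g x y" for x y
    by (simp_all add: gf_def gg_def)
  have [simp]: "valid (gf x y)" "valid (gg x y)" "cdo (gf x y) = Some [mob M' x y]" "cdo (gg x y) = Some [mob M'' x y]"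
    if [simp]: "x \<in> base A" "y \<in> base A" for x y
    using fH[OF that] gH[OF that] by (simp_all add: gf_def gg_def cdo_def tensor_unit_obj)
  show ?thesis unfolding hopf_module_hom_def
  proof (intro CollectI conjI ballI)
    show "(\<lambda>x\<in>base A. \<lambda>y\<in>base A. g x y \<cdot> f x y) \<in> (\<Pi>\<^sub>E x\<in>base A. \<Pi>\<^sub>E y\<in>base A. Hom V (mob M x y) (mob M'' x y))"
      unfolding restrict_PiE_iff
    proof (intro ballI)
      fix x y assume "x \<in> base A" "y \<in> base A"
      then show "g x y \<cdot> f x y \<in> Hom V (mob M x y) (mob M'' x y)"
        by (intro comp_hom[of _ "mob M' x y"] fH gH) simp_all
    qed
  next
    fix x y z assume [simp]: "x \<in> base A" "y \<in> base A" "z \<in> base A"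
    have 1: "gf x z \<odot> M.gp x y z = M'.gp x y z \<odot> (gf x y \<parallel> I [ob A y z])"
      and 2: "gg x z \<odot> M'.gp x y z = M''.gp x y z \<odot> (gg x y \<parallel> I [ob A y z])"
      using f g by (auto intro!: diagram_eqI simp: par_seq_simps hopf_module_hom_def tensor_unit_obj)
    have "gg x z \<odot> gf x z \<odot> M.gp x y z = M''.gp x y z \<odot> ((gg x y \<odot> gf x y) \<parallel> I [ob A y z])"
      using L_cong_lift[OF 2, of 0 "gf x y \<parallel> I [ob A y z]"] by (simp only: 1) (simp add: diag)
    from raw_congI[OF this]
    show "(\<lambda>x\<in>base A. \<lambda>y\<in>base A. g x y \<cdot> f x y) x z \<cdot> act M x y z =
         act M'' x y z \<cdot> ((\<lambda>x\<in>base A. \<lambda>y\<in>base A. g x y \<cdot> f x y) x y \<otimes> \<one> (ob A y z))"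
      using comp_assoc[of "mob M x y \<otimes>\<^sub>o ob A y z" "mob M x z" "mob M' x z" "mob M'' x z" "act M x y z" "f x z" "g x z"]
        fH[of x z] gH[of x z]
      by (simp add: par_seq_simps tensor_unit_obj tensor_Obj)
  next
    fix x y assume [simp]: "x \<in> base A" "y \<in> base A"
    have 1: "M'.gr x y \<odot> gf x y = (gf x y \<parallel> I [ob A x y]) \<odot> M.gr x y"
      and 2: "M''.gr x y \<odot> gg x y = (gg x y \<parallel> I [ob A x y]) \<odot> M'.gr x y"
      using f g by (auto intro!: diagram_eqI simp: par_seq_simps hopf_module_hom_def tensor_unit_obj)
    have "M''.gr x y \<odot> (gg x y \<odot> gf x y) = ((gg x y \<odot> gf x y) \<parallel> I [ob A x y]) \<odot> M.gr x y"
      using L_cong_lift[OF 2, of 0 "gf x y"] arg_cong[OF 1, of "L 0 (gg x y)"] by (simp add: diag)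
    from raw_congI[OF this]
    show "coact M'' x y \<cdot> (\<lambda>x\<in>base A. \<lambda>y\<in>base A. g x y \<cdot> f x y) x y =
         ((\<lambda>x\<in>base A. \<lambda>y\<in>base A. g x y \<cdot> f x y) x y \<otimes> \<one> (ob A x y)) \<cdot> coact M x y"
      by (simp add: par_seq_simps tensor_unit_obj)
  qed
qed

lemma hopf_category_category: "category (hopf_module_category V A)"
proof (unfold_locales, unfold hopf_module_category_simps mem_Collect_eq)
  fix M assume M: "hopf_module V A M"
  interpret M: hopf_mod V A M by (rule hopf_modI[OF M])
  show "(\<lambda>x\<in>base A. \<lambda>y\<in>base A. \<one> (mob M x y)) \<in> hopf_module_hom V A M M"
    using comp_ident_left[OF _ _ M.act] comp_ident_right[OF _ _ M.act]
      comp_ident_left[OF _ _ M.coact] comp_ident_right[OF _ _ M.coact]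
    by (simp add: hopf_module_hom_def ident_hom tensor_ident tensor_Obj)
next
  fix M M' M'' f g
  assume "hopf_module V A M" "hopf_module V A M'" "hopf_module V A M''"
    "f \<in> hopf_module_hom V A M M'" "g \<in> hopf_module_hom V A M' M''"
  then show "(\<lambda>x\<in>base A. \<lambda>y\<in>base A. g x y \<cdot> f x y) \<in> hopf_module_hom V A M M''"
    by (rule hopf_module_hom_comp)
next
  fix M M' f assume M: "hopf_module V A M" and M': "hopf_module V A M'"
    and "f \<in> hopf_module_hom V A M M'"
  interpret M: hopf_mod V A M by (rule hopf_modI[OF M])
  interpret M': hopf_mod V A M' by (rule hopf_modI[OF M'])
  have f: "f \<in> (\<Pi>\<^sub>E x\<in>base A. \<Pi>\<^sub>E y\<in>base A. Hom V (mob M x y) (mob M' x y))"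
    using \<open>f \<in> _\<close> by (simp add: hopf_module_hom_def)
  show "(\<lambda>x\<in>base A. \<lambda>y\<in>base A. f x y \<cdot> (\<lambda>x\<in>base A. \<lambda>y\<in>base A. \<one> (mob M x y)) x y) = f"
    by (rule PiE2_ext[OF _ f, where B = "\<lambda>x y. UNIV"]) (simp_all add: comp_ident_right[OF _ _ PiE2_mem[OF f]])
  show "(\<lambda>x\<in>base A. \<lambda>y\<in>base A. (\<lambda>x\<in>base A. \<lambda>y\<in>base A. \<one> (mob M' x y)) x y \<cdot> f x y) = f"
    by (rule PiE2_ext[OF _ f, where B = "\<lambda>x y. UNIV"]) (simp_all add: comp_ident_left[OF _ _ PiE2_mem[OF f]])
next
  fix M M1 M2 M3 f g h
  assume M: "hopf_module V A M" "hopf_module V A M1" "hopf_module V A M2" "hopf_module V A M3"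
    and "f \<in> hopf_module_hom V A M M1" "g \<in> hopf_module_hom V A M1 M2" "h \<in> hopf_module_hom V A M2 M3"
  then have f: "f \<in> (\<Pi>\<^sub>E x\<in>base A. \<Pi>\<^sub>E y\<in>base A. Hom V (mob M x y) (mob M1 x y))"
    and g: "g \<in> (\<Pi>\<^sub>E x\<in>base A. \<Pi>\<^sub>E y\<in>base A. Hom V (mob M1 x y) (mob M2 x y))"
    and h: "h \<in> (\<Pi>\<^sub>E x\<in>base A. \<Pi>\<^sub>E y\<in>base A. Hom V (mob M2 x y) (mob M3 x y))"
    by (simp_all add: hopf_module_hom_def)
  note m = M[THEN hopf_modI, THEN hopf_mod.mob]
  show "(\<lambda>x\<in>base A. \<lambda>y\<in>base A. (\<lambda>x\<in>base A. \<lambda>y\<in>base A. h x y \<cdot> g x y) x y \<cdot> f x y) =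
       (\<lambda>x\<in>base A. \<lambda>y\<in>base A. h x y \<cdot> (\<lambda>x\<in>base A. \<lambda>y\<in>base A. g x y \<cdot> f x y) x y)"
    by (rule restrict2_cong)
       (simp_all add: comp_assoc[OF m PiE2_mem[OF f] PiE2_mem[OF g] PiE2_mem[OF h]])
qed

lemma F_functor: "is_functor (family_category V (base A)) (hopf_module_category V A) (F_functor V A)"
proof (intro is_functor.intro family_category hopf_category_category is_functor_axioms.intro,
    unfold family_category_simps hopf_module_category_simps F_functor_def cfunctor.simps mem_Collect_eq)
  fix N assume N: "N \<in> (\<Pi>\<^sub>E x\<in>base A. Obj V)"
  then show "hopf_module V A (free_module V A N)" by (rule free_hopf)
  show "(\<lambda>x\<in>base A. \<lambda>y\<in>base A. (\<lambda>x\<in>base A. \<one> (N x)) x \<otimes> \<one> (ob A x y)) =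
         (\<lambda>x\<in>base A. \<lambda>y\<in>base A. \<one> (mob (free_module V A N) x y))"
    by (rule restrict2_cong) (simp_all add: tensor_ident N)
next
  fix N N' f assume N [simp]: "N \<in> (\<Pi>\<^sub>E x\<in>base A. Obj V)" "N' \<in> (\<Pi>\<^sub>E x\<in>base A. Obj V)"
    and f: "f \<in> (\<Pi>\<^sub>E x\<in>base A. Hom V (N x) (N' x))"
  note fH = PiE_mem[OF f]
  define gf where "gf x = mk [N x] (f x) [N' x]" for x
  have gf [simp]: "dm (gf x) = [N x]" "cd (gf x) = [N' x]" "raw (gf x) = f x" for x
    by (simp_all add: gf_def)
  have [simp]: "valid (gf x)" "cdo (gf x) = Some [N' x]" if [simp]: "x \<in> base A" for x
    using fH[OF that] by (simp_all add: gf_def cdo_def tensor_unit_obj)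
  show "(\<lambda>x\<in>base A. \<lambda>y\<in>base A. f x \<otimes> \<one> (ob A x y))
       \<in> hopf_module_hom V A (free_module V A N) (free_module V A N')"
    unfolding hopf_module_hom_def
  proof (intro CollectI conjI ballI)
    show "(\<lambda>x\<in>base A. \<lambda>y\<in>base A. f x \<otimes> \<one> (ob A x y)) \<in> (\<Pi>\<^sub>E x\<in>base A. \<Pi>\<^sub>E y\<in>base A.
        Hom V (mob (free_module V A N) x y) (mob (free_module V A N') x y))"
      by (simp add: tensor_Hom fH ident_hom)
  next
    fix x y z assume [simp]: "x \<in> base A" "y \<in> base A" "z \<in> base A"
    have "(gf x \<parallel> I [ob A x z]) \<odot> (I [N x] \<parallel> gm x y z) = (I [N' x] \<parallel> gm x y z) \<odot> ((gf x \<parallel> I [ob A x y]) \<parallel> I [ob A y z])"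
      by (simp add: diag)
    from raw_congI[OF this] show "(\<lambda>x\<in>base A. \<lambda>y\<in>base A. f x \<otimes> \<one> (ob A x y)) x z \<cdot> act (free_module V A N) x y z =
       act (free_module V A N') x y z \<cdot> ((\<lambda>x\<in>base A. \<lambda>y\<in>base A. f x \<otimes> \<one> (ob A x y)) x y \<otimes> \<one> (ob A y z))"
      by (simp add: par_seq_simps tensor_unit_obj)
    have "(I [N' x] \<parallel> gD x y) \<odot> (gf x \<parallel> I [ob A x y]) = ((gf x \<parallel> I [ob A x y]) \<parallel> I [ob A x y]) \<odot> (I [N x] \<parallel> gD x y)"
      by (simp add: diag)
    from raw_congI[OF this] show "coact (free_module V A N') x y \<cdot> (\<lambda>x\<in>base A. \<lambda>y\<in>base A. f x \<otimes> \<one> (ob A x y)) x y =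
       ((\<lambda>x\<in>base A. \<lambda>y\<in>base A. f x \<otimes> \<one> (ob A x y)) x y \<otimes> \<one> (ob A x y)) \<cdot> coact (free_module V A N) x y"
      by (simp add: par_seq_simps tensor_unit_obj)
  qed
next
  fix N N' N'' f g assume N [simp]: "N \<in> (\<Pi>\<^sub>E x\<in>base A. Obj V)" "N' \<in> (\<Pi>\<^sub>E x\<in>base A. Obj V)" "N'' \<in> (\<Pi>\<^sub>E x\<in>base A. Obj V)"
    and f: "f \<in> (\<Pi>\<^sub>E x\<in>base A. Hom V (N x) (N' x))"
    and g: "g \<in> (\<Pi>\<^sub>E x\<in>base A. Hom V (N' x) (N'' x))"
  have "(g x \<cdot> f x) \<otimes> \<one> (ob A x y) = (g x \<otimes> \<one> (ob A x y)) \<cdot> (f x \<otimes> \<one> (ob A x y))"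
    if "x \<in> base A" "y \<in> base A" for x y
    using tensor_comp[of "N x" "N' x" "N'' x" "ob A x y" "ob A x y" "ob A x y" "f x" "g x" "\<one> (ob A x y)" "\<one> (ob A x y)"]
      that PiE_mem[OF f] PiE_mem[OF g] by (simp add: ident_hom ident_comp)
  then show "(\<lambda>x\<in>base A. \<lambda>y\<in>base A. (\<lambda>x\<in>base A. g x \<cdot> f x) x \<otimes> \<one> (ob A x y)) =
       (\<lambda>x\<in>base A. \<lambda>y\<in>base A. (\<lambda>x\<in>base A. \<lambda>y\<in>base A. g x \<otimes> \<one> (ob A x y)) x y \<cdot> (\<lambda>x\<in>base A. \<lambda>y\<in>base A. f x \<otimes> \<one> (ob A x y)) x y)"
    by (intro restrict2_cong) simp_all
qed

end

section \<open>Maps induced on coinvariants\<close>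

locale hopf_map = hopf_setting V A + M: hopf_mod V A M + M': hopf_mod V A M'
  for V :: "('o, 'a) braided_category" (structure)
    and A :: "('x, 'o, 'a) cv_category" and M M' +
  fixes g assumes g: "g \<in> hopf_module_hom V A M M'"
begin

lemma g_Hom: "x \<in> base A \<Longrightarrow> y \<in> base A \<Longrightarrow> g x y \<in> Hom V (mob M x y) (mob M' x y)"
  using g by (auto simp: hopf_module_hom_def dest: PiE2_mem)

definition gg where "gg x y = mk [mob M x y] (g x y) [mob M' x y]"

lemma gg_simps [simp]:
  "dm (gg x y) = [mob M x y]" "cd (gg x y) = [mob M' x y]" "raw (gg x y) = g x y"
  "x \<in> base A \<Longrightarrow> y \<in> base A \<Longrightarrow> valid (gg x y)"
  "x \<in> base A \<Longrightarrow> y \<in> base A \<Longrightarrow> cdo (gg x y) = Some [mob M' x y]"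
  by (simp_all add: gg_def cdo_def g_Hom tensor_unit_obj)

lemma R_map_act:
  assumes [simp]: "x \<in> base A" "y \<in> base A" "z \<in> base A" and k: "fits n [mob M x y, ob A y z] k"
  shows "L n (M'.gp x y z) (L n (gg x y) k) = L n (gg x z) (L n (M.gp x y z) k)"
proof -
  have "M'.gp x y z \<odot> (gg x y \<parallel> I [ob A y z]) = gg x z \<odot> M.gp x y z"
    using g by (auto intro!: diagram_eqI simp: par_seq_simps hopf_module_hom_def tensor_unit_obj)
  from L_cong_lift[OF this, of n k] show ?thesis using k by (simp add: diag)
qed

lemma R_map_coact:
  assumes [simp]: "x \<in> base A" "y \<in> base A" and k: "fits n [mob M x y] k"
  shows "L n (M'.gr x y) (L n (gg x y) k) = L n (gg x y) (L n (M.gr x y) k)"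
proof -
  have "M'.gr x y \<odot> gg x y = (gg x y \<parallel> I [ob A x y]) \<odot> M.gr x y"
    using g by (auto intro!: diagram_eqI simp: par_seq_simps hopf_module_hom_def tensor_unit_obj)
  from L_cong_lift[OF this, of n k] show ?thesis using k by (simp add: diag)
qed

definition coinv_map where "coinv_map x = coinv_lift V A M' x (coinv_obj V A M x) (g x x \<cdot> coinv_incl V A M x)"

text \<open>Colinearity of \<open>g\<close> makes \<open>g x x \<cdot> inc x\<close> equalize the
  pair that defines the coinvariants of \<open>M'\<close>.\<close>

lemma coinv_map:
  assumes [simp]: "x \<in> base A"
  shows "coinv_map x \<in> Hom V (M.E x) (M'.E x)" "M'.inc x \<cdot> coinv_map x = g x x \<cdot> M.inc x"
proof -
  have h: "g x x \<cdot> M.inc x \<in> Hom V (M.E x) (mob M' x x)"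
    by (rule comp_hom[of _ "mob M x x"]) (simp_all add: g_Hom)
  have "M'.gr x x \<odot> (gg x x \<odot> M.gi x) = (I [mob M' x x] \<parallel> gu x) \<odot> (gg x x \<odot> M.gi x)"
  proof -
    have at: "L 0 (M.gi x) (I [M.E x]) = M.gi x" using L_atom[of "M.gi x"] by simp
    have "L (Suc 0) (gu x) (L 0 (M.gi x) (I [M.E x])) = L 0 (M.gi x) (L (Suc 0) (gu x) (I [M.E x]))"
      by (simp add: diag)
    then show ?thesis
      using M.R_inc[of x 0 "I [M.E x]"] by (simp add: diag R_map_coact at)
  qed
  from raw_congI[OF this] have "coact M' x x \<cdot> (g x x \<cdot> M.inc x) = (\<one> (mob M' x x) \<otimes> unity A x) \<cdot> (g x x \<cdot> M.inc x)"
    by (simp add: par_seq_simps tensor_unit_obj)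
  from M'.coinv_lift[OF assms M.E_Obj[OF assms] h this]
  show "coinv_map x \<in> Hom V (M.E x) (M'.E x)" "M'.inc x \<cdot> coinv_map x = g x x \<cdot> M.inc x"
    by (simp_all add: coinv_map_def)
qed

lemma counit_natural:
  assumes [simp]: "x \<in> base A" "y \<in> base A"
  shows "FG_counit V A M' x y \<cdot> (coinv_map x \<otimes> \<one> (ob A x y)) = g x y \<cdot> FG_counit V A M x y"
proof -
  define c where "c = mk [M.E x] (coinv_map x) [M'.E x]"
  have [simp]: "valid c" "cdo c = Some [M'.E x]" "dm c = [M.E x]" "cd c = [M'.E x]" "raw c = coinv_map x"
    by (simp_all add: c_def cdo_def tensor_unit_obj coinv_map)
  have "M'.gi x \<odot> c = gg x x \<odot> M.gi x"
    by (rule diagram_eqI) (simp_all add: par_seq_simps coinv_map tensor_unit_obj)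
  from L_cong_lift[OF this, of 0 "I [M.E x, ob A x y]"]
  have "M'.g_counit x y \<odot> (c \<parallel> I [ob A x y]) = gg x y \<odot> M.g_counit x y"
    by (simp add: M'.g_counit_L M.g_counit_L diag R_map_act)
  from raw_congI[OF this] show ?thesis
    by (simp add: par_seq_simps tensor_unit_obj M'.g_counit_simps M.g_counit_simps)
qed

end

section \<open>Free modules and invertibility of the unit\<close>

locale free_mod = hopf_setting V A
  for V :: "('o, 'a) braided_category" (structure)
    and A :: "('x, 'o, 'a) cv_category" +
  fixes N assumes N: "N \<in> (\<Pi>\<^sub>E x \<in> base A. Obj V)"
begin

sublocale F: hopf_mod V A "free_module V A N"
  by (rule hopf_modI[OF free_hopf[OF N]])

lemma N_Obj [simp]: "x \<in> base A \<Longrightarrow> N x \<in> Obj V"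
  using N by simp

text \<open>The same arrow as \<open>F.gi x\<close>, but with its codomain spelled as two strands,
  so that the rules for \<open>A\<close> can act on the second one.\<close>

definition g_incl where "g_incl x = mk [F.E x] (F.inc x) [N x, ob A x x]"

lemma g_incl_simps [simp]: "dm (g_incl x) = [F.E x]" "cd (g_incl x) = [N x, ob A x x]" "raw (g_incl x) = F.inc x"
  "x \<in> base A \<Longrightarrow> valid (g_incl x)" "x \<in> base A \<Longrightarrow> cdo (g_incl x) = Some [N x, ob A x x]"
  using F.inc_Hom[of x] by (simp_all add: g_incl_def cdo_def tensor_unit_obj)

definition eta where "eta x = coinv_lift V A (free_module V A N) x (N x) (\<one> (N x) \<otimes> unity A x)"

lemma eta:
  assumes [simp]: "x \<in> base A"
  shows "eta x \<in> Hom V (N x) (F.E x)" "F.inc x \<cdot> eta x = \<one> (N x) \<otimes> unity A x"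
proof -
  have h: "\<one> (N x) \<otimes> unity A x \<in> Hom V (N x) (mob (free_module V A N) x x)"
    using tensor_Hom[of "N x" "N x" \<k> "ob A x x" "\<one> (N x)" "unity A x"]
    by (simp add: ident_hom unit_obj_Obj tensor_unit_obj)
  have "(I [N x] \<parallel> gD x x) \<odot> (I [N x] \<parallel> gu x) = (I [N x, ob A x x] \<parallel> gu x) \<odot> (I [N x] \<parallel> gu x)"
    by (simp add: diag R_comul_unit)
  from raw_congI[OF this] have "coact (free_module V A N) x x \<cdot> (\<one> (N x) \<otimes> unity A x) =
      (\<one> (mob (free_module V A N) x x) \<otimes> unity A x) \<cdot> (\<one> (N x) \<otimes> unity A x)"
    by (simp add: par_seq_simps tensor_unit_obj)
  from F.coinv_lift[OF assms N_Obj[OF assms] h this]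
  show "eta x \<in> Hom V (N x) (F.E x)" "F.inc x \<cdot> eta x = \<one> (N x) \<otimes> unity A x"
    by (simp_all add: eta_def)
qed

definition g_eta where "g_eta x = mk [N x] (eta x) [F.E x]"

lemma g_eta_simps [simp]: "dm (g_eta x) = [N x]" "cd (g_eta x) = [F.E x]" "raw (g_eta x) = eta x"
  "x \<in> base A \<Longrightarrow> valid (g_eta x)" "x \<in> base A \<Longrightarrow> cdo (g_eta x) = Some [F.E x]"
  by (simp_all add: g_eta_def cdo_def tensor_unit_obj eta)

lemma R_inc_eta:
  assumes [simp]: "x \<in> base A" and k: "fits n [N x] k"
  shows "L n (g_incl x) (L n (g_eta x) k) = L (Suc n) (gu x) k"
proof -
  have "g_incl x \<odot> g_eta x = I [N x] \<parallel> gu x"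
    by (rule diagram_eqI) (simp_all add: par_seq_simps eta tensor_unit_obj)
  from L_cong_lift[OF this, of n k] show ?thesis using k by (simp add: diag)
qed

text \<open>The triangle identity for \<open>F\<close> in components; since the unit corrects to
  \<open>\<one> (N x) \<otimes> unity A x\<close> under the inclusion, it is a unit law of
  \<open>A\<close>.\<close>

lemma counit_eta:
  assumes [simp]: "x \<in> base A" "y \<in> base A"
  shows "FG_counit V A (free_module V A N) x y \<cdot> (eta x \<otimes> \<one> (ob A x y)) = \<one> (mob (free_module V A N) x y)"
proof -
  have "((I [N x] \<parallel> gm x x y) \<odot> (g_incl x \<parallel> I [ob A x y])) \<odot> (g_eta x \<parallel> I [ob A x y]) = I [N x, ob A x y]"
    by (simp add: diag R_inc_eta R_unit_left)
  from raw_congI[OF this] show ?thesis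
    by (simp add: par_seq_simps tensor_unit_obj FG_counit_def)
qed

text \<open>The splitting is given by the counit of \<open>A\<close>: one composite is
  \<open>\<epsilon>(1) = 1\<close>, and the other is checked after composing with the monic
  inclusion.\<close>

lemma eta_iso:
  assumes [simp]: "x \<in> base A"
  shows "is_inverse V (N x) (F.E x) (eta x) ((\<one> (N x) \<otimes> counit (coalg A x x)) \<cdot> F.inc x)"
proof -
  have at: "L 0 (g_incl x) (I [F.E x]) = g_incl x" using L_atom[of "g_incl x"] by simp
  let ?k = "(I [N x] \<parallel> ge x x) \<odot> g_incl x"
  have 1: "?k \<odot> g_eta x = I [N x]"
    using R_inc_eta[of x 0 "I [N x]"] L_atom[of "g_eta x"] by (simp add: diag R_counit_unit)
  have "(I [N x] \<parallel> gD x x) \<odot> g_incl x = (I [N x, ob A x x] \<parallel> gu x) \<odot> g_incl x"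
    using F.inc_eq[of x] by (intro diagram_eqI) (simp_all add: par_seq_simps tensor_unit_obj)
  \<comment> \<open>The counit is applied to the first of the two \<open>A\<close> strands in the
    equalizing condition. The left side collapses to the inclusion, and the right side becomes the
    inclusion after \<open>g_eta x \<odot> ?k\<close>.\<close>
  then have "L 1 (ge x x) (L 1 (gD x x) (g_incl x)) = L 1 (ge x x) (L 2 (gu x) (g_incl x))"
    by (simp add: diag eval_nat_numeral)
  then have 2: "g_incl x \<odot> (g_eta x \<odot> ?k) = g_incl x"
    by (simp add: diag R_inc_eta R_counit_left eval_nat_numeral)
  have k: "raw ?k \<in> Hom V (F.E x) (N x)"
    using validD(3)[of ?k] by (simp add: par_seq_simps tensor_unit_obj)
  have "eta x \<cdot> raw ?k = \<one> (F.E x)"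
  proof (rule F.inc_mono[OF assms F.E_Obj[OF assms]])
    show "F.inc x \<cdot> eta x \<cdot> raw ?k = F.inc x \<cdot> \<one> (F.E x)"
      using raw_congI[OF 2] comp_ident_right[OF F.E_Obj _ F.inc_Hom, of x]
      by (simp add: par_seq_simps tensor_Obj)
    show "eta x \<cdot> raw ?k \<in> Hom V (F.E x) (F.E x)"
      by (rule comp_hom[OF _ _ _ k eta(1)]) simp_all
  qed (simp add: ident_hom)
  with raw_congI[OF 1] k show ?thesis
    by (simp add: is_inverse_def par_seq_simps tensor_unit_obj)
qed

end

section \<open>\<open>F\<close> and \<open>G\<close> as adjoint functors\<close>

context hopf_setting
begin

lemma free_modI: "N \<in> (\<Pi>\<^sub>E x \<in> base A. Obj V) \<Longrightarrow> free_mod V A N"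
  by (intro free_mod.intro hopf_setting_axioms free_mod_axioms.intro)

lemma hopf_mapI: "\<lbrakk>hopf_module V A M; hopf_module V A M'; g \<in> hopf_module_hom V A M M'\<rbrakk> \<Longrightarrow> hopf_map V A M M' g"
  by (intro hopf_map.intro hopf_map_axioms.intro hopf_setting_axioms hopf_modI)

lemma coinv_family: "hopf_module V A M \<Longrightarrow> (\<lambda>x\<in>base A. coinv_obj V A M x) \<in> (\<Pi>\<^sub>E x \<in> base A. Obj V)"
  using hopf_mod.E_Obj[OF hopf_modI] by simp

text \<open>An induced arrow is determined by its composite with the inclusion of coinvariants, so
  the laws for identities and composites are checked after composing with that monic.\<close>

lemma G_functor: "is_functor (hopf_module_category V A) (family_category V (base A)) (G_functor V A)"
proof (intro is_functor.intro family_category hopf_category_category is_functor_axioms.intro,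
    unfold family_category_simps hopf_module_category_simps G_functor_def cfunctor.simps mem_Collect_eq)
  fix M assume M: "hopf_module V A M"
  then show "(\<lambda>x\<in>base A. coinv_obj V A M x) \<in> (\<Pi>\<^sub>E x \<in> base A. Obj V)" by (rule coinv_family)
  interpret M: hopf_mod V A M by (rule hopf_modI[OF M])
  let ?i = "\<lambda>x\<in>base A. \<lambda>y\<in>base A. \<one> (mob M x y)"
  have i: "?i \<in> hopf_module_hom V A M M"
    using category.ident_hom[OF hopf_category_category, of M] M
    by (simp add: hopf_module_category_simps)
  interpret i: hopf_map V A M M ?i by (rule hopf_mapI[OF M M i])
  have "i.coinv_map x = \<one> (M.E x)" if [simp]: "x \<in> base A" for x
    using i.coinv_map[of x] comp_ident_left[OF _ _ M.inc_Hom, of x] comp_ident_right[OF _ _ M.inc_Hom, of x]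
    by - (rule M.inc_mono[of x "M.E x"], simp_all add: ident_hom)
  then show "(\<lambda>x\<in>base A. coinv_lift V A M x (coinv_obj V A M x) (?i x x \<cdot> coinv_incl V A M x)) =
      (\<lambda>x\<in>base A. \<one> ((\<lambda>x\<in>base A. coinv_obj V A M x) x))"
    by (intro restrict_ext) (simp add: i.coinv_map_def)
next
  fix M M' g assume M: "hopf_module V A M" "hopf_module V A M'" and g: "g \<in> hopf_module_hom V A M M'"
  interpret g: hopf_map V A M M' g by (rule hopf_mapI[OF M g])
  show "(\<lambda>x\<in>base A. coinv_lift V A M' x (coinv_obj V A M x) (g x x \<cdot> coinv_incl V A M x))
       \<in> (\<Pi>\<^sub>E x\<in>base A. Hom V ((\<lambda>x\<in>base A. coinv_obj V A M x) x) ((\<lambda>x\<in>base A. coinv_obj V A M' x) x))"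
    using g.coinv_map(1) by (simp add: g.coinv_map_def)
next
  fix M M' M'' f g assume M: "hopf_module V A M" and M': "hopf_module V A M'" and M'': "hopf_module V A M''"
    and f: "f \<in> hopf_module_hom V A M M'" and g: "g \<in> hopf_module_hom V A M' M''"
  let ?h = "\<lambda>x\<in>base A. \<lambda>y\<in>base A. g x y \<cdot> f x y"
  interpret f: hopf_map V A M M' f by (rule hopf_mapI[OF M M' f])
  interpret g: hopf_map V A M' M'' g by (rule hopf_mapI[OF M' M'' g])
  interpret h: hopf_map V A M M'' ?h
    by (rule hopf_mapI[OF M M'' hopf_module_hom_comp[OF M M' M'' f g]])
  have "h.coinv_map x = g.coinv_map x \<cdot> f.coinv_map x" if x [simp]: "x \<in> base A" for x
  proof (rule g.M'.inc_mono[OF x f.M.E_Obj[OF x] h.coinv_map(1)[OF x]])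
    show "g.coinv_map x \<cdot> f.coinv_map x \<in> Hom V (f.M.E x) (g.M'.E x)"
      by (rule comp_hom[OF _ _ _ f.coinv_map(1) g.coinv_map(1)]) simp_all
    have "g.M'.inc x \<cdot> (g.coinv_map x \<cdot> f.coinv_map x) = (g.M'.inc x \<cdot> g.coinv_map x) \<cdot> f.coinv_map x"
      by (rule comp_assoc[OF _ _ _ _ f.coinv_map(1) g.coinv_map(1) g.M'.inc_Hom, symmetric]) simp_all
    also have "\<dots> = g x x \<cdot> (f.M'.inc x \<cdot> f.coinv_map x)"
      using comp_assoc[OF _ _ _ _ f.coinv_map(1) f.M'.inc_Hom g.g_Hom, of x] by (simp add: g.coinv_map)
    also have "\<dots> = (g x x \<cdot> f x x) \<cdot> f.M.inc x"
      using comp_assoc[OF _ _ _ _ f.M.inc_Hom f.g_Hom g.g_Hom, of x] by (simp add: f.coinv_map)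
    finally show "g.M'.inc x \<cdot> h.coinv_map x = g.M'.inc x \<cdot> (g.coinv_map x \<cdot> f.coinv_map x)" by (simp add: h.coinv_map)
  qed
  then show "(\<lambda>x\<in>base A. coinv_lift V A M'' x (coinv_obj V A M x) (?h x x \<cdot> coinv_incl V A M x)) =
      (\<lambda>x\<in>base A. (\<lambda>x\<in>base A. coinv_lift V A M'' x (coinv_obj V A M' x) (g x x \<cdot> coinv_incl V A M' x)) x
        \<cdot> (\<lambda>x\<in>base A. coinv_lift V A M' x (coinv_obj V A M x) (f x x \<cdot> coinv_incl V A M x)) x)"
    by (intro restrict_ext) (simp add: h.coinv_map_def f.coinv_map_def g.coinv_map_def)
qed

lemma id_functor: "category C \<Longrightarrow> is_functor C C id_functor"
  by (intro is_functor.intro is_functor_axioms.intro) (simp_all add: id_functor_def)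

lemma comp_functor:
  assumes "is_functor C D F" "is_functor D E G"
  shows "is_functor C E (comp_functor G F)"
proof -
  interpret F: is_functor C D F by fact
  interpret G: is_functor D E G by fact
  show ?thesis
    by unfold_locales
      (simp_all add: comp_functor_def F.fobj_Obj F.farr_Hom F.farr_ident F.farr_comp[of _ _ _]
        G.fobj_Obj G.farr_Hom G.farr_ident G.farr_comp[OF F.fobj_Obj F.fobj_Obj F.fobj_Obj F.farr_Hom F.farr_Hom])
qed

abbreviation D where "D \<equiv> family_category V (base A)"
abbreviation H where "H \<equiv> hopf_module_category V A"
abbreviation F where "F \<equiv> F_functor V A"
abbreviation G where "G \<equiv> G_functor V A"

lemma functor_simps:
  "fobj F N = free_module V A N"
  "farr F N N' f = (\<lambda>x\<in>base A. \<lambda>y\<in>base A. f x \<otimes> \<one> (ob A x y))"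
  "fobj G M = (\<lambda>x\<in>base A. coinv_obj V A M x)"
  "farr G M M' g = (\<lambda>x\<in>base A. coinv_lift V A M' x (coinv_obj V A M x) (g x x \<cdot> coinv_incl V A M x))"
  "fobj (comp_functor U T) a = fobj U (fobj T a)"
  "farr (comp_functor U T) a b k = farr U (fobj T a) (fobj T b) (farr T a b k)"
  "fobj id_functor a = a"
  "farr id_functor a b k = k"
  by (simp_all add: F_functor_def G_functor_def comp_functor_def id_functor_def)

text \<open>After composition with the monic inclusion both sides become
  \<open>f \<otimes> 1\<close>, where \<open>1\<close> stands for the unit of
  \<open>A\<close>.\<close>

lemma unit_natural: "natural_transformation D D id_functor (comp_functor G F) (FG_unit V A)"
proof (intro natural_transformation.intro natural_transformation_axioms.intro id_functor family_category
    comp_functor[OF F_functor G_functor], unfold functor_simps family_category_simps FG_unit_def)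
  fix N assume N: "N \<in> (\<Pi>\<^sub>E x\<in>base A. Obj V)"
  interpret N: free_mod V A N by (rule free_modI[OF N])
  show "(\<lambda>x\<in>base A. coinv_lift V A (free_module V A N) x (N x) (\<one> (N x) \<otimes> unity A x))
     \<in> (\<Pi>\<^sub>E x\<in>base A. Hom V (N x) ((\<lambda>x\<in>base A. coinv_obj V A (free_module V A N) x) x))"
    using N.eta(1) by (simp add: N.eta_def)
next
  fix N N' f assume N: "N \<in> (\<Pi>\<^sub>E x\<in>base A. Obj V)" and N': "N' \<in> (\<Pi>\<^sub>E x\<in>base A. Obj V)"
    and f: "f \<in> (\<Pi>\<^sub>E x\<in>base A. Hom V (N x) (N' x))"
  interpret N: free_mod V A N by (rule free_modI[OF N])
  interpret N': free_mod V A N' by (rule free_modI[OF N'])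
  let ?f = "\<lambda>x\<in>base A. \<lambda>y\<in>base A. f x \<otimes> \<one> (ob A x y)"
  have "?f \<in> hopf_module_hom V A (free_module V A N) (free_module V A N')"
    using is_functor.farr_Hom[OF F_functor, of N N' f] N N' f
    by (simp add: family_category_simps hopf_module_category_simps functor_simps)
  then interpret f: hopf_map V A "free_module V A N" "free_module V A N'" ?f
    by (rule hopf_mapI[OF free_hopf[OF N] free_hopf[OF N']])
  have fH: "f x \<in> Hom V (N x) (N' x)" if "x \<in> base A" for x using PiE_mem[OF f that] .
  have "N'.eta x \<cdot> f x = f.coinv_map x \<cdot> N.eta x" if x [simp]: "x \<in> base A" for x
  proof (rule N'.F.inc_mono[OF x N.N_Obj[OF x]])
    show "N'.eta x \<cdot> f x \<in> Hom V (N x) (N'.F.E x)"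
      by (rule comp_hom[OF _ _ _ fH N'.eta(1)]) simp_all
    show "f.coinv_map x \<cdot> N.eta x \<in> Hom V (N x) (N'.F.E x)"
      by (rule comp_hom[OF _ _ _ N.eta(1) f.coinv_map(1)]) simp_all
    have "N'.F.inc x \<cdot> (N'.eta x \<cdot> f x) = (\<one> (N' x) \<otimes> unity A x) \<cdot> f x"
      using comp_assoc[OF _ _ _ _ fH N'.eta(1) N'.F.inc_Hom, of x] by (simp add: N'.eta tensor_Obj)
    also have "\<dots> = (f x \<otimes> \<one> (ob A x x)) \<cdot> (\<one> (N x) \<otimes> unity A x)"
    proof -
      define c where "c = mk [N x] (f x) [N' x]"
      have [simp]: "valid c" "cdo c = Some [N' x]" "dm c = [N x]" "cd c = [N' x]" "raw c = f x"
        using fH[of x] by (simp_all add: c_def cdo_def tensor_unit_obj)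
      have "(I [N' x] \<parallel> gu x) \<odot> c = (c \<parallel> I [ob A x x]) \<odot> (I [N x] \<parallel> gu x)"
        using L_exchange[of 0 c "Suc 0" "gu x" "I [N x]"] L_atom[of c] by (simp add: diag del: L_exchange)
      from raw_congI[OF this] show ?thesis by (simp add: par_seq_simps tensor_unit_obj)
    qed
    also have "\<dots> = (f x \<otimes> \<one> (ob A x x)) \<cdot> (N.F.inc x \<cdot> N.eta x)" by (simp add: N.eta)
    also have "\<dots> = (N'.F.inc x \<cdot> f.coinv_map x) \<cdot> N.eta x"
      using comp_assoc[OF _ _ _ _ N.eta(1) N.F.inc_Hom f.g_Hom, of x] by (simp add: f.coinv_map tensor_Obj)
    also have "\<dots> = N'.F.inc x \<cdot> (f.coinv_map x \<cdot> N.eta x)"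
      by (rule comp_assoc[OF _ _ _ _ N.eta(1) f.coinv_map(1) N'.F.inc_Hom]) (simp_all add: tensor_Obj)
    finally show "N'.F.inc x \<cdot> (N'.eta x \<cdot> f x) = N'.F.inc x \<cdot> (f.coinv_map x \<cdot> N.eta x)" .
  qed
  then show "(\<lambda>x\<in>base A. (\<lambda>x\<in>base A. coinv_lift V A (free_module V A N') x (N' x) (\<one> (N' x) \<otimes> unity A x)) x \<cdot> f x) =
       (\<lambda>x\<in>base A. (\<lambda>x\<in>base A. coinv_lift V A (free_module V A N') x (coinv_obj V A (free_module V A N) x)
             (?f x x \<cdot> coinv_incl V A (free_module V A N) x)) x
         \<cdot> (\<lambda>x\<in>base A. coinv_lift V A (free_module V A N) x (N x) (\<one> (N x) \<otimes> unity A x)) x)"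
    by (intro restrict_ext) (simp add: N.eta_def N'.eta_def f.coinv_map_def)
qed

lemma counit_natural: "natural_transformation H H (comp_functor F G) id_functor (FG_counit V A)"
proof (intro natural_transformation.intro natural_transformation_axioms.intro id_functor hopf_category_category
    comp_functor[OF G_functor F_functor], unfold functor_simps hopf_module_category_simps mem_Collect_eq)
  fix M assume M: "hopf_module V A M"
  interpret M: hopf_mod V A M by (rule hopf_modI[OF M])
  show "FG_counit V A M \<in> hopf_module_hom V A (free_module V A (\<lambda>x\<in>base A. coinv_obj V A M x)) M"
    unfolding hopf_module_hom_def
  proof (intro CollectI conjI ballI)
    show "FG_counit V A M \<in> (\<Pi>\<^sub>E x\<in>base A. \<Pi>\<^sub>E y\<in>base A. Hom V
        (mob (free_module V A (\<lambda>x\<in>base A. coinv_obj V A M x)) x y) (mob M x y))"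
      using M.counit_Hom' by (simp add: FG_counit_def)
  qed (simp_all add: M.counit_act M.counit_coact)
next
  fix M M' g assume M: "hopf_module V A M" "hopf_module V A M'" and g: "g \<in> hopf_module_hom V A M M'"
  interpret g: hopf_map V A M M' g by (rule hopf_mapI[OF M g])
  show "(\<lambda>x\<in>base A. \<lambda>y\<in>base A. FG_counit V A M' x y \<cdot> (\<lambda>x\<in>base A. \<lambda>y\<in>base A.
         (\<lambda>x\<in>base A. coinv_lift V A M' x (coinv_obj V A M x) (g x x \<cdot> coinv_incl V A M x)) x \<otimes> \<one> (ob A x y)) x y) =
       (\<lambda>x\<in>base A. \<lambda>y\<in>base A. g x y \<cdot> FG_counit V A M x y)"
    using g.counit_natural by (intro restrict2_cong) (simp add: g.coinv_map_def)
qed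

lemma FG_adjunction: "adjunction D H F G (FG_unit V A) (FG_counit V A)"
proof (intro adjunction.intro adjunction_axioms.intro F_functor G_functor unit_natural counit_natural,
    unfold functor_simps hopf_module_category_simps family_category_simps mem_Collect_eq)
  fix N assume N: "N \<in> (\<Pi>\<^sub>E x\<in>base A. Obj V)"
  interpret N: free_mod V A N by (rule free_modI[OF N])
  show "(\<lambda>x\<in>base A. \<lambda>y\<in>base A. FG_counit V A (free_module V A N) x y \<cdot>
            (\<lambda>x\<in>base A. \<lambda>y\<in>base A. FG_unit V A N x \<otimes> \<one> (ob A x y)) x y) =
         (\<lambda>x\<in>base A. \<lambda>y\<in>base A. \<one> (mob (free_module V A N) x y))"
    using N.counit_eta by (intro restrict2_cong) (simp add: FG_unit_def N.eta_def)
next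
  fix M assume M: "hopf_module V A M"
  interpret M: hopf_mod V A M by (rule hopf_modI[OF M])
  let ?N = "\<lambda>x\<in>base A. coinv_obj V A M x"
  note N = coinv_family[OF M]
  interpret N: free_mod V A ?N by (rule free_modI[OF N])
  have "FG_counit V A M \<in> hopf_module_hom V A (free_module V A ?N) M"
    using natural_transformation.component_Hom[OF counit_natural, of M] M
    by (simp add: hopf_module_category_simps functor_simps)
  then interpret e: hopf_map V A "free_module V A ?N" M "FG_counit V A M"
    by (rule hopf_mapI[OF free_hopf[OF N] M])
  \<comment> \<open>Tested against the monic \<open>inc x\<close>; what remains is
    \<open>counit_unity\<close>.\<close>
  have "e.coinv_map x \<cdot> N.eta x = \<one> (M.E x)" if x [simp]: "x \<in> base A" for x
  proof (rule M.inc_mono[OF x M.E_Obj[OF x]])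
    have n: "N.eta x \<in> Hom V (M.E x) (N.F.E x)" using N.eta(1)[of x] by simp
    show "e.coinv_map x \<cdot> N.eta x \<in> Hom V (M.E x) (M.E x)"
      by (rule comp_hom[OF _ _ _ n e.coinv_map(1)]) simp_all
    have "M.inc x \<cdot> (e.coinv_map x \<cdot> N.eta x) = (M.inc x \<cdot> e.coinv_map x) \<cdot> N.eta x"
      by (rule comp_assoc[OF _ _ _ _ n e.coinv_map(1) M.inc_Hom, symmetric]) simp_all
    also have "\<dots> = FG_counit V A M x x \<cdot> (N.F.inc x \<cdot> N.eta x)"
      using comp_assoc[OF _ _ _ _ n N.F.inc_Hom e.g_Hom] N.F.mob[of x x]
      by (simp add: e.coinv_map tensor_Obj)
    also have "\<dots> = M.inc x" using M.counit_unity[of x] by (simp add: N.eta)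
    also have "\<dots> = M.inc x \<cdot> \<one> (M.E x)" using comp_ident_right[OF _ _ M.inc_Hom, of x] by simp
    finally show "M.inc x \<cdot> (e.coinv_map x \<cdot> N.eta x) = M.inc x \<cdot> \<one> (M.E x)" .
  qed (simp add: ident_hom)
  then show "(\<lambda>x\<in>base A. (\<lambda>x\<in>base A. coinv_lift V A M x (coinv_obj V A (free_module V A ?N) x)
             (FG_counit V A M x x \<cdot> coinv_incl V A (free_module V A ?N) x)) x \<cdot> FG_unit V A ?N x) =
         (\<lambda>x\<in>base A. \<one> (?N x))"
    by (intro restrict_ext) (simp add: e.coinv_map_def FG_unit_def N.eta_def)
qed

lemma FG_unit_iso:
  assumes "N \<in> Obj D"
  shows "is_iso D N (fobj G (fobj F N)) (FG_unit V A N)"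
proof -
  have N: "N \<in> (\<Pi>\<^sub>E x\<in>base A. Obj V)" using assms by (simp add: family_category_simps)
  interpret N: free_mod V A N by (rule free_modI[OF N])
  have 1: "FG_unit V A N \<in> Hom D N (fobj G (fobj F N))"
    using N.eta(1) by (simp add: family_category_simps functor_simps FG_unit_def N.eta_def)
  have "is_inverse D N (fobj G (fobj F N)) (FG_unit V A N)
     (\<lambda>x\<in>base A. (\<one> (N x) \<otimes> counit (coalg A x x)) \<cdot> N.F.inc x)"
    using N.eta_iso unfolding is_inverse_def
    by (auto simp: family_category_simps functor_simps FG_unit_def N.eta_def intro!: restrict_ext)
  with 1 show ?thesis by (auto simp: is_iso_def)
qed

end

section \<open>The equivalences\<close>

context hopf_map
begin

text \<open>The components of \<open>g\<close> can be cancelled on both sides, so their inverses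
  inherit linearity and colinearity.\<close>

lemma pointwise_inverse:
  assumes h: "\<And>x y. x \<in> base A \<Longrightarrow> y \<in> base A \<Longrightarrow>
      is_inverse V (mob M x y) (mob M' x y) (g x y) (h x y)"
  shows "is_iso H M M' g"
proof -
  let ?h = "\<lambda>x\<in>base A. \<lambda>y\<in>base A. h x y"
  have hH: "h x y \<in> Hom V (mob M' x y) (mob M x y)" and hg: "h x y \<cdot> g x y = \<one> (mob M x y)"
    and gh: "g x y \<cdot> h x y = \<one> (mob M' x y)" if "x \<in> base A" "y \<in> base A" for x y
    using h[OF that] by (auto simp: is_inverse_def)
  define c where "c x y = mk [mob M' x y] (h x y) [mob M x y]" for x y
  have c [simp]: "dm (c x y) = [mob M' x y]" "cd (c x y) = [mob M x y]" "raw (c x y) = h x y" for x y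
    by (simp_all add: c_def)
  have [simp]: "valid (c x y)" "cdo (c x y) = Some [mob M x y]" if "x \<in> base A" "y \<in> base A" for x y
    using hH[OF that] that by (simp_all add: c_def cdo_def tensor_unit_obj)
  have R1: "L n (c x y) (L n (gg x y) k) = k"
    if [simp]: "x \<in> base A" "y \<in> base A" and k: "fits n [mob M x y] k" for x y n k
  proof -
    have "c x y \<odot> gg x y = I [mob M x y]"
      by (rule diagram_eqI) (simp_all add: par_seq_simps hg tensor_unit_obj)
    from L_cong_lift[OF this, of n k] show ?thesis using k by (simp add: diag)
  qed
  have R2: "L n (gg x y) (L n (c x y) k) = k"
    if [simp]: "x \<in> base A" "y \<in> base A" and k: "fits n [mob M' x y] k" for x y n k
  proof -
    have "gg x y \<odot> c x y = I [mob M' x y]"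
      by (rule diagram_eqI) (simp_all add: par_seq_simps gh tensor_unit_obj)
    from L_cong_lift[OF this, of n k] show ?thesis using k by (simp add: diag)
  qed
  have act: "h x z \<cdot> act M' x y z = act M x y z \<cdot> (h x y \<otimes> \<one> (ob A y z))"
    if [simp]: "x \<in> base A" "y \<in> base A" "z \<in> base A" for x y z
  proof -
    let ?k = "L 0 (c x y) (I [mob M' x y, ob A y z])"
    \<comment> \<open>One diagram evaluated in two ways: here by linearity of \<open>g\<close>,
      below by cancelling \<open>g\<close> against the inverse that precedes it. The coaction is
      treated in the same manner.\<close>
    have "L 0 (c x z) (L 0 (M'.gp x y z) (L 0 (gg x y) ?k)) = L 0 (M.gp x y z) ?k"
      by (simp add: diag R_map_act R1)
    moreover have "L 0 (c x z) (L 0 (M'.gp x y z) (L 0 (gg x y) ?k)) = c x z \<odot> M'.gp x y z"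
      using L_atom[of "M'.gp x y z"] by (simp add: R2 diag)
    ultimately have "c x z \<odot> M'.gp x y z = M.gp x y z \<odot> (c x y \<parallel> I [ob A y z])" by (simp add: diag)
    from raw_congI[OF this] show ?thesis by (simp add: par_seq_simps tensor_unit_obj)
  qed
  have coact: "coact M x y \<cdot> h x y = (h x y \<otimes> \<one> (ob A x y)) \<cdot> coact M' x y"
    if [simp]: "x \<in> base A" "y \<in> base A" for x y
  proof -
    let ?k = "L 0 (c x y) (I [mob M' x y])"
    have "L 0 (c x y) (L 0 (M'.gr x y) (L 0 (gg x y) ?k)) = L 0 (M.gr x y) ?k"
      by (simp add: diag R_map_coact R1)
    moreover have "L 0 (c x y) (L 0 (M'.gr x y) (L 0 (gg x y) ?k)) = (c x y \<parallel> I [ob A x y]) \<odot> M'.gr x y"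
      using L_atom[of "M'.gr x y"] by (simp add: R2 diag)
    ultimately have "M.gr x y \<odot> c x y = (c x y \<parallel> I [ob A x y]) \<odot> M'.gr x y"
      using L_atom[of "c x y"] by (simp add: seq_def)
    from raw_congI[OF this] show ?thesis by (simp add: par_seq_simps tensor_unit_obj)
  qed
  have "?h \<in> hopf_module_hom V A M' M"
    by (simp add: hopf_module_hom_def hH act coact)
  then have "is_inverse H M M' g ?h"
    unfolding is_inverse_def hopf_module_category_simps using hg gh by (auto intro!: restrict2_cong)
  then show ?thesis unfolding is_iso_def hopf_module_category_simps using g by blast
qed

end

section \<open>An antipode inverts the counit of the adjunction\<close>

locale antipode = hopf_setting V A
  for V :: "('o, 'a) braided_category" (structure)
    and A :: "('x, 'o, 'a) cv_category" +
  fixes S assumes S: "is_antipode V A S"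
begin

definition gS where "gS x y = mk [ob A x y] (S x y) [ob A y x]"

lemma gS_simps [simp]: "dm (gS x y) = [ob A x y]" "cd (gS x y) = [ob A y x]" "raw (gS x y) = S x y"
  "x \<in> base A \<Longrightarrow> y \<in> base A \<Longrightarrow> valid (gS x y)"
  "x \<in> base A \<Longrightarrow> y \<in> base A \<Longrightarrow> cdo (gS x y) = Some [ob A y x]"
  using S by (simp_all add: gS_def cdo_def tensor_unit_obj is_antipode_def)

lemma R_S_right:
  assumes [simp]: "x \<in> base A" "y \<in> base A" and k: "fits n [ob A x y] k"
  shows "L n (gm x y x) (L (Suc n) (gS x y) (L n (gD x y) k)) = L n (gu x) (L n (ge x y) k)"
proof -
  have "gm x y x \<odot> (I [ob A x y] \<parallel> gS x y) \<odot> gD x y = gu x \<odot> ge x y"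
    using S by (intro diagram_eqI) (simp_all add: par_seq_simps tensor_unit_obj is_antipode_def)
  from L_cong_lift[OF this, of n k] show ?thesis using k by (simp add: diag)
qed

lemma R_S_left:
  assumes [simp]: "x \<in> base A" "y \<in> base A" and k: "fits n [ob A x y] k"
  shows "L n (gm y x y) (L n (gS x y) (L n (gD x y) k)) = L n (gu y) (L n (ge x y) k)"
proof -
  have "gm y x y \<odot> (gS x y \<parallel> I [ob A x y]) \<odot> gD x y = gu y \<odot> ge x y"
    using S by (intro diagram_eqI) (simp_all add: par_seq_simps tensor_unit_obj is_antipode_def)
  from L_cong_lift[OF this, of n k] show ?thesis using k by (simp add: diag)
qed

end

locale antipode_module = antipode V A S + hopf_mod V A M
  for V :: "('o, 'a) braided_category" (structure)
    and A :: "('x, 'o, 'a) cv_category" and S M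
begin

text \<open>
  A map \<open>f\<close> is recovered from its convolution product with the identity by convolving with \<open>S\<close>.
\<close>

lemma convolution_cancel:
  assumes P: "right_module V A P \<phi>" and [simp]: "x \<in> base A" "y \<in> base A"
    and f: "f \<in> Hom V (mob M x y) (P x)" and g: "g \<in> Hom V (mob M x y) (P x)"
    and eq: "\<phi> x y \<cdot> (f \<otimes> \<one> (ob A x y)) \<cdot> coact M x y = \<phi> x y \<cdot> (g \<otimes> \<one> (ob A x y)) \<cdot> coact M x y"
  shows "f = g"
proof -
  interpret P: right_module V A P \<phi> by fact
  let ?T = "\<lambda>c. P.ga x y \<odot> (c \<parallel> I [ob A x y]) \<odot> gr x y"
  \<comment> \<open>In Sweedler notation \<open>c(m_0) m_1 S(m_2) = c(m)\<close>, where
    \<open>?T c\<close> is the convolution product \<open>c(m_0) m_1\<close>.\<close>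
  have key: "L 0 (P.ga y x) (L 1 (gS x y) (L 0 (?T c) (L 0 (gr x y) (I [mob M x y])))) = c"
    if c [simp]: "valid c" "dm c = [mob M x y]" "cd c = [P x]" for c
  proof -
    have [simp]: "cdo c = Some [P x]" by (simp add: cdo_def)
    have "L 0 (P.ga x x) (L 1 (gu x) (L 0 c (I [mob M x y]))) = L 0 c (I [mob M x y])"
      using P.R_act_unit[of x 0 "L 0 c (I [mob M x y])"] by (simp add: diag)
    then have u: "L 0 (P.ga x x) (L 0 c (L 1 (gu x) (I [mob M x y]))) = c"
      using L_atom[of c] by (simp add: diag)
    show ?thesis
      using u by (simp add: diag P.R_act_assoc[symmetric] R_coact_coassoc R_S_right R_coact_counit)
  qed
  let ?c = "\<lambda>f. mk [mob M x y] f [P x]"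
  have v: "valid (?c f)" "valid (?c g)" using f g by (simp_all add: tensor_unit_obj)
  have "?T (?c f) = ?T (?c g)"
    using eq by (intro diagram_eqI) (simp_all only: par_seq_simps v mk_sel gen_simps gen_valid P.ga_simps
        gp_simps I_sel valid_I append.simps tens.simps ob_Obj set_simps assms list.set insert_subset empty_subsetI simp_thms tensor_unit_obj)
  then have "?c f = ?c g" using key[OF v(1)] key[OF v(2)] by simp
  then show ?thesis by (simp add: mk_def)
qed

text \<open>
  In Sweedler notation this is \<open>m \<mapsto> m\<^sub>0 S(m\<^sub>1)\<close>.
\<close>

definition proj where "proj x y = gp x y x \<odot> (I [mob M x y] \<parallel> gS x y) \<odot> gr x y"

lemma proj_simps:
  assumes "x \<in> base A" "y \<in> base A"
  shows "valid (proj x y)" "dm (proj x y) = [mob M x y]" "cd (proj x y) = [mob M x x]"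
    "cdo (proj x y) = Some [mob M x x]"
  using assms by (simp_all add: proj_def par_seq_simps cdo_valid)

lemma proj_L:
  assumes [simp]: "x \<in> base A" "y \<in> base A" and k: "fits n [mob M x y] k"
  shows "L n (proj x y) k = L n (gp x y x) (L (Suc n) (gS x y) (L n (gr x y) k))"
  using k by (simp add: proj_def diag)

text \<open>By coassociativity and the antipode,
  \<open>m_0 S(m_1) m_2 = m_0 \<epsilon>(m_1) = m\<close>.\<close>

lemma R_proj:
  assumes [simp]: "x \<in> base A" "y \<in> base A" and k: "fits n [mob M x y] k"
  shows "L n (gp x x y) (L n (proj x y) (L n (gr x y) k)) = k"
proof -
  have "L 0 (gp x x y) (L 0 (proj x y) (L 0 (gr x y) (I [mob M x y]))) = I [mob M x y]"
    by (simp add: proj_L diag R_mact_assoc R_coact_coassoc R_S_left R_coact_counit R_mact_unit)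
  from L_cong_lift[OF this, of n k] show ?thesis using k by (simp add: diag proj_simps)
qed

text \<open>
  Both sides have the same convolution product with the identity, namely the coaction, with
  respect to the diagonal action on \<open>M \<otimes> A\<close>. This avoids showing that \<open>S\<close> reverses the
  comultiplication.
\<close>

lemma proj_coinv:
  assumes [simp]: "x \<in> base A" "y \<in> base A"
  shows "coact M x x \<cdot> raw (proj x y) = (\<one> (mob M x x) \<otimes> unity A x) \<cdot> raw (proj x y)"
proof -
  interpret P: right_module V A "mob M x" "act M x" by (rule right_module) simp
  interpret Q: right_module V A "ob A x" "mult A x" by (rule mult_right_module) simp
  interpret T: two_modules V A "mob M x" "act M x" "ob A x" "mult A x" by unfold_locales
  have ga: "P.ga y z = gp x y z" "Q.ga y z = gm x y z" for y z
    by (simp_all add: P.ga_def Q.ga_def gp_def gm_def)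
  let ?f = "gr x x \<odot> proj x y" and ?g = "(I [mob M x x] \<parallel> gu x) \<odot> proj x y"
  note [simp] = proj_simps
  \<comment> \<open>Compatibility, read backwards, pulls the coaction \<open>\<rho>\<close> out of
    the diagonal action:
    \<open>\<rho>(m_0 S(m_1)) m_2 = \<rho>(m_0 S(m_1) m_2) = \<rho>(m)\<close>.\<close>
  have "T.diag_gen x y \<odot> (?f \<parallel> I [ob A x y]) \<odot> gr x y = L 0 (gr x y) (L 0 (gp x x y) (L 0 (proj x y) (L 0 (gr x y) (I [mob M x y]))))"
    using L_atom[of "gr x y"] by (simp add: T.diag_gen_L ga diag R_compat)
  also have "\<dots> = L 0 (gr x y) (I [mob M x y])" by (simp add: R_proj diag)
  also have "\<dots> = gr x y" using L_atom[of "gr x y"] by simp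
  finally have 1: "T.diag_gen x y \<odot> (?f \<parallel> I [ob A x y]) \<odot> gr x y = gr x y" .
  \<comment> \<open>For the other side, \<open>(m_0 S(m_1) \<otimes> 1) m_2 = m_0 S(m_1) m_2
    \<otimes> m_3 = \<rho>(m)\<close>.\<close>
  have "L 0 (T.diag_gen x y) (L 0 (?g \<parallel> I [ob A x y]) (L 0 (gr x y) (I [mob M x y]))) =
      L 0 (gp x x y) (L 0 (proj x y) (L 0 (gr x y) (L 0 (gr x y) (I [mob M x y]))))"
    by (simp add: T.diag_gen_L ga diag R_braid_unit_left R_unit_left R_coact_coassoc)
  also have "\<dots> = gr x y" using L_atom[of "gr x y"] by (simp add: R_proj diag)
  finally have 2: "T.diag_gen x y \<odot> (?g \<parallel> I [ob A x y]) \<odot> gr x y = gr x y"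
    using L_atom[of "gr x y"] by (simp add: seq_def)
  have "raw ?f = raw ?g"
  proof (rule convolution_cancel[OF T.diag_right_module assms])
    show "raw ?f \<in> Hom V (mob M x y) (mob M x x \<otimes>\<^sub>o ob A x x)"
      using validD(3)[of ?f] by (simp add: par_seq_simps tensor_unit_obj)
    show "raw ?g \<in> Hom V (mob M x y) (mob M x x \<otimes>\<^sub>o ob A x x)"
      using validD(3)[of ?g] by (simp add: par_seq_simps tensor_unit_obj)
    show "diag_act (mob M x) (act M x) (ob A x) (mult A x) x y \<cdot> (raw ?f \<otimes> \<one> (ob A x y)) \<cdot> coact M x y =
      diag_act (mob M x) (act M x) (ob A x) (mult A x) x y \<cdot> (raw ?g \<otimes> \<one> (ob A x y)) \<cdot> coact M x y"
      using raw_congI[OF 1] raw_congI[OF 2] by (simp add: par_seq_simps tensor_unit_obj)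
  qed
  then show ?thesis by (simp add: par_seq_simps tensor_unit_obj)
qed

definition proj_lift where "proj_lift x y = mk [mob M x y] (coinv_lift V A M x (mob M x y) (raw (proj x y))) [E x]"

lemma proj_lift_simps [simp]:
  "dm (proj_lift x y) = [mob M x y]" "cd (proj_lift x y) = [E x]"
  "x \<in> base A \<Longrightarrow> y \<in> base A \<Longrightarrow> valid (proj_lift x y)"
  "x \<in> base A \<Longrightarrow> y \<in> base A \<Longrightarrow> cdo (proj_lift x y) = Some [E x]"
  "x \<in> base A \<Longrightarrow> y \<in> base A \<Longrightarrow> inc x \<cdot> raw (proj_lift x y) = raw (proj x y)"
proof -
  show "dm (proj_lift x y) = [mob M x y]" "cd (proj_lift x y) = [E x]" by (simp_all add: proj_lift_def)
  assume [simp]: "x \<in> base A" "y \<in> base A"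
  have "raw (proj x y) \<in> Hom V (mob M x y) (mob M x x)"
    using validD(3)[of "proj x y"] by (simp add: proj_simps tensor_unit_obj)
  from coinv_lift[OF _ _ this proj_coinv]
  show "valid (proj_lift x y)" "cdo (proj_lift x y) = Some [E x]" "inc x \<cdot> raw (proj_lift x y) = raw (proj x y)"
    by (simp_all add: proj_lift_def cdo_def tensor_unit_obj)
qed

lemma R_inc_proj_lift:
  assumes [simp]: "x \<in> base A" "y \<in> base A" and k: "fits n [mob M x y] k"
  shows "L n (gi x) (L n (proj_lift x y) k) = L n (proj x y) k"
proof -
  have "gi x \<odot> proj_lift x y = proj x y"
    by (rule diagram_eqI) (simp_all add: par_seq_simps proj_simps)
  from L_cong_lift[OF this, of n k] show ?thesis using k by (simp add: diag)
qed

text \<open>The coaction of \<open>i(n) a\<close> is \<open>i(n) a_1 \<otimes> a_2\<close>, so the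
  projection sends it to \<open>i(n) a_1 S(a_2) = i(n) \<epsilon>(a)\<close>; the monic
  \<open>inc x\<close> then cancels.\<close>

lemma proj_lift_counit:
  assumes [simp]: "x \<in> base A" "y \<in> base A"
  shows "proj_lift x y \<odot> g_counit x y = I [E x] \<parallel> ge x y"
proof (rule diagram_eqI)
  note [simp] = g_counit_simps(1-3)
  let ?l = "proj_lift x y \<odot> g_counit x y" and ?r = "I [E x] \<parallel> ge x y"
  show v: "valid ?l" "valid ?r" "dm ?l = dm ?r" "cd ?l = cd ?r" by (simp_all add: par_seq_simps)
  have "gi x \<odot> ?l = gi x \<odot> ?r"
    using R_mact_unit_inc[of x 0 "L (Suc 0) (ge x y) (I [E x, ob A x y])"]
    by (simp add: g_counit_L diag R_inc_proj_lift proj_L R_compat R_inc R_braid_unit_left R_unit_left R_mact_assoc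
        R_S_right R_mact_unit_inc)
  from raw_congI[OF this] have "inc x \<cdot> raw ?l = inc x \<cdot> raw ?r"
    by (simp add: par_seq_simps)
  then show "raw ?l = raw ?r"
    using validD(3)[OF v(1)] validD(3)[OF v(2)]
    by - (rule inc_mono[of x "E x \<otimes>\<^sub>o ob A x y"], simp_all add: par_seq_simps tensor_unit_obj tensor_Obj)
qed

lemma R_proj_lift_counit:
  assumes [simp]: "x \<in> base A" "y \<in> base A" and k: "fits n [E x, ob A x y] k"
  shows "L n (proj_lift x y) (L n (gp x x y) (L n (gi x) k)) = L (Suc n) (ge x y) k"
  using L_cong_lift[OF proj_lift_counit[of x y], of n k] k by (simp add: g_counit_L diag)

lemma counit_inverse:
  assumes [simp]: "x \<in> base A" "y \<in> base A"
  shows "is_inverse V (E x \<otimes>\<^sub>o ob A x y) (mob M x y) (FG_counit V A M x y)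
     ((raw (proj_lift x y) \<otimes> \<one> (ob A x y)) \<cdot> coact M x y)"
proof -
  let ?t = "(proj_lift x y \<parallel> I [ob A x y]) \<odot> gr x y"
  have "g_counit x y \<odot> L 0 (proj_lift x y \<parallel> I [ob A x y]) (L 0 (gr x y) (I [mob M x y])) = I [mob M x y]"
    by (simp add: g_counit_L diag R_inc_proj_lift R_proj)
  then have 1: "g_counit x y \<odot> ?t = I [mob M x y]" using L_atom[of "gr x y"] by (simp add: seq_def)
  have 2: "?t \<odot> g_counit x y = I [E x, ob A x y]"
    by (simp add: g_counit_L diag R_compat R_inc R_braid_unit_left R_unit_left R_proj_lift_counit R_counit_left)
  note [simp] = g_counit_simps
  show ?thesis
    using raw_congI[OF 1] raw_congI[OF 2] validD(3)[of ?t]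
    by (simp add: is_inverse_def par_seq_simps tensor_unit_obj)
qed

end

section \<open>Canonical maps as counits at diagonal Hopf modules\<close>

lemma (in category) is_iso_comp:
  assumes o: "a \<in> Obj C" "b \<in> Obj C" "c \<in> Obj C" and f: "is_iso C a b f" and g: "is_iso C b c g"
  shows "is_iso C a c (g \<cdot> f)"
proof -
  obtain f' where f: "f \<in> Hom C a b" and f': "f' \<in> Hom C b a" "f' \<cdot> f = \<one> a" "f \<cdot> f' = \<one> b"
    using f by (auto simp: is_iso_def is_inverse_def)
  obtain g' where g: "g \<in> Hom C b c" and g': "g' \<in> Hom C c b" "g' \<cdot> g = \<one> b" "g \<cdot> g' = \<one> c"
    using g by (auto simp: is_iso_def is_inverse_def)
  have "g' \<cdot> g \<cdot> f = f"
    using comp_assoc[OF o(1,2,3,2) f g g'(1)] g' comp_ident_left[OF o(1,2) f] by simp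
  then have 1: "(f' \<cdot> g') \<cdot> g \<cdot> f = \<one> a"
    using comp_assoc[OF o(1,3,2,1) comp_hom[OF o f g] g'(1) f'(1)] f' by simp
  have "f \<cdot> f' \<cdot> g' = g'"
    using comp_assoc[OF o(3,2,1,2) g'(1) f'(1) f] f' comp_ident_left[OF o(3,2) g'(1)] by simp
  then have 2: "(g \<cdot> f) \<cdot> f' \<cdot> g' = \<one> c"
    using comp_assoc[OF o(3,1,2,3) comp_hom[OF o(3,2,1) g'(1) f'(1)] f g] g' by simp
  show ?thesis unfolding is_iso_def is_inverse_def
    using 1 2 comp_hom[OF o f g] comp_hom[OF o(3,2,1) g'(1) f'(1)] by blast
qed

lemma (in strict_monoidal_category) is_iso_tensor_ident:
  assumes o: "a \<in> Obj V" "b \<in> Obj V" "c \<in> Obj V" and f: "is_iso V a b f"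
  shows "is_iso V (a \<otimes>\<^sub>o c) (b \<otimes>\<^sub>o c) (f \<otimes> \<one> c)"
proof -
  obtain f' where f: "f \<in> Hom V a b" and f': "f' \<in> Hom V b a" "f' \<cdot> f = \<one> a" "f \<cdot> f' = \<one> b"
    using f by (auto simp: is_iso_def is_inverse_def)
  have i: "\<one> c \<in> Hom V c c" "\<one> c \<cdot> \<one> c = \<one> c" using o by (simp_all add: ident_hom ident_comp)
  have "(f' \<otimes> \<one> c) \<cdot> (f \<otimes> \<one> c) = \<one> (a \<otimes>\<^sub>o c)" "(f \<otimes> \<one> c) \<cdot> (f' \<otimes> \<one> c) = \<one> (b \<otimes>\<^sub>o c)"
    using tensor_comp[OF o(1,2,1) o(3,3,3) f f'(1) i(1) i(1)] tensor_comp[OF o(2,1,2) o(3,3,3) f'(1) f i(1) i(1)]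
      f' i o by (simp_all add: tensor_ident)
  then show ?thesis unfolding is_iso_def is_inverse_def
    using tensor_Hom[OF o(1,2,3,3) f i(1)] tensor_Hom[OF o(2,1,3,3) f'(1) i(1)] by blast
qed

context diag_hopf
begin

text \<open>Here the first tensor factor varies with the second index \<open>y\<close>, whereas in
  \<open>free_module\<close> it varies with the first.\<close>

definition diag_module where
  "diag_module = \<lparr>mob = (\<lambda>x\<in>base A. \<lambda>y\<in>base A. P y \<otimes>\<^sub>o ob A x y),
     act = (\<lambda>x\<in>base A. \<lambda>y\<in>base A. \<lambda>z\<in>base A. diag_act P \<phi> (ob A x) (mult A x) y z),
     coact = (\<lambda>x\<in>base A. \<lambda>y\<in>base A. \<one> (P y) \<otimes> comul (coalg A x y))\<rparr>"

lemma diag_module_simps [simp]: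
  "x \<in> base A \<Longrightarrow> y \<in> base A \<Longrightarrow> mob diag_module x y = P y \<otimes>\<^sub>o ob A x y"
  "x \<in> base A \<Longrightarrow> y \<in> base A \<Longrightarrow> z \<in> base A \<Longrightarrow> act diag_module x y z = diag_act P \<phi> (ob A x) (mult A x) y z"
  "x \<in> base A \<Longrightarrow> y \<in> base A \<Longrightarrow> coact diag_module x y = \<one> (P y) \<otimes> comul (coalg A x y)"
  by (simp_all add: diag_module_def)

lemma diag_module_hopf: "hopf_module V A diag_module"
proof
  have T: "right_module V A (\<lambda>y. P y \<otimes>\<^sub>o ob A x y) (diag_act P \<phi> (ob A x) (mult A x))"
    if "x \<in> base A" for x
    by (intro two_modules.diag_right_module two_modules.intro cv_context_axioms right_module_axioms
        mult_right_module that)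
  show "mob diag_module \<in> (\<Pi>\<^sub>E x \<in> base A. \<Pi>\<^sub>E y \<in> base A. Obj V)"
    by (simp add: diag_module_def tensor_Obj)
  show "act diag_module \<in> (\<Pi>\<^sub>E x\<in>base A. \<Pi>\<^sub>E y\<in>base A. \<Pi>\<^sub>E z\<in>base A.
      Hom V (mob diag_module x y \<otimes>\<^sub>o ob A y z) (mob diag_module x z))"
    using right_module.phi_Hom[OF T] by (simp add: diag_module_def)
  have gr: "valid (I [P y] \<parallel> gD x y)" if "x \<in> base A" "y \<in> base A" for x y
    using that by (simp add: par_seq_simps)
  show "coact diag_module \<in> (\<Pi>\<^sub>E x\<in>base A. \<Pi>\<^sub>E y\<in>base A.
      Hom V (mob diag_module x y) (mob diag_module x y \<otimes>\<^sub>o ob A x y))"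
    using validD(3)[OF gr] by (simp add: diag_module_def par_seq_simps tensor_unit_obj tensor_obj_assoc)
  fix x y z u assume [simp]: "x \<in> base A" "y \<in> base A" "z \<in> base A" "u \<in> base A"
  show "act diag_module x z u \<cdot> (act diag_module x y z \<otimes> \<one> (ob A z u)) =
      act diag_module x y u \<cdot> (\<one> (mob diag_module x y) \<otimes> mult A y z u)"
    using right_module.phi_assoc[OF T, of x y z u] by simp
  show "act diag_module x y y \<cdot> (\<one> (mob diag_module x y) \<otimes> unity A y) = \<one> (mob diag_module x y)"
    using right_module.phi_unity[OF T, of x y] by simp
  have "((I [P y] \<parallel> gD x y) \<parallel> I [ob A x y]) \<odot> (I [P y] \<parallel> gD x y) =
     (I [P y, ob A x y] \<parallel> gD x y) \<odot> (I [P y] \<parallel> gD x y)"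
    by (simp add: diag R_coassoc)
  from arg_cong[OF this, of raw]
  show "(coact diag_module x y \<otimes> \<one> (ob A x y)) \<cdot> coact diag_module x y =
      (\<one> (mob diag_module x y) \<otimes> comul (coalg A x y)) \<cdot> coact diag_module x y"
    by (simp add: par_seq_simps tensor_unit_obj)
  have "(I [P y, ob A x y] \<parallel> ge x y) \<odot> (I [P y] \<parallel> gD x y) = I [P y, ob A x y]"
    by (simp add: diag R_counit_right)
  from arg_cong[OF this, of raw]
  show "(\<one> (mob diag_module x y) \<otimes> counit (coalg A x y)) \<cdot> coact diag_module x y = \<one> (mob diag_module x y)"
    by (simp add: par_seq_simps tensor_unit_obj)
  show "coact diag_module x z \<cdot> act diag_module x y z = (act diag_module x y z \<otimes> mult A x y z)
      \<cdot> (\<one> (mob diag_module x y) \<otimes> \<c> (ob A x y) (ob A y z) \<otimes> \<one> (ob A y z))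
      \<cdot> (coact diag_module x y \<otimes> comul (coalg A y z))"
    using arg_cong[OF diag_hopf_gen_compat[of x y z], of raw] by (simp add: par_seq_simps tensor_unit_obj)
qed

end

context hopf_setting
begin

text \<open>The unit followed by the counit at the diagonal module sends
  \<open>b \<otimes> a\<close> to \<open>(b \<otimes> 1) a = b a_1 \<otimes> a_2\<close>, which is
  the canonical map.\<close>

lemma can_iso_if_counit_iso:
  assumes iso: "\<And>M. hopf_module V A M \<Longrightarrow> is_iso H (fobj F (fobj G M)) M (FG_counit V A M)"
    and [simp]: "x \<in> base A" "y \<in> base A" "z \<in> base A"
  shows "is_iso V (can_dom V A z x y) (can_cod V A z x y) (can V A z x y)"
proof -
  interpret P: right_module V A "ob A z" "mult A z" by (rule mult_right_module) simp
  interpret P: diag_hopf V A "ob A z" "mult A z" by unfold_locales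
  let ?M = "P.diag_module" and ?N = "\<lambda>x\<in>base A. ob A z x"
  have N: "?N \<in> (\<Pi>\<^sub>E x \<in> base A. Obj V)" by simp
  interpret N: free_mod V A ?N by (rule free_modI[OF N])
  interpret M: hopf_mod V A ?M by (rule hopf_modI[OF P.diag_module_hopf])
  have ga: "P.ga y y' = gm z y y'" for y y' by (simp add: P.ga_def gm_def)
  \<comment> \<open>The two equalizer problems are literally the same, so Hilbert choice selects the
    same solution.\<close>
  have coinv: "coinv V A ?M x = coinv V A (free_module V A ?N) x" by (simp add: coinv_def)
  obtain k where k: "k \<in> hopf_module_hom V A ?M (free_module V A (\<lambda>x\<in>base A. coinv_obj V A ?M x))"
    and k1: "(\<lambda>x\<in>base A. \<lambda>y\<in>base A. k x y \<cdot> FG_counit V A ?M x y) =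
      (\<lambda>x\<in>base A. \<lambda>y\<in>base A. \<one> (mob (free_module V A (\<lambda>x\<in>base A. coinv_obj V A ?M x)) x y))"
    and k2: "(\<lambda>x\<in>base A. \<lambda>y\<in>base A. FG_counit V A ?M x y \<cdot> k x y) =
      (\<lambda>x\<in>base A. \<lambda>y\<in>base A. \<one> (mob ?M x y))"
    using iso[OF P.diag_module_hopf]
    by (auto simp: is_iso_def is_inverse_def hopf_module_category_simps functor_simps)
  have "k x y \<in> Hom V (mob ?M x y) (M.E x \<otimes>\<^sub>o ob A x y)"
    using k by (auto simp: hopf_module_hom_def dest: PiE2_mem[of k _ _ _ x y])
  then have e: "is_iso V (M.E x \<otimes>\<^sub>o ob A x y) (mob ?M x y) (FG_counit V A ?M x y)"
    using fun_cong[OF fun_cong[OF k1, of x], of y] fun_cong[OF fun_cong[OF k2, of x], of y] M.counit_Hom'[of x y]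
    by (auto simp: is_iso_def is_inverse_def)
  have E: "M.E x = N.F.E x" using coinv by simp
  have n: "is_iso V (ob A z x) (N.F.E x) (N.eta x)"
    using N.eta_iso[of x] N.eta(1)[of x] unfolding is_iso_def by auto
  have "P.diag_hopf_gen x x y \<odot> (N.g_incl x \<parallel> I [ob A x y]) \<odot> (N.g_eta x \<parallel> I [ob A x y]) = (gm z x y \<parallel> I [ob A x y]) \<odot> (I [ob A z x] \<parallel> gD x y)"
    using N.R_inc_eta[of x] by (simp add: P.diag_hopf_gen_L ga diag R_braid_unit_left R_unit_left)
  from raw_congI[OF this]
  have "diag_act (ob A z) (mult A z) (ob A x) (mult A x) x y \<cdot> (N.F.inc x \<otimes> \<one> (ob A x y)) \<cdot> (N.eta x \<otimes> \<one> (ob A x y))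
     = can V A z x y"
    by (simp add: par_seq_simps tensor_unit_obj can_def)
  moreover have "(diag_act (ob A z) (mult A z) (ob A x) (mult A x) x y \<cdot> (N.F.inc x \<otimes> \<one> (ob A x y))) \<cdot> (N.eta x \<otimes> \<one> (ob A x y))
    = diag_act (ob A z) (mult A z) (ob A x) (mult A x) x y \<cdot> (N.F.inc x \<otimes> \<one> (ob A x y)) \<cdot> (N.eta x \<otimes> \<one> (ob A x y))"
  proof (rule comp_assoc)
    show "N.eta x \<otimes> \<one> (ob A x y) \<in> Hom V (ob A z x \<otimes>\<^sub>o ob A x y) (N.F.E x \<otimes>\<^sub>o ob A x y)"
      using N.eta(1)[of x] by (simp add: tensor_Hom ident_hom)
    show "N.F.inc x \<otimes> \<one> (ob A x y) \<in> Hom V (N.F.E x \<otimes>\<^sub>o ob A x y) ((ob A z x \<otimes>\<^sub>o ob A x x) \<otimes>\<^sub>o ob A x y)"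
      using N.F.inc_Hom[of x] by (simp add: tensor_Hom ident_hom tensor_Obj)
    show "diag_act (ob A z) (mult A z) (ob A x) (mult A x) x y \<in> Hom V ((ob A z x \<otimes>\<^sub>o ob A x x) \<otimes>\<^sub>o ob A x y) (ob A z y \<otimes>\<^sub>o ob A x y)"
      using M.act[of x x y] by simp
  qed (simp_all add: tensor_Obj)
  ultimately have can: "can V A z x y = FG_counit V A ?M x y \<cdot> (N.eta x \<otimes> \<one> (ob A x y))"
    by (simp add: FG_counit_def coinv)
  show ?thesis unfolding can
  proof (rule is_iso_comp)
    show "is_iso V (can_dom V A z x y) (N.F.E x \<otimes>\<^sub>o ob A x y) (N.eta x \<otimes> \<one> (ob A x y))"
      by (rule is_iso_tensor_ident[OF _ _ _ n]) simp_all
    show "is_iso V (N.F.E x \<otimes>\<^sub>o ob A x y) (can_cod V A z x y) (FG_counit V A ?M x y)"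
      using e by (simp add: E)
  qed (simp_all add: tensor_Obj)
qed

lemma counit_iso_if_hopf:
  assumes "is_antipode V A S" and M: "hopf_module V A M"
  shows "is_iso H (fobj F (fobj G M)) M (FG_counit V A M)"
proof -
  interpret M: antipode_module V A S M
    by (intro antipode_module.intro antipode.intro hopf_modI hopf_setting_axioms antipode_axioms.intro assms)
  have "FG_counit V A M \<in> hopf_module_hom V A (free_module V A (\<lambda>x\<in>base A. coinv_obj V A M x)) M"
    using natural_transformation.component_Hom[OF counit_natural, of M] M
    by (simp add: hopf_module_category_simps functor_simps)
  then interpret e: hopf_map V A "free_module V A (\<lambda>x\<in>base A. coinv_obj V A M x)" M "FG_counit V A M"
    by (rule hopf_mapI[OF free_hopf[OF coinv_family[OF M]] M])
  show ?thesis unfolding functor_simps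
    using M.counit_inverse by (intro e.pointwise_inverse) simp
qed

text \<open>
  The antipode is \<open>S(a) = (1 \<otimes> \<epsilon>) g(1 \<otimes> a)\<close>. As \<open>g\<close> inverts a colinear map it is colinear, so
  \<open>g(1 \<otimes> a) = S(a\<^sub>1) \<otimes> a\<^sub>2\<close>; applying the canonical map gives \<open>S(a\<^sub>1) a\<^sub>2 = \<epsilon>(a) 1\<close>. Then the
  canonical map sends \<open>a\<^sub>1 S(a\<^sub>2) \<otimes> a\<^sub>3\<close> and \<open>1 \<otimes> a\<close> both to \<open>a\<^sub>1 \<otimes> a\<^sub>2\<close>, and \<open>f\<close> cancels it.
\<close>

lemma antipode_component:
  assumes [simp]: "x \<in> base A" "y \<in> base A"
    and f: "is_left_inverse V (can_dom V A x x y) (can_cod V A x x y) (can V A x x y) f"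
    and g: "is_inverse V (can_dom V A y x y) (can_cod V A y x y) (can V A y x y) g"
  shows "\<exists>s. s \<in> Hom V (ob A x y) (ob A y x) \<and>
    mult A x y x \<cdot> (\<one> (ob A x y) \<otimes> s) \<cdot> comul (coalg A x y) = unity A x \<cdot> counit (coalg A x y) \<and>
    mult A y x y \<cdot> (s \<otimes> \<one> (ob A x y)) \<cdot> comul (coalg A x y) = unity A y \<cdot> counit (coalg A x y)"
proof -
  define c where "c = mk [ob A x y, ob A x y] f [ob A x x, ob A x y]"
  define d where "d = mk [ob A y y, ob A x y] g [ob A y x, ob A x y]"
  have c [simp]: "dm c = [ob A x y, ob A x y]" "cd c = [ob A x x, ob A x y]" "raw c = f" "valid c"
     "cdo c = Some [ob A x x, ob A x y]"
    using f by (simp_all add: c_def cdo_def is_left_inverse_def tensor_unit_obj)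
  have d [simp]: "dm d = [ob A y y, ob A x y]" "cd d = [ob A y x, ob A x y]" "raw d = g" "valid d"
     "cdo d = Some [ob A y x, ob A x y]"
    using g by (simp_all add: d_def cdo_def is_inverse_def tensor_unit_obj)
  let ?can = "\<lambda>z. (gm z x y \<parallel> I [ob A x y]) \<odot> (I [ob A z x] \<parallel> gD x y)"
  have R_c: "L n c (L n (gm x x y) (L (Suc n) (gD x y) k)) = k" if k: "fits n [ob A x x, ob A x y] k" for n k
  proof -
    have "c \<odot> ?can x = I [ob A x x, ob A x y]"
      using f by (intro diagram_eqI) (simp_all add: par_seq_simps is_left_inverse_def can_def tensor_unit_obj)
    from L_cong_lift[OF this, of n k] show ?thesis using k by (simp add: diag)
  qed
  have R_d: "L n d (L n (gm y x y) (L (Suc n) (gD x y) k)) = k" if k: "fits n [ob A y x, ob A x y] k" for n k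
  proof -
    have "d \<odot> ?can y = I [ob A y x, ob A x y]"
      using g by (intro diagram_eqI) (simp_all add: par_seq_simps is_inverse_def can_def tensor_unit_obj)
    from L_cong_lift[OF this, of n k] show ?thesis using k by (simp add: diag)
  qed
  have R_d': "L n (gm y x y) (L (Suc n) (gD x y) (L n d k)) = k" if k: "fits n [ob A y y, ob A x y] k" for n k
  proof -
    have "?can y \<odot> d = I [ob A y y, ob A x y]"
      using g by (intro diagram_eqI) (simp_all add: par_seq_simps is_inverse_def can_def tensor_unit_obj)
    from L_cong_lift[OF this, of n k] show ?thesis using k by (simp add: diag)
  qed
  let ?i = "I [ob A y y, ob A x y]"
  \<comment> \<open>The canonical map commutes with the comultiplication of its right factor;
    inserting it next to its inverse \<open>d\<close> transfers this property to
    \<open>d\<close>.\<close>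
  have "L (Suc 0) (gD x y) (L 0 d ?i) = L 0 d (L 0 (gm y x y) (L (Suc 0) (gD x y) (L (Suc 0) (gD x y) (L 0 d ?i))))"
    by (rule R_d[symmetric]) (simp add: diag)
  also have "L (Suc 0) (gD x y) (L (Suc 0) (gD x y) (L 0 d ?i)) = L (Suc (Suc 0)) (gD x y) (L (Suc 0) (gD x y) (L 0 d ?i))"
    by (rule R_coassoc) (simp_all add: diag)
  also have "L 0 (gm y x y) (L (Suc (Suc 0)) (gD x y) (L (Suc 0) (gD x y) (L 0 d ?i))) =
      L (Suc 0) (gD x y) (L 0 (gm y x y) (L (Suc 0) (gD x y) (L 0 d ?i)))"
    by (simp add: diag)
  also have "L 0 (gm y x y) (L (Suc 0) (gD x y) (L 0 d ?i)) = ?i" by (simp add: R_d' diag)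
  finally have colinear: "L (Suc 0) (gD x y) (L 0 d ?i) = L 0 d (L (Suc 0) (gD x y) ?i)" .
  let ?j = "I [ob A x y]"
  define s where "s = (I [ob A y x] \<parallel> ge x y) \<odot> d \<odot> (gu y \<parallel> ?j)"
  have s [simp]: "dm s = [ob A x y]" "cd s = [ob A y x]" "valid s" "cdo s = Some [ob A y x]"
    by (simp_all add: s_def par_seq_simps cdo_valid)
  have s_L: "L n s k = L (Suc n) (ge x y) (L n d (L n (gu y) k))" if k: "fits n [ob A x y] k" for n k
    using k by (simp add: s_def diag)
  have gamma: "L 0 d (L 0 (gu y) (L 0 (gD x y) ?j)) = L (Suc 0) (gD x y) (L 0 d (L 0 (gu y) ?j))"
    using L_cong_lift[OF colinear, of 0 "L 0 (gu y) ?j"] by (simp add: diag)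
  have can_gamma: "L 0 (gm y x y) (L (Suc 0) (gD x y) (L 0 d (L 0 (gu y) ?j))) = L 0 (gu y) ?j"
    by (simp add: R_d' diag)
  \<comment> \<open>The counit on the right factor of
    \<open>can (g (1 \<otimes> a)) = 1 \<otimes> a\<close> shows that the two factors of
    \<open>g (1 \<otimes> a)\<close> multiply to \<open>\<epsilon>(a) 1\<close>.\<close>
  have mg: "L 0 (gm y x y) (L 0 d (L 0 (gu y) ?j)) = L 0 (gu y) (L 0 (ge x y) ?j)"
    using arg_cong[OF can_gamma, of "L (Suc 0) (ge x y)"] by (simp add: diag R_counit_right)
  \<comment> \<open>By \<open>gamma\<close> the element \<open>S(a_1) \<otimes> a_2\<close> is
    \<open>g (1 \<otimes> a)\<close>, whose factors are multiplied by \<open>mg\<close>.\<close>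
  have left: "L 0 (gm y x y) (L 0 s (L 0 (gD x y) ?j)) = L 0 (gu y) (L 0 (ge x y) ?j)"
    by (simp add: s_L diag gamma R_counit_left mg)
  have R_left: "L n (gm y x y) (L n s (L n (gD x y) k)) = L n (gu y) (L n (ge x y) k)"
    if k: "fits n [ob A x y] k" for n k
    using L_cong_lift[OF left, of n k] k by (simp add: diag)
  let ?h = "L 0 (gm x y x) (L (Suc 0) s (L 0 (gD x y) (L 0 (gD x y) ?j)))"
  \<comment> \<open>Two bracketings of the comultiplication into four factors; the left one is what
    sorting leaves in the computation of \<open>1\<close>, where \<open>R_coassoc\<close> does not
    match directly.\<close>
  have co: "L 0 (gD x y) (L (Suc 0) (gD x y) (L 0 (gD x y) ?j)) = L (Suc 0) (gD x y) (L (Suc 0) (gD x y) (L 0 (gD x y) ?j))"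
  proof -
    have "L 0 (gD x y) (L (Suc 0) (gD x y) (L 0 (gD x y) ?j)) = L (Suc (Suc 0)) (gD x y) (L 0 (gD x y) (L 0 (gD x y) ?j))"
      by (simp add: diag)
    also have "\<dots> = L (Suc (Suc 0)) (gD x y) (L (Suc 0) (gD x y) (L 0 (gD x y) ?j))"
      by (simp add: diag R_coassoc)
    also have "\<dots> = L (Suc 0) (gD x y) (L (Suc 0) (gD x y) (L 0 (gD x y) ?j))"
      by (rule R_coassoc[symmetric]) (simp_all add: diag)
    finally show ?thesis .
  qed
  \<comment> \<open>With \<open>?h\<close> standing for \<open>a_1 S(a_2) \<otimes> a_3\<close>, the
    canonical map gives \<open>a_1 S(a_2) a_3 \<otimes> a_4 = a_1 \<otimes> a_2\<close>.\<close>
  have 1: "L 0 (gm x x y) (L (Suc 0) (gD x y) ?h) = L 0 (gD x y) ?j"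
    by (simp add: diag R_assoc co R_left R_counit_left R_unit_right)
  have 2: "L 0 (gm x x y) (L (Suc 0) (gD x y) (L 0 (gu x) ?j)) = L 0 (gD x y) ?j"
    by (simp add: diag R_unit_left)
  have h: "?h = L 0 (gu x) ?j"
    using R_c[of 0 ?h] R_c[of 0 "L 0 (gu x) ?j"] 1 2 by (simp add: diag)
  \<comment> \<open>The counit removes the right factor from
    \<open>a_1 S(a_2) \<otimes> a_3 = 1 \<otimes> a\<close>.\<close>
  have right: "L 0 (gm x y x) (L (Suc 0) s (L 0 (gD x y) ?j)) = L 0 (gu x) (L 0 (ge x y) ?j)"
    using arg_cong[OF h, of "L (Suc 0) (ge x y)"] by (simp add: diag R_counit_right)
  have at: "L 0 (gD x y) ?j = gD x y" "L 0 (ge x y) ?j = ge x y"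
    using L_atom[of "gD x y"] L_atom[of "ge x y"] by simp_all
  have a: "gm x y x \<odot> (I [ob A x y] \<parallel> s) \<odot> gD x y = gu x \<odot> ge x y"
    using right by (simp only: at) (simp add: diag)
  have b: "gm y x y \<odot> (s \<parallel> I [ob A x y]) \<odot> gD x y = gu y \<odot> ge x y"
    using left by (simp only: at) (simp add: diag)
  show ?thesis
    using raw_congI[OF a] raw_congI[OF b] validD(3)[OF s(3)]
    by (intro exI[of _ "raw s"]) (simp add: par_seq_simps tensor_unit_obj)
qed

end

section \<open>The cycle of implications from (1) through (5) back to (1)\<close>

theorem theorem9p2:
  fixes V :: "('o, 'a) braided_category"
    and A :: "('x, 'o, 'a) cv_category"
  assumes "strict_braided_monoidal_category V"
    and "has_equalizers V"
    and "cv_category V A"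
  defines "X \<equiv> base A"
  defines "P1 \<equiv> hopf_category V A"
    and "P2 \<equiv> inverse_equivalences (family_category V X) (hopf_module_category V A)
      (F_functor V A) (G_functor V A) (FG_unit V A) (FG_counit V A)"
    and "P3 \<equiv> fully_faithful (hopf_module_category V A) (family_category V X) (G_functor V A)"
    and "P4 \<equiv> \<forall>x \<in> X. \<forall>y \<in> X. \<forall>z \<in> X.
      is_iso V (can_dom V A z x y) (can_cod V A z x y) (can V A z x y)"
    and "P5 \<equiv> \<forall>x \<in> X. \<forall>y \<in> X.
      (\<exists>f. is_left_inverse V (can_dom V A x x y) (can_cod V A x x y) (can V A x x y) f) \<and>
      is_iso V (can_dom V A y x y) (can_cod V A y x y) (can V A y x y)"
  shows "(P1 \<longleftrightarrow> P2) \<and> (P2 \<longleftrightarrow> P3) \<and> (P3 \<longleftrightarrow> P4) \<and> (P4 \<longleftrightarrow> P5)"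
proof -
  interpret hopf_setting V A
    by (intro hopf_setting.intro cv_context.intro hopf_setting_axioms.intro assms)
  interpret adj: adjunction D H F G "FG_unit V A" "FG_counit V A" by (rule FG_adjunction)
  have "P2" if "P1"
  proof -
    obtain S where "is_antipode V A S" using \<open>P1\<close> by (auto simp: P1_def hopf_category_def)
    then show ?thesis unfolding P2_def X_def
      by (intro inverse_equivalences.intro inverse_equivalences_axioms.intro FG_adjunction FG_unit_iso)
        (auto intro: counit_iso_if_hopf simp: hopf_module_category_simps)
  qed
  moreover have "P3" if "P2"
    using that adj.counit_iso_imp_fully_faithful
    by (simp add: P2_def P3_def X_def inverse_equivalences_def inverse_equivalences_axioms_def)
  moreover have "P4" if "P3"
  proof -
    have "is_iso H (fobj F (fobj G M)) M (FG_counit V A M)" if "hopf_module V A M" for M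
      using adj.fully_faithful_imp_counit_iso[of M] \<open>P3\<close> that
      by (simp add: P3_def X_def hopf_module_category_simps)
    then show ?thesis unfolding P4_def X_def using can_iso_if_counit_iso by blast
  qed
  moreover have "P5" if "P4"
    using that unfolding P4_def P5_def is_iso_def is_inverse_def is_left_inverse_def by blast
  moreover have "P1" if "P5"
  proof -
    have "\<exists>s. s \<in> Hom V (ob A x y) (ob A y x) \<and>
      mult A x y x \<cdot>\<^bsub>V\<^esub> (\<one>\<^bsub>V\<^esub> (ob A x y) \<otimes>\<^bsub>V\<^esub> s) \<cdot>\<^bsub>V\<^esub> comul (coalg A x y) = unity A x \<cdot>\<^bsub>V\<^esub> counit (coalg A x y) \<and>
      mult A y x y \<cdot>\<^bsub>V\<^esub> (s \<otimes>\<^bsub>V\<^esub> \<one>\<^bsub>V\<^esub> (ob A x y)) \<cdot>\<^bsub>V\<^esub> comul (coalg A x y) = unity A y \<cdot>\<^bsub>V\<^esub> counit (coalg A x y)"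
      if xy: "x \<in> base A" "y \<in> base A" for x y
    proof -
      obtain f g where "is_left_inverse V (can_dom V A x x y) (can_cod V A x x y) (can V A x x y) f"
        "is_inverse V (can_dom V A y x y) (can_cod V A y x y) (can V A y x y) g"
        using \<open>P5\<close> xy unfolding P5_def X_def is_iso_def by blast
      then show ?thesis by (rule antipode_component[OF xy])
    qed
    \<comment> \<open>The conditions on an antipode are separate for each pair \<open>x\<close>,
      \<open>y\<close>, so its components are chosen independently.\<close>
    then have "\<exists>S. is_antipode V A S" unfolding is_antipode_def by metis
    then show ?thesis using assms(3) by (simp add: P1_def hopf_category_def)
  qed
  ultimately show ?thesis by blast
qed

end
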